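(* Let $r \geq 5$. If $G$ is a $2$-geodetic digraph with order $n = 2r+1$, size $r^2+2$ and no sources or sinks, then $G$ is isomorphic to one of $A_r$, $B_{r,0}$, $B_{r,r-1}$, $C_r$, $D_r$, or to one of $B_{r,t}$, $B'_{r,t}$ for some $1 \leq t \leq r-2$. The digraphs in this list are pairwise non-isomorphic, so there are exactly $2r+1$ such digraphs up to isomorphism.
   Context: A digraph has a vertex set and an arc set consisting of ordered pairs of distinct vertices. A walk of length $\ell$ is a sequence $x_0x_1\dots x_\ell$ of vertices with $x_i \rightarrow x_{i+1}$ for all $i$. A digraph is $k$-geodetic if for every ordered pair $(u,v)$ of (not necessarily distinct) vertices there is at most one $u,v$-walk of length at most $k$. A source has in-degree $0$, a sink out-degree $0$. Order = number of vertices, size = number of arcs. All the digraphs below have vertex set $\{x,y,z\} \cup \{x_1,\dots,x_{r-1}\} \cup \{y_1,\dots,y_{r-1}\}$, contain the directed triangle $x \rightarrow y \rightarrow z \rightarrow x$, and between $X=\{x_1,\dots,x_{r-1}\}$ and $Y=\{y_1,\dots,y_{r-1}\}$ contain exactly one arc for each pair $(x_i,y_j)$: namely $y_j \rightarrow x_i$ for all $i \neq j$, while the direction of the arc between $x_i$ and $y_i$ is specified below. There are no other arcs than those listed. $A_r$: $x_i \rightarrow y_i$ for $1 \le i \le r-2$, $y_{r-1} \rightarrow x_{r-1}$; $x_{r-1} \rightarrow x$; $x \rightarrow x_i$ for $1 \le i \le r-2$; $y \rightarrow y_{r-1}$; $y_i \rightarrow y$ for $1 \le i \le r-2$. $B_{r,t}$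 ($0 \le t \le r-1$): $x_i \rightarrow y_i$ for all $1 \le i \le r-1$; $x \rightarrow x_i$ for all $1 \le i \le r-1$; $y_i \rightarrow y$ for $1 \le i \le t$; $y_i \rightarrow z$ for $t+1 \le i \le r-1$. $B'_{r,t}$ is the converse of $B_{r,t}$ (all arcs reversed). $C_r$: $x_i \rightarrow y_i$ for $1 \le i \le r-2$, $y_{r-1} \rightarrow x_{r-1}$; $z \rightarrow y_{r-1}$; $x_{r-1} \rightarrow z$; $y \rightarrow x_i$ for $1 \le i \le r-2$; $y_i \rightarrow x$ for $1 \le i \le r-2$. $D_r$: $x_i \rightarrow y_i$ for all $1 \le i \le r-1$; $z \rightarrow x_1$; $y_1 \rightarrow z$; $y \rightarrow x_i$ for $2 \le i \le r-1$; $y_i \rightarrow x$ for $2 \le i \le r-1$. *)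

theory Defs
  imports
    "Graph_Theory.Digraph_Isomorphism"
    "Graph_Theory.Pair_Digraph"
    "Graph_Theory.Vertex_Walk"
begin

text \<open>Walks are sequences of vertices. The walk of length 0 counts as a walk from \<open>u\<close> to \<open>u\<close>, so a
  \<open>k\<close>-geodetic digraph has no closed walk of length between 1 and \<open>k\<close>.\<close>

definition k_geodetic :: "nat \<Rightarrow> 'a pair_pre_digraph \<Rightarrow> bool" where
  "k_geodetic k G \<longleftrightarrow>
     (\<forall>u \<in> pverts G. \<forall>v \<in> pverts G. \<forall>p q.
        vwalk p (with_proj G) \<and> hd p = u \<and> last p = v \<and> vwalk_length p \<le> k \<and>
        vwalk q (with_proj G) \<and> hd q = u \<and> last q = v \<and> vwalk_length q \<le> k \<longrightarrow> p = q)"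

definition is_source :: "'a pair_pre_digraph \<Rightarrow> 'a \<Rightarrow> bool" where
  "is_source G v \<longleftrightarrow> v \<in> pverts G \<and> in_degree (with_proj G) v = 0"

definition is_sink :: "'a pair_pre_digraph \<Rightarrow> 'a \<Rightarrow> bool" where
  "is_sink G v \<longleftrightarrow> v \<in> pverts G \<and> out_degree (with_proj G) v = 0"

definition converse_digraph :: "'a pair_pre_digraph \<Rightarrow> 'a pair_pre_digraph" where
  "converse_digraph G = \<lparr>pverts = pverts G, parcs = (parcs G)\<inverse>\<rparr>"

definition isomorphic :: "'a pair_pre_digraph \<Rightarrow> 'b pair_pre_digraph \<Rightarrow> bool" where
  "isomorphic G H \<longleftrightarrow> digraph_iso (with_proj G) (with_proj H)"

text \<open>\<open>VX i\<close> and \<open>VY i\<close> stand for the vertices \<open>x\<^sub>i\<close> and \<open>y\<^sub>i\<close>, where \<open>1 \<le> i \<le> r - 1\<close>.\<close>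

datatype vertex = Vx | Vy | Vz | VX nat | VY nat

definition std_verts :: "nat \<Rightarrow> vertex set" where
  "std_verts r = {Vx, Vy, Vz} \<union> VX ` {1..r-1} \<union> VY ` {1..r-1}"

text \<open>The arcs common to all digraphs of the list: the directed triangle, and \<open>y\<^sub>j \<rightarrow> x\<^sub>i\<close> for \<open>i \<noteq> j\<close>.\<close>

definition std_arcs :: "nat \<Rightarrow> (vertex \<times> vertex) set" where
  "std_arcs r = {(Vx, Vy), (Vy, Vz), (Vz, Vx)}
     \<union> {(VY j, VX i) | i j. i \<in> {1..r-1} \<and> j \<in> {1..r-1} \<and> i \<noteq> j}"

definition dig_A :: "nat \<Rightarrow> vertex pair_pre_digraph" where
  "dig_A r = \<lparr>pverts = std_verts r,
     parcs = std_arcs r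
       \<union> {(VX i, VY i) | i. i \<in> {1..r-2}}
       \<union> {(VY (r-1), VX (r-1))}
       \<union> {(VX (r-1), Vx)}
       \<union> {(Vx, VX i) | i. i \<in> {1..r-2}}
       \<union> {(Vy, VY (r-1))}
       \<union> {(VY i, Vy) | i. i \<in> {1..r-2}}\<rparr>"

definition dig_B :: "nat \<Rightarrow> nat \<Rightarrow> vertex pair_pre_digraph" where
  "dig_B r t = \<lparr>pverts = std_verts r,
     parcs = std_arcs r
       \<union> {(VX i, VY i) | i. i \<in> {1..r-1}}
       \<union> {(Vx, VX i) | i. i \<in> {1..r-1}}
       \<union> {(VY i, Vy) | i. i \<in> {1..t}}
       \<union> {(VY i, Vz) | i. i \<in> {t+1..r-1}}\<rparr>"

definition dig_B' :: "nat \<Rightarrow> nat \<Rightarrow> vertex pair_pre_digraph" where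
  "dig_B' r t = converse_digraph (dig_B r t)"

definition dig_C :: "nat \<Rightarrow> vertex pair_pre_digraph" where
  "dig_C r = \<lparr>pverts = std_verts r,
     parcs = std_arcs r
       \<union> {(VX i, VY i) | i. i \<in> {1..r-2}}
       \<union> {(VY (r-1), VX (r-1))}
       \<union> {(Vz, VY (r-1))}
       \<union> {(VX (r-1), Vz)}
       \<union> {(Vy, VX i) | i. i \<in> {1..r-2}}
       \<union> {(VY i, Vx) | i. i \<in> {1..r-2}}\<rparr>"

definition dig_D :: "nat \<Rightarrow> vertex pair_pre_digraph" where
  "dig_D r = \<lparr>pverts = std_verts r,
     parcs = std_arcs r
       \<union> {(VX i, VY i) | i. i \<in> {1..r-1}}
       \<union> {(Vz, VX 1)}
       \<union> {(VY 1, Vz)}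
       \<union> {(Vy, VX i) | i. i \<in> {2..r-1}}
       \<union> {(VY i, Vx) | i. i \<in> {2..r-1}}\<rparr>"

text \<open>A list rather than a set, so that pairwise non-isomorphism of its entries also excludes
  that two entries are equal.\<close>

definition dig_list :: "nat \<Rightarrow> vertex pair_pre_digraph list" where
  "dig_list r = [dig_A r, dig_B r 0, dig_B r (r-1), dig_C r, dig_D r]
     @ map (dig_B r) [1..<r-1] @ map (dig_B' r) [1..<r-1]"

definition admissible :: "nat \<Rightarrow> 'a pair_pre_digraph \<Rightarrow> bool" where
  "admissible r G \<longleftrightarrow>
     pair_digraph G \<and> k_geodetic 2 G \<and>
     card (pverts G) = 2 * r + 1 \<and> card (parcs G) = r\<^sup>2 + 2 \<and>
     (\<nexists>v. is_source G v) \<and> (\<nexists>v. is_sink G v)"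

text \<open>Every finite digraph is isomorphic to one whose vertices are natural numbers, so isomorphism
  classes may be counted there.\<close>

definition admissible_iso_classes :: "nat \<Rightarrow> nat pair_pre_digraph set set" where
  "admissible_iso_classes r =
     {G. admissible r G} // {(G, H). admissible r G \<and> admissible r H \<and> isomorphic G H}"

end

theory Submission
  imports Defs
begin

text \<open>In a 2-geodetic digraph every edge lies in at most one triangle, and every triangle is directed.
  If there is no triangle, an arc of maximal degree sum shows that a digraph with \<open>2r + 1\<close> vertices and
  \<open>r\<^sup>2 + 2\<close> arcs is bipartite; then two vertices of the smaller side are joined to the whole larger side,
  and a count of the arcs leaving the larger side yields a source or a sink. If there is a triangle, deleting it
  leaves an extremal digraph on \<open>2 (r - 1)\<close> vertices, which is an orientation of a complete bipartite graph,
  and each of its vertices is joined to exactly one vertex of the triangle. Some vertex of the triangle has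
  two out-neighbours (up to reversal) on one side of the bipartition; this makes the arcs between the
  sides a matching in one direction and its complement in the other, and few cases remain. The digraphs
  found are told apart by degrees along the arcs.\<close>


section \<open>Digraphs as relations\<close>

text \<open>The size \<open>r\<^sup>2 + 2\<close> is exactly what the count around a triangle
  allows. With \<open>s = r - 1\<close>, the triangle has 3 arcs, each of the other
  \<open>2 * s\<close> vertices is joined to at most one triangle vertex because an edge lies in
  only one triangle, and the rest carries at most \<open>s\<^sup>2\<close> arcs; the sum is
  \<open>(s + 1)\<^sup>2 + 2\<close>. All three bounds are attained, which is the source of the
  rigidity.

  The assumption \<open>5 \<le> r\<close> enters through the quarter-square bound on the rest: it
  fails for three vertices, and for six vertices its equality case does not exclude two triangles
  joined by a perfect matching, which have nine arcs.

  Without triangles there is slack, since a complete bipartite graph on \<open>r\<close> and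
  \<open>r + 1\<close> vertices has \<open>r\<^sup>2 + r\<close> edges; there the orientation has to
  be used as well as the count.

  Reversal preserves the assumptions and, up to isomorphism, the list. So the forced arcs are worked
  out only for a triangle vertex with two out-neighbours on one side.\<close>

locale two_geodetic =
  fixes V :: "'v set" and E :: "('v \<times> 'v) set"
  assumes finite_verts: "finite V"
    and arcs_subset: "E \<subseteq> V \<times> V"
    and no_loop: "(u, u) \<notin> E"
    and no_2cycle: "(u, v) \<in> E \<Longrightarrow> (v, u) \<notin> E"
    and no_shortcut: "(u, w) \<in> E \<Longrightarrow> (w, v) \<in> E \<Longrightarrow> (u, v) \<notin> E"
    and unique_mid:
      "(u, w) \<in> E \<Longrightarrow> (w, v) \<in> E \<Longrightarrow> (u, w') \<in> E \<Longrightarrow> (w', v) \<in> E \<Longrightarrow> w = w'"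

lemma vwalk_at_most_2:
  assumes "vwalk p (with_proj G)" "vwalk_length p \<le> 2"
  obtains u where "p = [u]"
    | u v where "p = [u, v]" "(u, v) \<in> parcs G"
    | u w v where "p = [u, w, v]" "(u, w) \<in> parcs G" "(w, v) \<in> parcs G"
proof (cases p rule: vwalk_arcs.cases)
  case 1
  then show ?thesis using assms by (auto simp: vwalk_def)
next
  case (2 u)
  then show ?thesis using that by blast
next
  case (3 u v ps)
  then show ?thesis using assms that by (cases ps) (auto simp: vwalk_def)
qed

text \<open>Walks of equal length 0 or 1 with the same ends coincide anyway. Each remaining pair of
  lengths gives one axiom of the locale: 0 and 1 \<open>no_loop\<close>, 0 and 2
  \<open>no_2cycle\<close>, 1 and 2 \<open>no_shortcut\<close>, 2 and 2
  \<open>unique_mid\<close>.\<close>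

lemma k_geodetic_2_iff:
  assumes "pair_digraph G"
  shows "k_geodetic 2 G \<longleftrightarrow> two_geodetic (pverts G) (parcs G)"
proof -
  interpret pair_digraph G by fact
  have sub: "parcs G \<subseteq> pverts G \<times> pverts G"
    by (auto dest: in_arcsD1 in_arcsD2)
  show ?thesis
  proof
    assume geo: "k_geodetic 2 G"
    have eq: "p = q" if "vwalk p (with_proj G)" "vwalk q (with_proj G)" "hd p = hd q" "last p = last q"
      "length p \<le> 3" "length q \<le> 3" for p q
    proof -
      have "hd p \<in> pverts G" "last p \<in> pverts G"
        using that by (auto simp: vwalk_def)
      moreover have "vwalk_length p \<le> 2" "vwalk_length q \<le> 2"
        using that by simp_all
      ultimately show ?thesis using geo that(1-4) unfolding k_geodetic_def by metis
    qed
    have w1: "vwalk [u] (with_proj G)" if "u \<in> pverts G" for u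
      using that by (auto simp: vwalk_def)
    have w2: "vwalk [u, v] (with_proj G)" if "(u, v) \<in> parcs G" for u v
      using that sub by (auto simp: vwalk_def)
    have w3: "vwalk [u, w, v] (with_proj G)" if "(u, w) \<in> parcs G" "(w, v) \<in> parcs G" for u w v
      using that sub by (auto simp: vwalk_def)
    show "two_geodetic (pverts G) (parcs G)"
    proof
      show "finite (pverts G)" by (rule pair_finite_verts)
      show "parcs G \<subseteq> pverts G \<times> pverts G" by (rule sub)
      show "(u, u) \<notin> parcs G" for u using no_loops' by auto
      show "(v, u) \<notin> parcs G" if "(u, v) \<in> parcs G" for u v
        using eq[OF w1 w3, of u u v] that sub by auto
      show "(u, v) \<notin> parcs G" if "(u, w) \<in> parcs G" "(w, v) \<in> parcs G" for u v w
        using eq[OF w2 w3, of u v u w v] that by auto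
      show "w = w'" if "(u, w) \<in> parcs G" "(w, v) \<in> parcs G" "(u, w') \<in> parcs G" "(w', v) \<in> parcs G"
        for u v w w'
        using eq[OF w3 w3, of u w v u w' v] that by auto
    qed
  next
    assume "two_geodetic (pverts G) (parcs G)"
    then interpret G: two_geodetic "pverts G" "parcs G" .
    show "k_geodetic 2 G"
      unfolding k_geodetic_def
    proof (intro ballI allI impI, elim conjE)
      fix u v p q
      assume p: "vwalk p (with_proj G)" "hd p = u" "last p = v" "vwalk_length p \<le> 2"
        and q: "vwalk q (with_proj G)" "hd q = u" "last q = v" "vwalk_length q \<le> 2"
      show "p = q"
        using p(1,4) by (cases rule: vwalk_at_most_2; use q(1,4) in \<open>cases rule: vwalk_at_most_2\<close>)
          (use p q G.no_loop in \<open>auto dest: G.no_2cycle G.no_shortcut G.unique_mid\<close>)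
    qed
  qed
qed

lemma two_geodetic_pair_digraph:
  assumes "two_geodetic (pverts G) (parcs G)"
  shows "pair_digraph G"
proof -
  interpret two_geodetic "pverts G" "parcs G" by fact
  show ?thesis
    using arcs_subset finite_verts finite_subset[OF arcs_subset] no_loop
    by unfold_locales fastforce+
qed

locale adm = two_geodetic +
  fixes r :: nat
  assumes order: "card V = 2 * r + 1"
    and arcs_card: "card E = r\<^sup>2 + 2"
    and no_source: "v \<in> V \<Longrightarrow> \<exists>u. (u, v) \<in> E"
    and no_sink: "v \<in> V \<Longrightarrow> \<exists>w. (v, w) \<in> E"

lemma admissible_iff: "admissible r G \<longleftrightarrow> adm (pverts G) (parcs G) r"
proof -
  have src: "(\<nexists>v. is_source G v) \<longleftrightarrow> (\<forall>v\<in>pverts G. \<exists>u. (u, v) \<in> parcs G)"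
    and snk: "(\<nexists>v. is_sink G v) \<longleftrightarrow> (\<forall>v\<in>pverts G. \<exists>w. (v, w) \<in> parcs G)" if "pair_digraph G"
  proof -
    interpret pair_digraph G by fact
    have "in_degree (with_proj G) v = 0 \<longleftrightarrow> (\<nexists>u. (u, v) \<in> parcs G)"
      and "out_degree (with_proj G) v = 0 \<longleftrightarrow> (\<nexists>w. (v, w) \<in> parcs G)" for v
      using pair_finite_arcs by (auto simp: in_degree_def in_arcs_def out_degree_def out_arcs_def)
    then show "(\<nexists>v. is_source G v) \<longleftrightarrow> (\<forall>v\<in>pverts G. \<exists>u. (u, v) \<in> parcs G)"
      and "(\<nexists>v. is_sink G v) \<longleftrightarrow> (\<forall>v\<in>pverts G. \<exists>w. (v, w) \<in> parcs G)"
      by (auto simp: is_source_def is_sink_def)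
  qed
  show ?thesis
  proof
    assume "admissible r G"
    then show "adm (pverts G) (parcs G) r"
      using src snk k_geodetic_2_iff[of G] by (auto simp: admissible_def adm_def adm_axioms_def)
  next
    assume "adm (pverts G) (parcs G) r"
    then show "admissible r G"
      using src snk k_geodetic_2_iff[of G] two_geodetic_pair_digraph[of G]
      by (auto simp: admissible_def adm_def adm_axioms_def)
  qed
qed

text \<open>A library isomorphism carries separate maps for vertices, arcs, heads and tails. For
  arcs that are pairs, head and tail are the projections, so the vertex map determines the arc
  map.\<close>

lemma isomorphic_iff:
  assumes "pair_wf_digraph G"
  shows "isomorphic G H \<longleftrightarrow>
    (\<exists>f. inj_on f (pverts G) \<and> pverts H = f ` pverts G \<and> parcs H = map_prod f f ` parcs G)"
proof
  assume "isomorphic G H"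
  then obtain h where h: "pre_digraph.digraph_isomorphism (with_proj G) h"
    and H: "with_proj H = app_iso h (with_proj G)"
    by (auto simp: isomorphic_def digraph_iso_def)
  from H have V: "pverts H = iso_verts h ` pverts G" and A: "parcs H = iso_arcs h ` parcs G"
    and t: "iso_tail h = fst" and hd: "iso_head h = snd"
    by (auto simp: with_proj_def app_iso_def)
  have "iso_arcs h a = map_prod (iso_verts h) (iso_verts h) a" if "a \<in> parcs G" for a
    using h that by (simp add: pre_digraph.digraph_isomorphism_def t hd prod_eq_iff)
  then have "parcs H = map_prod (iso_verts h) (iso_verts h) ` parcs G"
    unfolding A by (rule image_cong[OF refl])
  moreover have "inj_on (iso_verts h) (pverts G)"
    using h by (simp add: pre_digraph.digraph_isomorphism_def)
  ultimately show "\<exists>f. inj_on f (pverts G) \<and> pverts H = f ` pverts G \<and> parcs H = map_prod f f ` parcs G"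
    using V by blast
next
  assume "\<exists>f. inj_on f (pverts G) \<and> pverts H = f ` pverts G \<and> parcs H = map_prod f f ` parcs G"
  then obtain f where f: "inj_on f (pverts G)" "pverts H = f ` pverts G" "parcs H = map_prod f f ` parcs G"
    by blast
  have "parcs G \<subseteq> pverts G \<times> pverts G"
    using assms by (auto simp: pair_wf_digraph_def)
  then have "inj_on (map_prod f f) (parcs G)"
    using map_prod_inj_on[OF f(1) f(1)] inj_on_subset by blast
  then have "pre_digraph.digraph_isomorphism (with_proj G)
      \<lparr>iso_verts = f, iso_arcs = map_prod f f, iso_head = snd, iso_tail = fst\<rparr>"
    using assms f by (simp add: pre_digraph.digraph_isomorphism_def wf_digraph_wp_iff)
  moreover have "with_proj H = app_iso
      \<lparr>iso_verts = f, iso_arcs = map_prod f f, iso_head = snd, iso_tail = fst\<rparr> (with_proj G)"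
    using f by (simp add: with_proj_def app_iso_def)
  ultimately show "isomorphic G H"
    unfolding isomorphic_def digraph_iso_def by blast
qed

lemma isomorphic_sym: "pair_wf_digraph G \<Longrightarrow> isomorphic G H \<Longrightarrow> isomorphic H G"
  by (simp add: isomorphic_def digraph_iso_swap wf_digraph_wp_iff)

lemma isomorphic_trans: "isomorphic G H \<Longrightarrow> isomorphic H K \<Longrightarrow> isomorphic G K"
  unfolding isomorphic_def by (rule digraph_iso_trans)

lemma isomorphic_refl: "pair_wf_digraph G \<Longrightarrow> isomorphic G G"
  by (subst isomorphic_iff) (auto intro!: exI[of _ id] simp: prod.map_id0)

lemma adm_pair_wf_digraph: "adm (pverts G) (parcs G) r \<Longrightarrow> pair_wf_digraph G"
  by (intro pair_digraph.pair_wf_digraph two_geodetic_pair_digraph) (simp add: adm_def)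

lemma adm_image:
  assumes "adm V E r" "inj_on f V"
  shows "adm (f ` V) (map_prod f f ` E) r"
proof -
  interpret adm V E r by fact
  have arc: "(f u, f v) \<in> map_prod f f ` E \<longleftrightarrow> (u, v) \<in> E" if "u \<in> V" "v \<in> V" for u v
    using that assms(2) arcs_subset by (auto dest: inj_onD)
  have arcE: "\<exists>u\<in>V. \<exists>v\<in>V. a = f u \<and> b = f v \<and> (u, v) \<in> E" if "(a, b) \<in> map_prod f f ` E" for a b
    using that arcs_subset by blast
  have inj: "u = v" if "f u = f v" "u \<in> V" "v \<in> V" for u v
    using that assms(2) by (auto dest: inj_onD)
  show ?thesis
  proof
    show "finite (f ` V)" using finite_verts by simp
    show "map_prod f f ` E \<subseteq> f ` V \<times> f ` V" using arcs_subset by auto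
    show "(a, a) \<notin> map_prod f f ` E" for a
      using arcE[of a a] inj no_loop by metis
    show "(b, a) \<notin> map_prod f f ` E" if "(a, b) \<in> map_prod f f ` E" for a b
      using arcE[of a b] arcE[of b a] that inj no_2cycle by metis
    show "(a, b) \<notin> map_prod f f ` E" if "(a, c) \<in> map_prod f f ` E" "(c, b) \<in> map_prod f f ` E" for a b c
      using arcE[OF that(1)] arcE[OF that(2)] arcE[of a b] inj no_shortcut by metis
    show "c = d" if "(a, c) \<in> map_prod f f ` E" "(c, b) \<in> map_prod f f ` E"
      "(a, d) \<in> map_prod f f ` E" "(d, b) \<in> map_prod f f ` E" for a b c d
      using arcE[OF that(1)] arcE[OF that(2)] arcE[OF that(3)] arcE[OF that(4)] inj unique_mid by metis
    show "card (f ` V) = 2 * r + 1" using assms(2) order by (simp add: card_image)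
    have "inj_on (map_prod f f) E"
      using map_prod_inj_on[OF assms(2) assms(2)] arcs_subset inj_on_subset by blast
    then show "card (map_prod f f ` E) = r\<^sup>2 + 2" using arcs_card by (simp add: card_image)
    show "\<exists>u. (u, v) \<in> map_prod f f ` E" if "v \<in> f ` V" for v
      using that no_source by (metis imageE map_prod_imageI)
    show "\<exists>w. (v, w) \<in> map_prod f f ` E" if "v \<in> f ` V" for v
      using that no_sink by (metis imageE map_prod_imageI)
  qed
qed

lemma (in two_geodetic) two_geodetic_converse: "two_geodetic V (E\<inverse>)"
proof
  show "finite V" by (rule finite_verts)
  show "E\<inverse> \<subseteq> V \<times> V" using arcs_subset by auto
  show "(u, u) \<notin> E\<inverse>" for u using no_loop by simp
  show "(v, u) \<notin> E\<inverse>" if "(u, v) \<in> E\<inverse>" for u v using no_2cycle that by simp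
  show "(u, v) \<notin> E\<inverse>" if "(u, w) \<in> E\<inverse>" "(w, v) \<in> E\<inverse>" for u w v
    using no_shortcut that by simp
  show "w = w'" if "(u, w) \<in> E\<inverse>" "(w, v) \<in> E\<inverse>" "(u, w') \<in> E\<inverse>" "(w', v) \<in> E\<inverse>"
    for u v w w'
    using unique_mid[of v w u w'] that by simp
qed

lemma (in adm) adm_converse: "adm V (E\<inverse>) r"
proof -
  interpret c: two_geodetic V "E\<inverse>" by (rule two_geodetic_converse)
  show ?thesis
    by unfold_locales (use order arcs_card no_source no_sink in auto)
qed

text \<open>Since both arc sets have the same finite size, it suffices to map arcs to arcs.\<close>

lemma isomorphicI:
  assumes "pair_digraph H" "finite (parcs G)" "card (parcs G) = card (parcs H)"
    and "inj_on f (pverts H)" "f ` pverts H = pverts G"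
    and "\<And>u v. (u, v) \<in> parcs H \<Longrightarrow> (f u, f v) \<in> parcs G"
  shows "isomorphic G H"
proof -
  interpret H: pair_digraph H by fact
  have sub: "parcs H \<subseteq> pverts H \<times> pverts H"
    by (auto dest: H.in_arcsD1 H.in_arcsD2)
  then have "inj_on (map_prod f f) (parcs H)"
    using map_prod_inj_on[OF assms(4) assms(4)] inj_on_subset by blast
  then have "card (map_prod f f ` parcs H) = card (parcs G)"
    using assms(3) by (simp add: card_image)
  moreover have "map_prod f f ` parcs H \<subseteq> parcs G"
    using assms(6) by auto
  ultimately have "map_prod f f ` parcs H = parcs G"
    using assms(2) by (intro card_subset_eq)
  then have "isomorphic H G"
    using isomorphic_iff[OF H.pair_wf_digraph] assms(4,5) by metis
  then show ?thesis by (rule isomorphic_sym[OF H.pair_wf_digraph])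
qed

section \<open>Extremal bounds\<close>

text \<open>Cauchy-Schwarz against a constant function: expand the nonnegative sum of
  \<open>(n * d u - m)\<^sup>2\<close> with \<open>n = card W\<close>, where multiplying by
  \<open>n\<close> replaces division, and cancel \<open>n\<close>. The integers permit the
  subtraction.\<close>

lemma sum_square_ge:
  fixes d :: "'a \<Rightarrow> nat"
  assumes "finite W" "sum d W = m"
  shows "m\<^sup>2 \<le> card W * (\<Sum>u\<in>W. (d u)\<^sup>2)"
proof (cases "W = {}")
  case False
  then have n: "0 < int (card W)" using assms(1) by (simp add: card_gt_0_iff)
  have D: "(\<Sum>u\<in>W. int (d u)) = int m"
    using assms(2) by (simp flip: of_nat_sum)
  have "0 \<le> (\<Sum>u\<in>W. (int (card W) * int (d u) - int m)\<^sup>2)"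
    by (simp add: sum_nonneg)
  also have "\<dots> = (\<Sum>u\<in>W. (int (card W))\<^sup>2 * (int (d u))\<^sup>2 - 2 * int (card W) * int m * int (d u) + (int m)\<^sup>2)"
    by (intro sum.cong) (simp_all add: power2_eq_square algebra_simps)
  also have "\<dots> = (int (card W))\<^sup>2 * (\<Sum>u\<in>W. (int (d u))\<^sup>2)
      - 2 * int (card W) * int m * (\<Sum>u\<in>W. int (d u)) + int (card W) * (int m)\<^sup>2"
    by (simp add: sum.distrib sum_subtractf sum_distrib_left)
  also have "\<dots> = int (card W) * (int (card W) * (\<Sum>u\<in>W. (int (d u))\<^sup>2) - (int m)\<^sup>2)"
    unfolding D by (simp add: power2_eq_square algebra_simps)
  finally have "0 \<le> int (card W) * (\<Sum>u\<in>W. (int (d u))\<^sup>2) - (int m)\<^sup>2"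
    using n zero_le_mult_iff[of "int (card W)"] by auto
  then have "int (m\<^sup>2) \<le> int (card W * (\<Sum>u\<in>W. (d u)\<^sup>2))"
    by simp
  then show ?thesis by (simp only: of_nat_le_iff)
qed (use assms in simp)

lemma two_elements: "2 \<le> card A \<Longrightarrow> \<exists>a\<in>A. \<exists>b\<in>A. a \<noteq> b"
  using card_le_Suc0_iff_eq[of A] card.infinite[of A] by force

section \<open>The underlying undirected graph: degrees, triangles and bounds on the number of
  arcs\<close>

context two_geodetic
begin

definition adj :: "'v \<Rightarrow> 'v \<Rightarrow> bool" where
  "adj u v \<longleftrightarrow> (u, v) \<in> E \<or> (v, u) \<in> E"

definition nb :: "'v set \<Rightarrow> 'v \<Rightarrow> 'v set" where
  "nb W u = {v \<in> W. adj u v}"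

definition arcs_in :: "'v set \<Rightarrow> ('v \<times> 'v) set" where
  "arcs_in W = E \<inter> W \<times> W"

lemma adj_commute: "adj u v \<longleftrightarrow> adj v u"
  by (auto simp: adj_def)

lemma adj_irrefl: "\<not> adj u u"
  by (simp add: adj_def no_loop)

lemma finite_arcs: "finite E"
  using finite_subset[OF arcs_subset] finite_verts by simp

lemma finite_arcs_in: "finite (arcs_in W)"
  by (simp add: arcs_in_def finite_arcs)

lemma arcs_in_V: "arcs_in V = E"
  using arcs_subset by (auto simp: arcs_in_def)

text \<open>If the triangle were not cyclic, one of its arcs would bypass the walk of length 2
  formed by the other two.\<close>

lemma triangle_directed:
  assumes "(u, v) \<in> E" "adj u w" "adj v w"
  shows "(v, w) \<in> E \<and> (w, u) \<in> E"
  using assms no_shortcut[of u w v] no_shortcut[of u v w] no_shortcut[of w u v]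
  by (auto simp: adj_def)

text \<open>Both triangles are cyclic, so both third vertices are midpoints of a walk of length 2
  from the head of the common arc to its tail.\<close>

lemma edge_in_one_triangle:
  assumes "adj u v" "adj u w" "adj v w" "adj u w'" "adj v w'"
  shows "w = w'"
proof -
  have "w = w'" if "(a, b) \<in> E" "adj a w" "adj b w" "adj a w'" "adj b w'" for a b
    using triangle_directed[OF that(1-3)] triangle_directed[OF that(1,4,5)] unique_mid by blast
  then show ?thesis using assms unfolding adj_def by blast
qed

lemma card_nb:
  assumes "finite W"
  shows "card (nb W u) = card {v\<in>W. (u, v) \<in> E} + card {v\<in>W. (v, u) \<in> E}"
proof -
  have "nb W u = {v\<in>W. (u, v) \<in> E} \<union> {v\<in>W. (v, u) \<in> E}"
    by (auto simp: nb_def adj_def)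
  moreover have "{v\<in>W. (u, v) \<in> E} \<inter> {v\<in>W. (v, u) \<in> E} = {}"
    using no_2cycle by auto
  ultimately show ?thesis using assms by (simp add: card_Un_disjoint)
qed

lemma sum_arcs_tail:
  fixes f :: "'v \<Rightarrow> nat"
  assumes "finite W"
  shows "(\<Sum>(u, v)\<in>arcs_in W. f u) = (\<Sum>u\<in>W. card {v\<in>W. (u, v) \<in> E} * f u)"
proof -
  have "arcs_in W = Sigma W (\<lambda>u. {v\<in>W. (u, v) \<in> E})"
    by (auto simp: arcs_in_def)
  then show ?thesis using assms by (simp flip: sum.Sigma)
qed

lemma sum_arcs_head:
  fixes f :: "'v \<Rightarrow> nat"
  assumes "finite W"
  shows "(\<Sum>(u, v)\<in>arcs_in W. f v) = (\<Sum>u\<in>W. card {v\<in>W. (v, u) \<in> E} * f u)"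
proof -
  have "(\<Sum>(u, v)\<in>arcs_in W. f v) = (\<Sum>(u, v)\<in>Sigma W (\<lambda>u. {v\<in>W. (v, u) \<in> E}). f u)"
    by (rule sum.reindex_bij_witness[of _ prod.swap prod.swap]) (auto simp: arcs_in_def)
  then show ?thesis using assms by (simp flip: sum.Sigma)
qed

lemma handshake:
  assumes "finite W"
  shows "(\<Sum>u\<in>W. card (nb W u)) = 2 * card (arcs_in W)"
  using sum_arcs_tail[OF assms, of "\<lambda>_. 1"] sum_arcs_head[OF assms, of "\<lambda>_. 1"] assms
  by (simp add: card_nb sum.distrib case_prod_beta)

text \<open>Double counting: a vertex contributes its degree once for each arc at it, hence the
  square of its degree.\<close>

lemma sum_arcs_nb:
  assumes "finite W"
  shows "(\<Sum>(u, v)\<in>arcs_in W. card (nb W u) + card (nb W v)) = (\<Sum>u\<in>W. (card (nb W u))\<^sup>2)"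
proof -
  have "(\<Sum>(u, v)\<in>arcs_in W. card (nb W u) + card (nb W v))
      = (\<Sum>(u, v)\<in>arcs_in W. card (nb W u)) + (\<Sum>(u, v)\<in>arcs_in W. card (nb W v))"
    by (simp add: sum.distrib case_prod_beta)
  also have "\<dots> = (\<Sum>u\<in>W. card {v\<in>W. (u, v) \<in> E} * card (nb W u)
      + card {v\<in>W. (v, u) \<in> E} * card (nb W u))"
    by (simp add: sum.distrib sum_arcs_tail[OF assms] sum_arcs_head[OF assms])
  also have "\<dots> = (\<Sum>u\<in>W. (card (nb W u))\<^sup>2)"
    by (intro sum.cong) (simp_all add: card_nb[OF assms] power2_eq_square algebra_simps)
  finally show ?thesis .
qed

text \<open>Such an arc has at least average degree sum. By \<open>sum_arcs_nb\<close> the average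
  over the \<open>e\<close> arcs is the sum of the squared degrees divided by \<open>e\<close>;
  since the degrees sum to \<open>2 * e\<close>, this is at least
  \<open>4 * e / card W\<close>.\<close>

lemma heavy_arc:
  assumes "finite W" "arcs_in W \<noteq> {}"
  shows "\<exists>(u, v)\<in>arcs_in W. 4 * card (arcs_in W) \<le> card W * (card (nb W u) + card (nb W v))"
proof (rule ccontr)
  let ?e = "card (arcs_in W)"
  assume "\<not> ?thesis"
  then have "card W * (card (nb W u) + card (nb W v)) < 4 * ?e" if "(u, v) \<in> arcs_in W" for u v
    using that by fastforce
  then have "(\<Sum>(u, v)\<in>arcs_in W. card W * (card (nb W u) + card (nb W v)))
      < (\<Sum>(u, v)\<in>arcs_in W. 4 * ?e)"
    using assms(2) by (intro sum_strict_mono) (auto simp: finite_arcs_in)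
  also have "\<dots> = 4 * ?e\<^sup>2"
    by (simp add: power2_eq_square case_prod_beta)
  finally have "(\<Sum>(u, v)\<in>arcs_in W. card W * (card (nb W u) + card (nb W v))) < 4 * ?e\<^sup>2" .
  moreover have "(\<Sum>(u, v)\<in>arcs_in W. card W * (card (nb W u) + card (nb W v)))
      = card W * (\<Sum>u\<in>W. (card (nb W u))\<^sup>2)"
    unfolding sum_arcs_nb[OF assms(1), symmetric] by (simp add: sum_distrib_left case_prod_beta)
  moreover have "(2 * ?e)\<^sup>2 \<le> card W * (\<Sum>u\<in>W. (card (nb W u))\<^sup>2)"
    by (rule sum_square_ge[OF assms(1) handshake[OF assms(1)]])
  ultimately show False by (simp add: power_mult_distrib)
qed

text \<open>The trivial bound by the number of pairs. It handles the remainders of fewer than four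
  vertices in \<open>arcs_in_bound\<close>.\<close>

lemma double_arcs_in_le:
  assumes "finite W"
  shows "2 * card (arcs_in W) \<le> card W * (card W - 1)"
proof -
  have "card (nb W u) \<le> card W - 1" if "u \<in> W" for u
  proof -
    have "nb W u \<subseteq> W - {u}" by (auto simp: nb_def adj_irrefl)
    then show ?thesis using that assms card_mono[of "W - {u}"] by fastforce
  qed
  then have "(\<Sum>u\<in>W. card (nb W u)) \<le> (\<Sum>u\<in>W. card W - 1)"
    by (rule sum_mono)
  then show ?thesis using handshake[OF assms] by simp
qed

definition triangle :: "'v \<Rightarrow> 'v \<Rightarrow> 'v \<Rightarrow> bool" where
  "triangle x y z \<longleftrightarrow> (x, y) \<in> E \<and> (y, z) \<in> E \<and> (z, x) \<in> E"

lemma triangle_free_nb: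
  assumes "(u, v) \<in> E" "u \<in> W" "v \<in> W" "\<And>w. w \<in> W \<Longrightarrow> \<not> triangle u v w"
  shows "nb W u \<inter> nb W v = {}"
  using triangle_directed[OF assms(1)] assms(1,4) by (auto simp: nb_def triangle_def)

lemma card_nb_triangle_free:
  assumes "finite W" "(u, v) \<in> E" "u \<in> W" "v \<in> W" "\<And>w. w \<in> W \<Longrightarrow> \<not> triangle u v w"
  shows "card (nb W u \<union> nb W v) = card (nb W u) + card (nb W v)"
    and "card (nb W u) + card (nb W v) \<le> card W"
proof -
  have fin: "finite (nb W a)" for a using assms(1) by (simp add: nb_def)
  show eq: "card (nb W u \<union> nb W v) = card (nb W u) + card (nb W v)"
    using triangle_free_nb[OF assms(2-5)] fin by (simp add: card_Un_disjoint)
  show "card (nb W u) + card (nb W v) \<le> card W"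
    unfolding eq[symmetric] using assms(1) by (intro card_mono) (auto simp: nb_def)
qed

definition cross :: "'v set \<Rightarrow> 'v set \<Rightarrow> ('v \<times> 'v) set" where
  "cross A B = {(a, b). a \<in> A \<and> b \<in> B \<and> adj a b}"

lemma card_arcs_in_Un:
  assumes "finite A" "finite B" "A \<inter> B = {}"
  shows "card (arcs_in (A \<union> B)) = card (arcs_in A) + card (arcs_in B) + card (cross A B)"
proof -
  let ?X = "E \<inter> (A \<times> B \<union> B \<times> A)"
  \<comment> \<open>Turns every arc between the sides so that it starts in \<open>A\<close>; this is
    injective since no pair carries arcs in both directions.\<close>
  let ?f = "\<lambda>(a, b). if a \<in> A then (a, b) else (b, a)"
  have inj: "inj_on ?f ?X"
    using assms(3) no_2cycle by (auto simp: inj_on_def split: if_splits)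
  have img: "?f ` ?X = cross A B"
  proof (intro set_eqI iffI)
    fix p assume "p \<in> ?f ` ?X"
    then show "p \<in> cross A B"
      using assms(3) by (auto simp: cross_def adj_def split: if_splits)
  next
    fix p assume "p \<in> cross A B"
    then obtain a b where p: "p = (a, b)" "a \<in> A" "b \<in> B" "adj a b" by (auto simp: cross_def)
    moreover have "b \<notin> A" using p assms(3) by blast
    ultimately consider "(a, b) \<in> ?X" "?f (a, b) = p" | "(b, a) \<in> ?X" "?f (b, a) = p"
      by (auto simp: adj_def)
    then show "p \<in> ?f ` ?X"
    proof cases
      case 1
      then show ?thesis using image_eqI[where f = ?f, OF 1(2)[symmetric] 1(1)] by simp
    next
      case 2
      then show ?thesis using image_eqI[where f = ?f, OF 2(2)[symmetric] 2(1)] by simp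
    qed
  qed
  have X: "card ?X = card (cross A B)"
    by (rule card_image[OF inj, unfolded img, symmetric])
  have "arcs_in (A \<union> B) = arcs_in A \<union> arcs_in B \<union> ?X"
    by (auto simp: arcs_in_def)
  moreover have "arcs_in A \<inter> arcs_in B = {}" "(arcs_in A \<union> arcs_in B) \<inter> ?X = {}"
    using assms(3) unfolding arcs_in_def by blast+
  ultimately show ?thesis
    using X finite_arcs by (simp add: card_Un_disjoint finite_arcs_in)
qed

lemma triangle_distinct:
  assumes "triangle x y z"
  shows "x \<noteq> y" "y \<noteq> z" "x \<noteq> z"
  using assms no_loop by (auto simp: triangle_def)

lemma triangle_card_arcs:
  assumes "triangle x y z"
  shows "card (arcs_in {x, y, z}) = 3"
proof -
  have "arcs_in {x, y, z} = {(x, y), (y, z), (z, x)}"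
    using assms no_loop no_2cycle by (auto simp: arcs_in_def triangle_def)
  then show ?thesis using triangle_distinct[OF assms] by simp
qed

text \<open>Two triangle vertices with a common neighbour \<open>w\<close> outside would put a
  second triangle on the edge joining them.\<close>

lemma triangle_one_nb:
  assumes "triangle x y z" "w \<notin> {x, y, z}" "a \<in> {x, y, z}" "b \<in> {x, y, z}" "adj a w" "adj b w"
  shows "a = b"
proof -
  have adj: "adj x y" "adj y z" "adj x z" using assms(1) by (auto simp: triangle_def adj_def)
  have "\<not> (adj x w \<and> adj y w)"
    using edge_in_one_triangle[OF adj(1), of z w] adj assms(2) by auto
  moreover have "\<not> (adj y w \<and> adj z w)"
    using edge_in_one_triangle[OF adj(2), of x w] adj assms(2) adj_commute by auto
  moreover have "\<not> (adj x w \<and> adj z w)"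
    using edge_in_one_triangle[OF adj(3), of y w] adj assms(2) adj_commute by auto
  ultimately show ?thesis using assms(3-6) by auto
qed

text \<open>By \<open>triangle_one_nb\<close>, projecting the edges between the triangle and
  \<open>W\<close> to their end in \<open>W\<close> is injective; if their number is
  \<open>card W\<close>, the projection is also onto.\<close>

lemma card_cross_triangle:
  assumes "triangle x y z" "finite W" "W \<inter> {x, y, z} = {}"
  shows "card (cross {x, y, z} W) \<le> card W"
    and "card (cross {x, y, z} W) = card W \<Longrightarrow> w \<in> W \<Longrightarrow> adj x w \<or> adj y w \<or> adj z w"
proof -
  let ?C = "cross {x, y, z} W"
  have inj: "inj_on snd ?C"
  proof (rule inj_onI, clarsimp simp: cross_def)
    fix a b w assume "a = x \<or> a = y \<or> a = z" "w \<in> W" "adj a w" "b = x \<or> b = y \<or> b = z" "adj b w"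
    then show "a = b" using triangle_one_nb[OF assms(1), of w a b] assms(3) by blast
  qed
  have sub: "snd ` ?C \<subseteq> W" by (auto simp: cross_def)
  show "card ?C \<le> card W"
    using card_mono[OF assms(2) sub] inj by (simp add: card_image)
  show "adj x w \<or> adj y w \<or> adj z w" if "card ?C = card W" "w \<in> W"
  proof -
    have "snd ` ?C = W"
      using card_subset_eq[OF assms(2) sub] inj that(1) by (simp add: card_image)
    then show ?thesis using that(2) by (auto simp: cross_def)
  qed
qed

lemma arcs_in_remove_triangle:
  assumes "triangle x y z" "{x, y, z} \<subseteq> W" "finite W"
  shows "card (W - {x, y, z}) = card W - 3" "3 \<le> card W"
    and "card (arcs_in W) = 3 + card (arcs_in (W - {x, y, z})) + card (cross {x, y, z} (W - {x, y, z}))"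
proof -
  have c: "card {x, y, z} = 3" using triangle_distinct[OF assms(1)] by simp
  show "card (W - {x, y, z}) = card W - 3"
    using c assms(2) by (metis card_Diff_subset finite.emptyI finite.insertI)
  show "3 \<le> card W" using card_mono[OF assms(3,2)] c by simp
  have W: "W = {x, y, z} \<union> (W - {x, y, z})" using assms(2) by auto
  show "card (arcs_in W) = 3 + card (arcs_in (W - {x, y, z})) + card (cross {x, y, z} (W - {x, y, z}))"
    by (subst W, subst card_arcs_in_Un) (use assms(3) triangle_card_arcs[OF assms(1)] in auto)
qed

text \<open>Mantel's bound, but with triangles permitted. Deleting a triangle from \<open>n\<close>
  vertices costs at most \<open>3 + (n - 3) = n\<close> arcs, while a quarter of the square drops by
  \<open>(6 * n - 9) / 4\<close>, which is at least \<open>n\<close> from \<open>n = 5\<close> on.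
  Without triangles the ends of a heavy arc have disjoint neighbourhoods, so its degree sum is at
  most \<open>n\<close>.\<close>

lemma arcs_in_bound:
  assumes "finite W" "4 \<le> card W"
  shows "4 * card (arcs_in W) \<le> (card W)\<^sup>2"
  using assms
proof (induction "card W" arbitrary: W rule: less_induct)
  case less
  show ?case
  proof (cases "\<exists>x\<in>W. \<exists>y\<in>W. \<exists>z\<in>W. triangle x y z")
    case True
    then obtain x y z where T: "triangle x y z" "{x, y, z} \<subseteq> W" by blast
    let ?W = "W - {x, y, z}"
    note rem = arcs_in_remove_triangle[OF T less.prems(1)]
    have fin: "finite ?W" using less.prems(1) by simp
    have "card (cross {x, y, z} ?W) \<le> card W - 3"
      using card_cross_triangle(1)[OF T(1) fin] rem(1) by auto
    then have le: "card (arcs_in W) \<le> card W + card (arcs_in ?W)"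
      using rem by linarith
    show ?thesis
    proof (cases "4 \<le> card ?W")
      case True
      then have IH: "4 * card (arcs_in ?W) \<le> (card W - 3)\<^sup>2"
        using less.hyps[of ?W] fin rem(1,2) by simp
      obtain n where n: "card W = n + 3" using rem(2) by (metis le_add_diff_inverse2)
      then have "4 \<le> n" using True rem(1) by simp
      then show ?thesis using IH le unfolding n by (simp add: power2_eq_square algebra_simps)
    next
      case False
      \<comment> \<open>The remainder has 1, 2 or 3 vertices, hence at most 0, 1 or 3 arcs; the
        totals 4, 6 and 9 just satisfy the bound for 4, 5 and 6 vertices.\<close>
      then have "card W \<in> {4, 5, 6}" using rem(1) less.prems(2) by auto
      then show ?thesis
        using le double_arcs_in_le[OF fin] rem(1) by (auto simp: power2_eq_square)
    qed
  next
    case False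
    show ?thesis
    proof (cases "arcs_in W = {}")
      case nonempty: False
      obtain u v where uv: "(u, v) \<in> arcs_in W"
        "4 * card (arcs_in W) \<le> card W * (card (nb W u) + card (nb W v))"
        using heavy_arc[OF less.prems(1) nonempty] by blast
      then have "card (nb W u) + card (nb W v) \<le> card W"
        using card_nb_triangle_free(2)[OF less.prems(1), of u v] False by (auto simp: arcs_in_def)
      then have "card W * (card (nb W u) + card (nb W v)) \<le> (card W)\<^sup>2"
        unfolding power2_eq_square by (rule mult_le_mono2)
      then show ?thesis using uv(2) by linarith
    qed simp
  qed
qed

lemma nb_independent:
  assumes "\<forall>x\<in>W. \<forall>y\<in>W. \<forall>z\<in>W. \<not> triangle x y z" "u \<in> W" "a \<in> nb W u" "b \<in> nb W u"
  shows "\<not> adj a b"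
proof
  assume "adj a b"
  moreover have False if "(c, d) \<in> E" "c \<in> nb W u" "d \<in> nb W u" for c d
  proof -
    have "adj c u" "adj d u" "c \<in> W" "d \<in> W"
      using that(2,3) adj_commute[of u] by (simp_all add: nb_def)
    then show False
      using triangle_directed[OF that(1), of u] that(1) assms(1,2) unfolding triangle_def by blast
  qed
  ultimately show False using assms(3,4) by (auto simp: adj_def)
qed

lemma arcs_in_independent:
  assumes "\<And>a b. a \<in> A \<Longrightarrow> b \<in> A \<Longrightarrow> \<not> adj a b"
  shows "arcs_in A = {}"
  using assms by (auto simp: arcs_in_def adj_def)

text \<open>The equality case of \<open>arcs_in_bound\<close>. A triangle would give
  \<open>4 * s\<^sup>2 \<le> 8 * s + (2 * s - 3)\<^sup>2\<close>, which is false;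
  \<open>4 \<le> s\<close> leaves enough vertices outside the triangle for the bound to apply to
  them. Then the neighbourhoods of the ends of a heavy arc fill \<open>W\<close>, are independent,
  and carry \<open>s\<^sup>2\<close> arcs between them only if they are balanced and completely
  joined.\<close>

lemma extremal_structure:
  assumes "finite W" "card W = 2 * s" "4 \<le> s" "s\<^sup>2 \<le> card (arcs_in W)"
  obtains A B where "W = A \<union> B" "A \<inter> B = {}" "card A = s" "card B = s"
    "\<And>a b. a \<in> A \<Longrightarrow> b \<in> A \<Longrightarrow> \<not> adj a b" "\<And>a b. a \<in> B \<Longrightarrow> b \<in> B \<Longrightarrow> \<not> adj a b"
    "\<And>a b. a \<in> A \<Longrightarrow> b \<in> B \<Longrightarrow> adj a b"
proof -
  have free: "\<forall>x\<in>W. \<forall>y\<in>W. \<forall>z\<in>W. \<not> triangle x y z"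
  proof (rule ccontr)
    assume "\<not> ?thesis"
    then obtain x y z where T: "triangle x y z" "{x, y, z} \<subseteq> W" by blast
    let ?W = "W - {x, y, z}"
    note rem = arcs_in_remove_triangle[OF T assms(1)]
    have fin: "finite ?W" using assms(1) by simp
    have "card (cross {x, y, z} ?W) \<le> 2 * s - 3"
      using card_cross_triangle(1)[OF T(1) fin] rem(1) assms(2) by auto
    then have le: "card (arcs_in W) \<le> 2 * s + card (arcs_in ?W)"
      using rem assms(2) by linarith
    have "4 * card (arcs_in ?W) \<le> (2 * s - 3)\<^sup>2"
      using arcs_in_bound[OF fin] rem(1) assms(2,3) by simp
    then have "4 * s\<^sup>2 \<le> 8 * s + (2 * s - 3)\<^sup>2" using le assms(4) by linarith
    moreover obtain k where "s = k + 4" using assms(3) by (metis le_add_diff_inverse2)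
    ultimately show False by (simp add: power2_eq_square algebra_simps)
  qed
  have "0 < s\<^sup>2" using assms(3) by simp
  then have "arcs_in W \<noteq> {}" using assms(4) by force
  then obtain u v where uv: "(u, v) \<in> arcs_in W"
    "4 * card (arcs_in W) \<le> card W * (card (nb W u) + card (nb W v))"
    using heavy_arc[OF assms(1)] by blast
  define A where "A = nb W u"
  define B where "B = nb W v"
  have fin: "finite A" "finite B" using assms(1) by (auto simp: A_def B_def nb_def)
  have "4 * s\<^sup>2 \<le> 4 * card (arcs_in W)"
    using assms(4) by simp
  also have "\<dots> \<le> 2 * s * (card A + card B)"
    using uv(2) unfolding A_def B_def assms(2) .
  finally have "4 * s\<^sup>2 \<le> 2 * s * (card A + card B)" .
  then have "2 * s * (2 * s) \<le> 2 * s * (card A + card B)" by (simp add: power2_eq_square)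
  then have ge: "2 * s \<le> card A + card B" using assms(3) nat_mult_le_cancel1[of "2 * s"] by simp
  have disj: "A \<inter> B = {}" and cu: "card (A \<union> B) = card A + card B" and "card A + card B \<le> 2 * s"
    using triangle_free_nb[of u v W] card_nb_triangle_free[OF assms(1), of u v] free uv(1) assms(2)
    by (auto simp: A_def B_def arcs_in_def)
  with ge have s2: "card A + card B = 2 * s" by simp
  have W: "W = A \<union> B"
    using card_subset_eq[OF assms(1), of "A \<union> B"] cu s2 assms(2) by (auto simp: A_def B_def nb_def)
  have indA: "\<not> adj a b" if "a \<in> A" "b \<in> A" for a b
    using nb_independent[OF free, of u a b] that uv(1) by (auto simp: A_def arcs_in_def)
  have indB: "\<not> adj a b" if "a \<in> B" "b \<in> B" for a b
    using nb_independent[OF free, of v a b] that uv(1) by (auto simp: B_def arcs_in_def)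
  have cross: "card (arcs_in W) = card (cross A B)"
    unfolding W card_arcs_in_Un[OF fin disj]
    using arcs_in_independent[OF indA] arcs_in_independent[OF indB] by simp
  have sub: "cross A B \<subseteq> A \<times> B" by (auto simp: cross_def)
  have "s * s \<le> card A * card B"
    using card_mono[OF _ sub] fin assms(4) cross by (simp add: card_cartesian_product power2_eq_square)
  \<comment> \<open>With the sum \<open>2 * s\<close> fixed, the product of the sizes is
    \<open>s\<^sup>2\<close> minus the square of the deviation from \<open>s\<close>.\<close>
  moreover have "card A = s \<and> card B = s \<and> card A * card B = s * s \<or> card A * card B < s * s"
  proof -
    have cB: "int (card B) = 2 * int s - int (card A)" using s2 by simp
    have "int (card A) * int (card B) = int s * int s - (int (card A) - int s)\<^sup>2"
      unfolding cB by (simp add: power2_eq_square algebra_simps)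
    moreover have "0 < (int (card A) - int s)\<^sup>2" if "card A \<noteq> s" using that by simp
    ultimately have "card A = s \<or> int (card A * card B) < int (s * s)" by fastforce
    then have "card A = s \<or> card A * card B < s * s" by (simp only: of_nat_less_iff)
    then show ?thesis using s2 by auto
  qed
  ultimately have cs: "card A = s" "card B = s" by auto
  then have "card (cross A B) = card (A \<times> B)"
    using card_mono[OF _ sub] fin cross assms(4) by (simp add: card_cartesian_product power2_eq_square)
  then have "cross A B = A \<times> B" using sub fin by (intro card_subset_eq) auto
  then have "adj a b" if "a \<in> A" "b \<in> B" for a b
    using that by (auto simp: cross_def)
  with W disj cs indA indB show thesis by (rule that)
qed

end

section \<open>The triangle-free case\<close>

context two_geodetic
begin

lemma adj_converse: "two_geodetic.adj (E\<inverse>) = adj"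
  by (auto simp: fun_eq_iff adj_def two_geodetic.adj_def[OF two_geodetic_converse])

text \<open>Each \<open>p\<close> in \<open>A\<close> turns out to receive at most one arc from
  \<open>B\<close>, while every vertex of \<open>B\<close> sends one: the smaller side has too few
  receivers. The tool is \<open>RS\<close>: the out-neighbours of \<open>p\<close> and the
  in-neighbours of \<open>p'\<close> share at most one vertex of \<open>B\<close>. It bounds
  \<open>S p\<close> as soon as \<open>S p\<close> lies in some \<open>R p'\<close>.\<close>

lemma few_in_arcs:
  assumes fin: "finite A" "finite B" and less: "card A < card B"
    and out: "\<And>q. q \<in> B \<Longrightarrow> \<exists>p\<in>A. (q, p) \<in> E"
    and p1: "p1 \<in> A" "\<And>q. q \<in> B \<Longrightarrow> adj p1 q"
    and p2: "p2 \<in> A" "\<And>q. q \<in> B \<Longrightarrow> adj p2 q"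
    and disj: "\<And>q. q \<in> B \<Longrightarrow> (q, p1) \<in> E \<Longrightarrow> (q, p2) \<notin> E"
    and ne: "p1 \<noteq> p2"
    and deg: "\<And>p. p \<in> A \<Longrightarrow> 3 \<le> card (nb B p)"
  shows False
proof -
  define R where "R p = {q\<in>B. (p, q) \<in> E}" for p
  define S where "S p = {q\<in>B. (q, p) \<in> E}" for p
  have finRS: "finite (R p)" "finite (S p)" for p using fin by (auto simp: R_def S_def)
  have RS: "card (R p \<inter> S p') \<le> 1" for p p'
    using unique_mid[of p _ p'] finRS(1)[of p]
    by (subst One_nat_def, subst card_le_Suc0_iff_eq) (auto simp: R_def S_def)
  have le1: "card (S p) \<le> 1" if "(\<And>q. q \<in> S p \<Longrightarrow> (p', q) \<in> E)" for p p'
  proof -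
    have "S p = R p' \<inter> S p" using that by (auto simp: R_def S_def)
    then show ?thesis using RS[of p' p] by simp
  qed
  \<comment> \<open>By \<open>disj\<close> and since \<open>p2\<close> is adjacent to all of
    \<open>B\<close>, every in-neighbour of \<open>p1\<close> is an out-neighbour of
    \<open>p2\<close>.\<close>
  have S1: "card (S p1) \<le> 1"
    using le1[of p1 p2] p2(2) disj by (auto simp: S_def adj_def)
  have "card (S p) \<le> 1" if p: "p \<in> A" for p
  proof (cases "p = p1")
    case False
    show ?thesis
    proof (cases "S p1 \<inter> S p = {}")
      case True
      then show ?thesis using le1[of p p1] p1(2) by (auto simp: S_def adj_def)
    next
      case meet: False
      then obtain q where q: "q \<in> S p1" "q \<in> S p" by blast
      \<comment> \<open>A common in-neighbour \<open>q\<close> of \<open>p1\<close> and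
        \<open>p\<close> forbids common out-neighbours, so all out-neighbours of \<open>p\<close>
        lie in \<open>S p1\<close>. That leaves \<open>p\<close> at most two neighbours in
        \<open>B\<close>, against \<open>deg\<close>.\<close>
      have "(p1, q') \<notin> E" if "q' \<in> R p" for q'
        using unique_mid[of q p1 q' p] q that False by (auto simp: R_def S_def)
      then have "R p \<subseteq> S p1"
        using p1(2) by (auto simp: R_def S_def adj_def)
      then have "nb B p \<subseteq> S p1 \<union> (R p1 \<inter> S p)"
        using p1(2) by (auto simp: nb_def R_def S_def adj_def)
      then have "card (nb B p) \<le> card (S p1) + card (R p1 \<inter> S p)"
        using card_mono card_Un_le finRS by (meson finite_Int finite_UnI le_trans)
      then show ?thesis using S1 RS[of p1 p] deg[OF p] by linarith
    qed
  qed (use S1 in simp)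
  then have "(\<Sum>p\<in>A. card (S p)) \<le> card A"
    using sum_mono[of A "\<lambda>p. card (S p)" "\<lambda>_. 1"] by simp
  moreover have "B \<subseteq> (\<Union>p\<in>A. S p)" using out by (auto simp: S_def)
  then have "card B \<le> (\<Sum>p\<in>A. card (S p))"
    using card_mono[of "\<Union>p\<in>A. S p" B] card_UN_le[OF fin(1), of S] fin(1) finRS by fastforce
  ultimately show False using less by simp
qed

lemma card_cross:
  assumes "finite A" "finite B"
  shows "card (cross A B) = (\<Sum>p\<in>A. card (nb B p))"
proof -
  have "cross A B = Sigma A (nb B)" by (auto simp: cross_def nb_def)
  then show ?thesis using assms by (simp add: nb_def)
qed

end

section \<open>Existence of a triangle: exclusion of triangle-free and of bipartite digraphs\<close>

context adm
begin

text \<open>A heavy arc has degree sum at least \<open>2 * r\<close>, since \<open>2 * r - 1\<close>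
  would allow at most \<open>(4 * r\<^sup>2 - 1) / 4\<close> arcs. The two neighbourhoods therefore
  miss at most one vertex \<open>w\<close>, and \<open>w\<close> joins a side in which it has no
  neighbour. If it had \<open>i\<close> and \<open>j\<close> neighbours in the two sides, both
  positive, it would add \<open>i + j\<close> edges and exclude \<open>i * j\<close>, so there would
  be at most \<open>r\<^sup>2 + i + j - i * j \<le> r\<^sup>2 + 1\<close> edges.\<close>

lemma triangle_free_bipartite:
  assumes free: "\<And>x y z. \<not> triangle x y z"
  obtains A B where "V = A \<union> B" "A \<inter> B = {}"
    "\<And>a b. a \<in> A \<Longrightarrow> b \<in> A \<Longrightarrow> \<not> adj a b" "\<And>a b. a \<in> B \<Longrightarrow> b \<in> B \<Longrightarrow> \<not> adj a b"
proof -
  have "arcs_in V \<noteq> {}" using arcs_card unfolding arcs_in_V by auto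
  then obtain u v where uv: "(u, v) \<in> arcs_in V"
    and heavy: "4 * card (arcs_in V) \<le> card V * (card (nb V u) + card (nb V v))"
    using heavy_arc[OF finite_verts] by blast
  define A where "A = nb V u"
  define B where "B = nb V v"
  have fin: "finite A" "finite B" using finite_verts by (auto simp: A_def B_def nb_def)
  have disj: "A \<inter> B = {}" and cu: "card (A \<union> B) = card A + card B" and le: "card A + card B \<le> card V"
    using triangle_free_nb[of u v V] card_nb_triangle_free[OF finite_verts, of u v] free uv
    by (auto simp: A_def B_def arcs_in_def)
  have ind: "\<not> adj a b" if "a \<in> nb V w" "b \<in> nb V w" "w \<in> V" for a b w
    using nb_independent[of V w a b] free that by blast
  have indA: "\<not> adj a b" if "a \<in> A" "b \<in> A" for a b
    using ind[of a u b] that uv by (auto simp: A_def arcs_in_def)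
  have indB: "\<not> adj a b" if "a \<in> B" "b \<in> B" for a b
    using ind[of a v b] that uv by (auto simp: B_def arcs_in_def)
  have "2 * r \<le> card A + card B"
  proof (rule ccontr)
    assume "\<not> 2 * r \<le> card A + card B"
    then have "card A + card B + 1 \<le> 2 * r" by simp
    then have "(2 * r + 1) * (card A + card B + 1) \<le> (2 * r + 1) * (2 * r)" by (rule mult_le_mono2)
    moreover have "4 * (r\<^sup>2 + 2) \<le> (2 * r + 1) * (card A + card B)"
      using heavy unfolding arcs_in_V arcs_card order A_def B_def .
    ultimately show False by (simp add: power2_eq_square algebra_simps)
  qed
  then consider "card A + card B = card V" | "card A + card B = 2 * r"
    using le order by linarith
  then show thesis
  proof cases
    case 1
    then have "V = A \<union> B"
      using card_subset_eq[OF finite_verts, of "A \<union> B"] cu by (auto simp: A_def B_def nb_def)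
    then show ?thesis using that disj indA indB by blast
  next
    case 2
    have sub: "A \<union> B \<subseteq> V" by (auto simp: A_def B_def nb_def)
    then have "card (V - (A \<union> B)) = 1"
      using card_Diff_subset[OF _ sub] fin cu 2 order by simp
    then obtain w where "V - (A \<union> B) = {w}" by (auto simp: card_1_singleton_iff)
    then have w: "V = (A \<union> B) \<union> {w}" "w \<notin> A \<union> B" using sub by auto
    consider "nb A w = {}" | "nb B w = {}" | "nb A w \<noteq> {}" "nb B w \<noteq> {}" by blast
    then show ?thesis
    proof cases
      case 1
      then have "\<not> adj a b" if "a \<in> insert w A" "b \<in> insert w A" for a b
        using that indA adj_irrefl adj_commute[of a b] by (auto simp: nb_def)
      moreover have "V = insert w A \<union> B" "insert w A \<inter> B = {}" using w disj by auto
      ultimately show ?thesis using that[of "insert w A" B] indB by blast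
    next
      case 2
      then have "\<not> adj a b" if "a \<in> insert w B" "b \<in> insert w B" for a b
        using that indB adj_irrefl adj_commute[of a b] by (auto simp: nb_def)
      moreover have "V = A \<union> insert w B" "A \<inter> insert w B = {}" using w disj by auto
      ultimately show ?thesis using that[of A "insert w B"] indA by blast
    next
      case 3
      have finw: "finite (nb A w)" "finite (nb B w)" using fin by (auto simp: nb_def)
      have no: "\<not> adj a b" if "a \<in> nb A w" "b \<in> nb B w" for a b
        using ind[of a w b] that w(1) by (auto simp: nb_def)
      have "cross A B \<subseteq> A \<times> B - nb A w \<times> nb B w"
        using no by (auto simp: cross_def)
      then have "card (cross A B) \<le> card (A \<times> B - nb A w \<times> nb B w)"
        using fin by (intro card_mono) auto
      also have "\<dots> = card A * card B - card (nb A w) * card (nb B w)"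
        using finw by (subst card_Diff_subset) (auto simp: nb_def card_cartesian_product)
      finally have cross: "card (cross A B) + card (nb A w) * card (nb B w) \<le> card A * card B"
        using mult_le_mono[of "card (nb A w)" "card A" "card (nb B w)" "card B"] card_mono[OF fin(1), of "nb A w"]
          card_mono[OF fin(2), of "nb B w"] by (auto simp: nb_def)
      have "cross (A \<union> B) {w} = (nb A w \<union> nb B w) \<times> {w}"
        using adj_commute by (auto simp: cross_def nb_def)
      then have cw: "card (cross (A \<union> B) {w}) = card (nb A w) + card (nb B w)"
        using finw disj by (auto simp: card_cartesian_product nb_def intro!: card_Un_disjoint)
      have "card E = card (arcs_in (A \<union> B)) + card (arcs_in {w}) + card (cross (A \<union> B) {w})"
        by (subst arcs_in_V[symmetric], subst w(1), rule card_arcs_in_Un) (use fin w(2) in auto)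
      moreover have "arcs_in {w} = {}" by (rule arcs_in_independent) (auto simp: adj_irrefl)
      moreover have "card (arcs_in (A \<union> B)) = card (cross A B)"
        using card_arcs_in_Un[OF fin disj] arcs_in_independent[of A] arcs_in_independent[of B] indA indB
        by simp
      ultimately have e: "r\<^sup>2 + 2 = card (cross A B) + card (nb A w) + card (nb B w)"
        using arcs_card cw by simp
      obtain i j where ij: "card (nb A w) = Suc i" "card (nb B w) = Suc j"
        using 3 finw by (metis card_0_eq not0_implies_Suc)
      have "r\<^sup>2 + 1 \<le> card A * card B"
        using cross e unfolding ij by simp
      moreover have "card A * card B \<le> r\<^sup>2"
      proof -
        have cA: "int (card A) = 2 * int r - int (card B)" using 2 by simp
        have "(int r)\<^sup>2 - int (card A) * int (card B) = (int r - int (card B))\<^sup>2"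
          unfolding cA by (simp add: power2_eq_square algebra_simps)
        then have "int (card A) * int (card B) \<le> (int r)\<^sup>2"
          using zero_le_power2[of "int r - int (card B)"] by linarith
        then have "int (card A * card B) \<le> int (r\<^sup>2)" by simp
        then show ?thesis by (simp only: of_nat_le_iff)
      qed
      ultimately show ?thesis by simp
    qed
  qed
qed

text \<open>\<open>card A * card B\<close> equals
  \<open>r\<^sup>2 + card A - (r - card A)\<^sup>2\<close>, so at most \<open>card A - 2\<close>
  pairs between the sides are not joined. Hence every vertex of \<open>A\<close> keeps at least
  three neighbours in the larger side, and at least two vertices \<open>p1\<close>,
  \<open>p2\<close> of \<open>A\<close> miss nothing. These feed \<open>few_in_arcs\<close>.\<close>

lemma not_bipartite_aux:
  assumes "V = A \<union> B" "A \<inter> B = {}" "card A < card B"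
    and indA: "\<And>a b. a \<in> A \<Longrightarrow> b \<in> A \<Longrightarrow> \<not> adj a b"
    and indB: "\<And>a b. a \<in> B \<Longrightarrow> b \<in> B \<Longrightarrow> \<not> adj a b"
  shows False
proof -
  have fin: "finite A" "finite B" using finite_verts assms(1) by auto
  have cab: "card A + card B = 2 * r + 1"
    using order card_Un_disjoint[OF fin assms(2)] assms(1) by simp
  have "card E = card (cross A B)"
    using card_arcs_in_Un[OF fin assms(2)] arcs_in_independent[of A] arcs_in_independent[of B] indA indB
    unfolding assms(1)[symmetric] arcs_in_V by simp
  then have e: "(\<Sum>p\<in>A. card (nb B p)) = r\<^sup>2 + 2"
    using card_cross[OF fin] arcs_card by simp
  have ab: "card A * card B \<le> r\<^sup>2 + card A"
  proof -
    have cB: "int (card B) = 2 * int r + 1 - int (card A)" using cab by simp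
    have "(int r)\<^sup>2 + int (card A) - int (card A) * int (card B) = (int r - int (card A))\<^sup>2"
      unfolding cB by (simp add: power2_eq_square algebra_simps)
    then have "int (card A) * int (card B) \<le> (int r)\<^sup>2 + int (card A)"
      using zero_le_power2[of "int r - int (card A)"] by linarith
    then have "int (card A * card B) \<le> int (r\<^sup>2 + card A)" by simp
    then show ?thesis by (simp only: of_nat_le_iff)
  qed
  have nbB: "card (nb B p) \<le> card B" for p
    using fin by (intro card_mono) (auto simp: nb_def)
  have deg: "3 \<le> card (nb B p)" if "p \<in> A" for p
  proof -
    have "(\<Sum>p\<in>A. card (nb B p)) = card (nb B p) + (\<Sum>p\<in>A-{p}. card (nb B p))"
      using that fin by (simp add: sum.remove)
    moreover have "(\<Sum>p\<in>A-{p}. card (nb B p)) \<le> card (A - {p}) * card B"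
      using sum_bounded_above[of "A - {p}" "\<lambda>p. card (nb B p)" "card B"] nbB by simp
    moreover have "card A * card B = card B + card (A - {p}) * card B"
      using card.remove[OF fin(1) that] by simp
    ultimately show ?thesis using e ab assms(3) by linarith
  qed
  define F where "F = {p\<in>A. nb B p = B}"
  have "card (nb B p) + (if p \<in> F then 0 else 1) \<le> card B" if "p \<in> A" for p
  proof (cases "p \<in> F")
    case False
    then have "nb B p \<subset> B" using that by (auto simp: F_def nb_def)
    then have "card (nb B p) < card B" by (rule psubset_card_mono[OF fin(2)])
    then show ?thesis using False by simp
  qed (use nbB in simp)
  then have "(\<Sum>p\<in>A. card (nb B p) + (if p \<in> F then 0 else 1)) \<le> card A * card B"
    by (rule sum_bounded_above[of A _ "card B", unfolded of_nat_id])
  moreover have "(\<Sum>p\<in>A. if p \<in> F then 0 else 1) = card (A - F)"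
    using fin by (simp add: sum.If_cases Diff_eq)
  ultimately have "card (A - F) + 2 \<le> card A"
    using e ab by (simp add: sum.distrib)
  moreover have "card A = card (A - F) + card F"
    using fin card_Diff_subset[of F A] card_mono[of A F] by (simp add: F_def)
  ultimately have "2 \<le> card F" by simp
  then obtain p1 p2 where p: "p1 \<in> F" "p2 \<in> F" "p1 \<noteq> p2"
    using two_elements by blast
  have pA: "p1 \<in> A" "p2 \<in> A" and adj1: "\<And>q. q \<in> B \<Longrightarrow> adj p1 q" and adj2: "\<And>q. q \<in> B \<Longrightarrow> adj p2 q"
    using p by (auto simp: F_def nb_def)
  have out: "\<exists>p\<in>A. (q, p) \<in> E" and inn: "\<exists>p\<in>A. (p, q) \<in> E" if "q \<in> B" for q
    using that no_sink[of q] no_source[of q] indB[of q] arcs_subset assms(1) unfolding adj_def by blast+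
  show False
  \<comment> \<open>By \<open>unique_mid\<close>, \<open>p1\<close> and \<open>p2\<close> cannot
    have both a common in-neighbour and a common out-neighbour in \<open>B\<close>; if the former
    exists, the argument is applied to the reversed digraph.\<close>
  proof (cases "\<exists>q\<in>B. (q, p1) \<in> E \<and> (q, p2) \<in> E")
    case False
    then show ?thesis
      using few_in_arcs[OF fin assms(3) out pA(1) adj1 pA(2) adj2 _ p(3) deg] by blast
  next
    case True
    interpret c: two_geodetic V "E\<inverse>" by (rule two_geodetic_converse)
    have "(p2, q) \<notin> E" if "q \<in> B" "(p1, q) \<in> E" for q
      using True that unique_mid p(3) by blast
    moreover have "c.nb = nb"
      by (simp add: fun_eq_iff nb_def c.nb_def adj_converse)
    ultimately show ?thesis
      using c.few_in_arcs[OF fin assms(3), of p1 p2] inn pA adj1 adj2 p(3) deg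
      by (simp add: adj_converse)
  qed
qed

lemma not_bipartite:
  assumes "V = A \<union> B" "A \<inter> B = {}"
    and indA: "\<And>a b. a \<in> A \<Longrightarrow> b \<in> A \<Longrightarrow> \<not> adj a b"
    and indB: "\<And>a b. a \<in> B \<Longrightarrow> b \<in> B \<Longrightarrow> \<not> adj a b"
  shows False
proof -
  have "card A + card B = 2 * r + 1"
    using order finite_verts card_Un_disjoint[of A B] assms(1,2) by simp
  then have "card A < card B \<or> card B < card A" by presburger
  then show False
    using not_bipartite_aux[of A B] not_bipartite_aux[of B A] assms by (metis Int_commute Un_commute)
qed

lemma triangle_exists: "\<exists>x y z. triangle x y z"
  using triangle_free_bipartite not_bipartite by metis

end

text \<open>The shape left when all bounds are attained, \<open>P\<close> and \<open>Q\<close> being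
  the sides of the bipartition. It is invariant under rotating the triangle, exchanging
  \<open>P\<close> and \<open>Q\<close>, and reversing all arcs with the triangle listed backwards,
  so the case analysis can be made for one vertex, one side and one direction.\<close>

locale config = adm V E "Suc s" for V :: "'v set" and E and s +
  fixes x y z :: 'v and P Q :: "'v set"
  assumes tri: "(x, y) \<in> E" "(y, z) \<in> E" "(z, x) \<in> E"
    and verts: "V = {x, y, z} \<union> P \<union> Q"
    and disj: "P \<inter> Q = {}" "x \<notin> P \<union> Q" "y \<notin> P \<union> Q" "z \<notin> P \<union> Q"
    and card_P: "card P = s" and card_Q: "card Q = s" and s_ge: "4 \<le> s"
    and ind_P: "a \<in> P \<Longrightarrow> b \<in> P \<Longrightarrow> (a, b) \<notin> E"
    and ind_Q: "a \<in> Q \<Longrightarrow> b \<in> Q \<Longrightarrow> (a, b) \<notin> E"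
    and complete: "p \<in> P \<Longrightarrow> q \<in> Q \<Longrightarrow> (p, q) \<in> E \<or> (q, p) \<in> E"
    and attached: "w \<in> P \<union> Q \<Longrightarrow> \<exists>!a. a \<in> {x, y, z} \<and> ((a, w) \<in> E \<or> (w, a) \<in> E)"

lemma (in adm) config_exists:
  assumes "5 \<le> r"
  shows "\<exists>x y z P Q. config V E (r - 1) x y z P Q"
proof -
  obtain x y z where T: "triangle x y z" using triangle_exists by blast
  have TV: "{x, y, z} \<subseteq> V" using T arcs_subset by (auto simp: triangle_def)
  let ?W = "V - {x, y, z}"
  note rem = arcs_in_remove_triangle[OF T TV finite_verts]
  have fin: "finite ?W" using finite_verts by simp
  obtain s where s: "r = Suc s" using assms by (cases r) auto
  have cW: "card ?W = 2 * s" using rem(1) order s by simp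
  have "4 * card (arcs_in ?W) \<le> (2 * s)\<^sup>2"
    using arcs_in_bound[OF fin] cW assms s by simp
  then have le: "card (arcs_in ?W) \<le> s\<^sup>2" by (simp add: power_mult_distrib)
  have cross_le: "card (cross {x, y, z} ?W) \<le> card ?W"
    using card_cross_triangle(1)[OF T fin] by blast
  \<comment> \<open>The surplus of \<open>r\<^sup>2 + 2\<close> over the 3 triangle arcs is the sum
    of the maxima of the two remaining terms, so both maxima are attained.\<close>
  have sum: "s\<^sup>2 + 2 * s = card (arcs_in ?W) + card (cross {x, y, z} ?W)"
    using rem(3) arcs_card unfolding arcs_in_V s by (simp add: power2_eq_square)
  then have ge: "s\<^sup>2 \<le> card (arcs_in ?W)" and cross_eq: "card (cross {x, y, z} ?W) = card ?W"
    using le cross_le cW by simp_all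
  obtain P Q where PQ: "?W = P \<union> Q" "P \<inter> Q = {}" "card P = s" "card Q = s"
    "\<And>a b. a \<in> P \<Longrightarrow> b \<in> P \<Longrightarrow> \<not> adj a b" "\<And>a b. a \<in> Q \<Longrightarrow> b \<in> Q \<Longrightarrow> \<not> adj a b"
    "\<And>a b. a \<in> P \<Longrightarrow> b \<in> Q \<Longrightarrow> adj a b"
    using extremal_structure[OF fin cW _ ge] assms s by auto
  have ex1: "\<exists>!a. a \<in> {x, y, z} \<and> adj a w" if "w \<in> P \<union> Q" for w
  proof (rule ex_ex1I)
    show "\<exists>a. a \<in> {x, y, z} \<and> adj a w"
      using card_cross_triangle(2)[OF T fin _ cross_eq, of w] that PQ(1) by auto
    show "a = b" if "a \<in> {x, y, z} \<and> adj a w" "b \<in> {x, y, z} \<and> adj b w" for a b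
      using triangle_one_nb[OF T, of w a b] that \<open>w \<in> P \<union> Q\<close> PQ(1) by blast
  qed
  have "config V E s x y z P Q"
  proof
    show "(x, y) \<in> E" "(y, z) \<in> E" "(z, x) \<in> E" using T by (auto simp: triangle_def)
    show "V = {x, y, z} \<union> P \<union> Q" "x \<notin> P \<union> Q" "y \<notin> P \<union> Q" "z \<notin> P \<union> Q"
      using PQ(1) TV by auto
    show "P \<inter> Q = {}" "card P = s" "card Q = s" by fact+
    show "4 \<le> s" using assms s by simp
    show "(a, b) \<notin> E" if "a \<in> P" "b \<in> P" for a b using PQ(5) that by (auto simp: adj_def)
    show "(a, b) \<notin> E" if "a \<in> Q" "b \<in> Q" for a b using PQ(6) that by (auto simp: adj_def)
    show "(p, q) \<in> E \<or> (q, p) \<in> E" if "p \<in> P" "q \<in> Q" for p q using PQ(7) that by (auto simp: adj_def)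
    show "\<exists>!a. a \<in> {x, y, z} \<and> ((a, w) \<in> E \<or> (w, a) \<in> E)" if "w \<in> P \<union> Q" for w
      using ex1[OF that] unfolding adj_def .
    show "card V = 2 * Suc s + 1" "card E = (Suc s)\<^sup>2 + 2"
      using order arcs_card unfolding s .
    show "\<exists>u. (u, v) \<in> E" "\<exists>w. (v, w) \<in> E" if "v \<in> V" for v
      using no_source no_sink that by blast+
  qed
  then show ?thesis unfolding s diff_Suc_1 by blast
qed

section \<open>The listed digraphs\<close>

text \<open>From here on \<open>r\<close> is \<open>Suc s\<close>, which turns the index ranges up
  to \<open>r - 1\<close> and \<open>r - 2\<close> into \<open>i \<le> s\<close> and
  \<open>i < s\<close> and removes truncated subtraction.\<close>

lemma std_verts_Suc:
  "v \<in> std_verts (Suc s) \<longleftrightarrow>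
    (case v of VX i \<Rightarrow> 1 \<le> i \<and> i \<le> s | VY i \<Rightarrow> 1 \<le> i \<and> i \<le> s | _ \<Rightarrow> True)"
  by (auto simp: std_verts_def split: vertex.split)

lemma card_std_verts: "card (std_verts (Suc s)) = 2 * s + 3" "finite (std_verts r)"
proof -
  have X: "card (VX ` {1..s}) = s" "card (VY ` {1..s}) = s"
    by (auto simp: card_image inj_on_def)
  have "card (VX ` {1..s} \<union> VY ` {1..s}) = s + s"
    by (subst card_Un_disjoint) (auto simp: X simp del: One_nat_def)
  moreover have "std_verts (Suc s) = {Vx, Vy, Vz} \<union> (VX ` {1..s} \<union> VY ` {1..s})"
    by (auto simp: std_verts_def)
  ultimately show "card (std_verts (Suc s)) = 2 * s + 3"
    by (simp only:, subst card_Un_disjoint) auto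
qed (simp add: std_verts_def)

lemma pverts_dig [simp]:
  "pverts (dig_A r) = std_verts r" "pverts (dig_B r t) = std_verts r"
  "pverts (dig_C r) = std_verts r" "pverts (dig_D r) = std_verts r"
  "pverts (converse_digraph G) = pverts G" "parcs (converse_digraph G) = (parcs G)\<inverse>"
  by (simp_all add: dig_A_def dig_B_def dig_C_def dig_D_def converse_digraph_def)

section \<open>Out-neighbourhoods and arc counts of the listed digraphs\<close>

lemma arcs_A:
  assumes "1 \<le> s"
  shows "(Vx, v) \<in> parcs (dig_A (Suc s)) \<longleftrightarrow> v = Vy \<or> (\<exists>i. v = VX i \<and> 1 \<le> i \<and> i < s)"
    and "(Vy, v) \<in> parcs (dig_A (Suc s)) \<longleftrightarrow> v = Vz \<or> v = VY s"
    and "(Vz, v) \<in> parcs (dig_A (Suc s)) \<longleftrightarrow> v = Vx"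
    and "(VX i, v) \<in> parcs (dig_A (Suc s)) \<longleftrightarrow> 1 \<le> i \<and> i < s \<and> v = VY i \<or> i = s \<and> v = Vx"
    and "(VY j, v) \<in> parcs (dig_A (Suc s)) \<longleftrightarrow>
      1 \<le> j \<and> j \<le> s \<and> (\<exists>i. v = VX i \<and> 1 \<le> i \<and> i \<le> s \<and> (i \<noteq> j \<or> i = s)) \<or> 1 \<le> j \<and> j < s \<and> v = Vy"
  using assms by (auto simp: dig_A_def std_arcs_def)

lemma arcs_B:
  assumes "t \<le> s"
  shows "(Vx, v) \<in> parcs (dig_B (Suc s) t) \<longleftrightarrow> v = Vy \<or> (\<exists>i. v = VX i \<and> 1 \<le> i \<and> i \<le> s)"
    and "(Vy, v) \<in> parcs (dig_B (Suc s) t) \<longleftrightarrow> v = Vz"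
    and "(Vz, v) \<in> parcs (dig_B (Suc s) t) \<longleftrightarrow> v = Vx"
    and "(VX i, v) \<in> parcs (dig_B (Suc s) t) \<longleftrightarrow> 1 \<le> i \<and> i \<le> s \<and> v = VY i"
    and "(VY j, v) \<in> parcs (dig_B (Suc s) t) \<longleftrightarrow>
      1 \<le> j \<and> j \<le> s \<and> ((\<exists>i. v = VX i \<and> 1 \<le> i \<and> i \<le> s \<and> i \<noteq> j) \<or> v = (if j \<le> t then Vy else Vz))"
  using assms by (auto simp: dig_B_def std_arcs_def)

lemma arcs_C:
  assumes "1 \<le> s"
  shows "(Vx, v) \<in> parcs (dig_C (Suc s)) \<longleftrightarrow> v = Vy"
    and "(Vy, v) \<in> parcs (dig_C (Suc s)) \<longleftrightarrow> v = Vz \<or> (\<exists>i. v = VX i \<and> 1 \<le> i \<and> i < s)"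
    and "(Vz, v) \<in> parcs (dig_C (Suc s)) \<longleftrightarrow> v = Vx \<or> v = VY s"
    and "(VX i, v) \<in> parcs (dig_C (Suc s)) \<longleftrightarrow> 1 \<le> i \<and> i < s \<and> v = VY i \<or> i = s \<and> v = Vz"
    and "(VY j, v) \<in> parcs (dig_C (Suc s)) \<longleftrightarrow>
      1 \<le> j \<and> j \<le> s \<and> (\<exists>i. v = VX i \<and> 1 \<le> i \<and> i \<le> s \<and> (i \<noteq> j \<or> i = s)) \<or> 1 \<le> j \<and> j < s \<and> v = Vx"
  using assms by (auto simp: dig_C_def std_arcs_def)

lemma arcs_D:
  assumes "1 \<le> s"
  shows "(Vx, v) \<in> parcs (dig_D (Suc s)) \<longleftrightarrow> v = Vy"
    and "(Vy, v) \<in> parcs (dig_D (Suc s)) \<longleftrightarrow> v = Vz \<or> (\<exists>i. v = VX i \<and> 1 < i \<and> i \<le> s)"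
    and "(Vz, v) \<in> parcs (dig_D (Suc s)) \<longleftrightarrow> v = Vx \<or> v = VX 1"
    and "(VX i, v) \<in> parcs (dig_D (Suc s)) \<longleftrightarrow> 1 \<le> i \<and> i \<le> s \<and> v = VY i"
    and "(VY j, v) \<in> parcs (dig_D (Suc s)) \<longleftrightarrow>
      1 \<le> j \<and> j \<le> s \<and> ((\<exists>i. v = VX i \<and> 1 \<le> i \<and> i \<le> s \<and> i \<noteq> j) \<or> v = (if j = 1 then Vz else Vx))"
  using assms by (auto simp: dig_D_def std_arcs_def)

lemma std_arcs_image:
  "std_arcs r = {(Vx, Vy), (Vy, Vz), (Vz, Vx)}
    \<union> (\<lambda>(i, j). (VY j, VX i)) ` ({1..r-1} \<times> {1..r-1} - (\<lambda>i. (i, i)) ` {1..r-1})"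
  unfolding std_arcs_def by (intro arg_cong2[where f = "(\<union>)"] refl) force

lemma finite_std_arcs: "finite (std_arcs r)"
  unfolding std_arcs_image by simp

text \<open>Three triangle arcs and \<open>s * s - s\<close> ordered pairs of distinct indices; the
  sum form avoids subtraction.\<close>

lemma card_std_arcs: "card (std_arcs (Suc s)) + s = 3 + s * s"
proof -
  let ?D = "{1..s} \<times> {1..s} - (\<lambda>i. (i, i)) ` {1..s}"
  let ?f = "\<lambda>(i, j). (VY j, VX i)"
  have "card ((\<lambda>i. (i, i)) ` {1..s}) = s" by (simp add: card_image inj_on_def)
  then have "card ?D = s * s - s" by (subst card_Diff_subset) (auto simp: card_cartesian_product)
  moreover have "card (?f ` ?D) = card ?D"
    by (rule card_image) (auto simp: inj_on_def)
  ultimately have D: "card (?f ` ?D) + s = s * s"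
    using le_square[of s] by simp
  have "card (std_arcs (Suc s)) = card {(Vx, Vy), (Vy, Vz), (Vz, Vx)} + card (?f ` ?D)"
    unfolding std_arcs_image diff_Suc_1 by (rule card_Un_disjoint) auto
  also have "\<dots> = 3 + card (?f ` ?D)" by simp
  finally show ?thesis using D by simp
qed

lemma std_arcs_iff:
  "(VX i, v) \<notin> std_arcs r" "(u, VY j) \<notin> std_arcs r" "(Vx, VX i) \<notin> std_arcs r"
  "(Vy, VX i) \<notin> std_arcs r" "(Vz, VX i) \<notin> std_arcs r"
  "(VY j, Vx) \<notin> std_arcs r" "(VY j, Vy) \<notin> std_arcs r" "(VY j, Vz) \<notin> std_arcs r"
  "(VY i, VX i) \<notin> std_arcs r"
  by (auto simp: std_arcs_def)

lemma card_Un_image: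
  assumes "finite A" "finite I" "inj f" "\<And>i. i \<in> I \<Longrightarrow> f i \<notin> A"
  shows "card (A \<union> f ` I) = card A + card I"
  using assms by (subst card_Un_disjoint) (auto simp: card_image inj_on_subset)

text \<open>Beyond \<open>std_arcs\<close> every listed digraph has \<open>3 * s\<close> arcs: one
  for each pair of equal indices, and one joining each of the \<open>2 * s\<close> vertices
  \<open>x\<^sub>i\<close>, \<open>y\<^sub>i\<close> to the triangle.\<close>

lemma card_parcs:
  assumes "1 \<le> s" "t \<le> s"
  shows "card (parcs (dig_A (Suc s))) = (Suc s)\<^sup>2 + 2"
    and "card (parcs (dig_B (Suc s) t)) = (Suc s)\<^sup>2 + 2"
    and "card (parcs (dig_C (Suc s))) = (Suc s)\<^sup>2 + 2"
    and "card (parcs (dig_D (Suc s))) = (Suc s)\<^sup>2 + 2"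
proof -
  have eq: "(Suc s)\<^sup>2 + 2 = card (std_arcs (Suc s)) + 3 * s"
    using card_std_arcs[of s] by (simp add: power2_eq_square)
  note unf = dig_A_def dig_B_def dig_C_def dig_D_def pair_pre_digraph.simps Setcompr_eq_image
    Collect_mem_eq eq
  note sm = card_Un_image finite_std_arcs std_arcs_iff card_insert_if inj_def image_iff
  show "card (parcs (dig_A (Suc s))) = (Suc s)\<^sup>2 + 2"
    using assms(1) unfolding unf by (auto simp: sm)
  show "card (parcs (dig_B (Suc s) t)) = (Suc s)\<^sup>2 + 2"
    using assms unfolding unf by (auto simp: sm)
  show "card (parcs (dig_C (Suc s))) = (Suc s)\<^sup>2 + 2"
    using assms(1) unfolding unf by (auto simp: sm)
  show "card (parcs (dig_D (Suc s))) = (Suc s)\<^sup>2 + 2"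
    using assms(1) unfolding unf by (auto simp: sm)
qed

text \<open>\<open>src\<close> and \<open>tgt\<close> choose an in-neighbour and an out-neighbour of
  every vertex, so that the absence of sources and sinks can be checked by cases.\<close>

lemma adm_stdI:
  assumes "card E = (Suc s)\<^sup>2 + 2"
    and "\<And>u v. (u, v) \<in> E \<Longrightarrow> u \<in> std_verts (Suc s) \<and> v \<in> std_verts (Suc s)"
    and "\<And>u v. (u, v) \<in> E \<Longrightarrow> (v, u) \<notin> E"
    and "\<And>u v w. (u, w) \<in> E \<Longrightarrow> (w, v) \<in> E \<Longrightarrow> (u, v) \<notin> E"
    and "\<And>u v w w'. (u, w) \<in> E \<Longrightarrow> (w, v) \<in> E \<Longrightarrow> (u, w') \<in> E \<Longrightarrow> (w', v) \<in> E \<Longrightarrow> w = w'"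
    and "\<And>v. v \<in> std_verts (Suc s) \<Longrightarrow> (src v, v) \<in> E"
    and "\<And>v. v \<in> std_verts (Suc s) \<Longrightarrow> (v, tgt v) \<in> E"
  shows "adm (std_verts (Suc s)) E (Suc s)"
proof
  show "(u, u) \<notin> E" for u using assms(3) by blast
  show "finite (std_verts (Suc s))" "card (std_verts (Suc s)) = 2 * Suc s + 1"
    by (simp_all add: card_std_verts)
  show "E \<subseteq> std_verts (Suc s) \<times> std_verts (Suc s)" using assms(2) by auto
  show "card E = (Suc s)\<^sup>2 + 2" by (rule assms(1))
  show "(v, u) \<notin> E" if "(u, v) \<in> E" for u v using assms(3) that .
  show "(u, v) \<notin> E" if "(u, w) \<in> E" "(w, v) \<in> E" for u v w using assms(4) that .
  show "w = w'" if "(u, w) \<in> E" "(w, v) \<in> E" "(u, w') \<in> E" "(w', v) \<in> E" for u v w w'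
    using assms(5) that .
  show "\<exists>u. (u, v) \<in> E" "\<exists>w. (v, w) \<in> E" if "v \<in> std_verts (Suc s)" for v
    using assms(6,7) that by blast+
qed

lemma adm_A:
  assumes "4 \<le> s"
  shows "adm (std_verts (Suc s)) (parcs (dig_A (Suc s))) (Suc s)"
proof (rule adm_stdI[where src = "case_vertex Vz Vx Vy (\<lambda>i. if i < s then Vx else VY s) (\<lambda>i. if i < s then VX i else Vy)"
      and tgt = "case_vertex Vy Vz Vx (\<lambda>i. if i < s then VY i else Vx) (\<lambda>i. if i < s then Vy else VX s)"])
  fix u v w w'
  note arcs = arcs_A[of s, OF order_trans[OF _ assms], simplified]
  let ?E = "parcs (dig_A (Suc s))"
  show "card ?E = (Suc s)\<^sup>2 + 2"
    using card_parcs assms by simp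
  show "(u, v) \<in> ?E \<Longrightarrow> u \<in> std_verts (Suc s) \<and> v \<in> std_verts (Suc s)"
    using assms by (cases u) (auto simp: arcs std_verts_Suc)
  show "(u, v) \<in> ?E \<Longrightarrow> (v, u) \<notin> ?E"
    by (cases u; cases v) (auto simp: arcs split: if_splits)
  show "(u, w) \<in> ?E \<Longrightarrow> (w, v) \<in> ?E \<Longrightarrow> (u, v) \<notin> ?E"
    by (cases u; cases w) (auto simp: arcs split: if_splits)
  show "(u, w) \<in> ?E \<Longrightarrow> (w, v) \<in> ?E \<Longrightarrow> (u, w') \<in> ?E \<Longrightarrow> (w', v) \<in> ?E \<Longrightarrow> w = w'"
    by (cases u; cases w; cases w') (auto simp: arcs split: if_splits)
qed (use assms in \<open>auto simp: arcs_A[of s, OF order_trans[OF _ assms], simplified] std_verts_Suc split: vertex.splits if_splits\<close>)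

lemma adm_B:
  assumes "4 \<le> s" "t \<le> s"
  shows "adm (std_verts (Suc s)) (parcs (dig_B (Suc s) t)) (Suc s)"
proof (rule adm_stdI[where src = "case_vertex Vz Vx Vy (\<lambda>i. Vx) (\<lambda>i. VX i)"
      and tgt = "case_vertex Vy Vz Vx (\<lambda>i. VY i) (\<lambda>i. if i \<le> t then Vy else Vz)"])
  fix u v w w'
  note arcs = arcs_B[OF assms(2)]
  let ?E = "parcs (dig_B (Suc s) t)"
  show "card ?E = (Suc s)\<^sup>2 + 2"
    using card_parcs assms by simp
  show "(u, v) \<in> ?E \<Longrightarrow> u \<in> std_verts (Suc s) \<and> v \<in> std_verts (Suc s)"
    using assms by (cases u) (auto simp: arcs std_verts_Suc)
  show "(u, v) \<in> ?E \<Longrightarrow> (v, u) \<notin> ?E"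
    by (cases u; cases v) (auto simp: arcs split: if_splits)
  show "(u, w) \<in> ?E \<Longrightarrow> (w, v) \<in> ?E \<Longrightarrow> (u, v) \<notin> ?E"
    by (cases u; cases w) (auto simp: arcs split: if_splits)
  show "(u, w) \<in> ?E \<Longrightarrow> (w, v) \<in> ?E \<Longrightarrow> (u, w') \<in> ?E \<Longrightarrow> (w', v) \<in> ?E \<Longrightarrow> w = w'"
    by (cases u; cases w; cases w') (auto simp: arcs split: if_splits)
qed (use assms in \<open>auto simp: arcs_B[OF assms(2)] std_verts_Suc split: vertex.splits if_splits\<close>)

lemma adm_C:
  assumes "4 \<le> s"
  shows "adm (std_verts (Suc s)) (parcs (dig_C (Suc s))) (Suc s)"
proof (rule adm_stdI[where src = "case_vertex Vz Vx Vy (\<lambda>i. if i < s then Vy else VY s) (\<lambda>i. if i < s then VX i else Vz)"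
      and tgt = "case_vertex Vy Vz Vx (\<lambda>i. if i < s then VY i else Vz) (\<lambda>i. if i < s then Vx else VX s)"])
  fix u v w w'
  note arcs = arcs_C[of s, OF order_trans[OF _ assms], simplified]
  let ?E = "parcs (dig_C (Suc s))"
  show "card ?E = (Suc s)\<^sup>2 + 2"
    using card_parcs assms by simp
  show "(u, v) \<in> ?E \<Longrightarrow> u \<in> std_verts (Suc s) \<and> v \<in> std_verts (Suc s)"
    using assms by (cases u) (auto simp: arcs std_verts_Suc)
  show "(u, v) \<in> ?E \<Longrightarrow> (v, u) \<notin> ?E"
    by (cases u; cases v) (auto simp: arcs split: if_splits)
  show "(u, w) \<in> ?E \<Longrightarrow> (w, v) \<in> ?E \<Longrightarrow> (u, v) \<notin> ?E"
    by (cases u; cases w) (auto simp: arcs split: if_splits)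
  show "(u, w) \<in> ?E \<Longrightarrow> (w, v) \<in> ?E \<Longrightarrow> (u, w') \<in> ?E \<Longrightarrow> (w', v) \<in> ?E \<Longrightarrow> w = w'"
    by (cases u; cases w; cases w') (auto simp: arcs split: if_splits)
qed (use assms in \<open>auto simp: arcs_C[of s, OF order_trans[OF _ assms], simplified] std_verts_Suc split: vertex.splits if_splits\<close>)

lemma adm_D:
  assumes "4 \<le> s"
  shows "adm (std_verts (Suc s)) (parcs (dig_D (Suc s))) (Suc s)"
proof (rule adm_stdI[where src = "case_vertex Vz Vx Vy (\<lambda>i. if i = 1 then Vz else Vy) (\<lambda>i. VX i)"
      and tgt = "case_vertex Vy Vz Vx (\<lambda>i. VY i) (\<lambda>i. if i = 1 then Vz else Vx)"])
  fix u v w w'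
  note arcs = arcs_D[of s, OF order_trans[OF _ assms], simplified]
  let ?E = "parcs (dig_D (Suc s))"
  show "card ?E = (Suc s)\<^sup>2 + 2"
    using card_parcs assms by simp
  show "(u, v) \<in> ?E \<Longrightarrow> u \<in> std_verts (Suc s) \<and> v \<in> std_verts (Suc s)"
    using assms by (cases u) (auto simp: arcs std_verts_Suc)
  show "(u, v) \<in> ?E \<Longrightarrow> (v, u) \<notin> ?E"
    by (cases u; cases v) (auto simp: arcs split: if_splits)
  show "(u, w) \<in> ?E \<Longrightarrow> (w, v) \<in> ?E \<Longrightarrow> (u, v) \<notin> ?E"
    by (cases u; cases w) (auto simp: arcs split: if_splits)
  show "(u, w) \<in> ?E \<Longrightarrow> (w, v) \<in> ?E \<Longrightarrow> (u, w') \<in> ?E \<Longrightarrow> (w', v) \<in> ?E \<Longrightarrow> w = w'"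
    by (cases u; cases w; cases w') (auto simp: arcs split: if_splits)
qed (use assms in \<open>auto simp: arcs_D[of s, OF order_trans[OF _ assms], simplified] std_verts_Suc split: vertex.splits if_splits\<close>)

section \<open>Closure of the list under reversal\<close>

lemma isomorphic_converse_self:
  assumes "adm (pverts H) (parcs H) r" "\<And>v. f (f v) = v"
    and "\<And>v. v \<in> pverts H \<Longrightarrow> f v \<in> pverts H"
    and "\<And>u v. (u, v) \<in> parcs H \<Longrightarrow> (f v, f u) \<in> parcs H"
  shows "isomorphic (converse_digraph H) H"
proof (rule isomorphicI)
  interpret adm "pverts H" "parcs H" r by fact
  show "pair_digraph H" by (rule two_geodetic_pair_digraph) unfold_locales
  show "finite (parcs (converse_digraph H))" by (simp add: finite_arcs)
  show "card (parcs (converse_digraph H)) = card (parcs H)" by simp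
  show "inj_on f (pverts H)" using assms(2) by (metis inj_onI)
  show "f ` pverts H = pverts (converse_digraph H)"
    using assms(2,3) by (simp add: set_eq_iff image_iff) metis
  show "(f u, f v) \<in> parcs (converse_digraph H)" if "(u, v) \<in> parcs H" for u v
    using assms(4) that by simp
qed

text \<open>The reversing involutions exchange \<open>x\<^sub>i\<close> with
  \<open>y\<^sub>i\<close> and reflect the triangle. They fix \<open>z\<close> for \<open>A\<close>,
  \<open>C\<close>, \<open>D\<close> and for \<open>B\<close> with \<open>t = s\<close>, but fix
  \<open>y\<close> for \<open>B\<close> with \<open>t = 0\<close>, whose \<open>y\<^sub>i\<close>
  all point to \<open>z\<close>.\<close>

lemma converse_self:
  assumes "4 \<le> s"
  shows "isomorphic (converse_digraph (dig_A (Suc s))) (dig_A (Suc s))"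
    and "isomorphic (converse_digraph (dig_B (Suc s) 0)) (dig_B (Suc s) 0)"
    and "isomorphic (converse_digraph (dig_B (Suc s) s)) (dig_B (Suc s) s)"
    and "isomorphic (converse_digraph (dig_C (Suc s))) (dig_C (Suc s))"
    and "isomorphic (converse_digraph (dig_D (Suc s))) (dig_D (Suc s))"
proof -
  have s1: "1 \<le> s" using assms by simp
  let ?xy = "case_vertex Vy Vx Vz VY VX"
  let ?xz = "case_vertex Vz Vy Vx VY VX"
  have inv: "?xy (?xy v) = v" "?xz (?xz v) = v" for v by (cases v; simp)+
  have closed: "?xy v \<in> std_verts (Suc s)" "?xz v \<in> std_verts (Suc s)" if "v \<in> std_verts (Suc s)" for v
    using that by (cases v; simp add: std_verts_Suc)+
  show "isomorphic (converse_digraph (dig_A (Suc s))) (dig_A (Suc s))"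
  proof (rule isomorphic_converse_self[where f = ?xy and r = "Suc s"])
    show "(?xy v, ?xy u) \<in> parcs (dig_A (Suc s))" if "(u, v) \<in> parcs (dig_A (Suc s))" for u v
      using that s1 by (cases u; cases v) (auto simp: arcs_A[OF s1])
  qed (simp_all add: adm_A assms inv closed)
  show "isomorphic (converse_digraph (dig_B (Suc s) 0)) (dig_B (Suc s) 0)"
  proof (rule isomorphic_converse_self[where f = ?xz and r = "Suc s"])
    show "(?xz v, ?xz u) \<in> parcs (dig_B (Suc s) 0)" if "(u, v) \<in> parcs (dig_B (Suc s) 0)" for u v
      using that s1 by (cases u; cases v) (auto simp: arcs_B)
  qed (simp_all add: adm_B assms inv closed)
  show "isomorphic (converse_digraph (dig_B (Suc s) s)) (dig_B (Suc s) s)"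
  proof (rule isomorphic_converse_self[where f = ?xy and r = "Suc s"])
    show "(?xy v, ?xy u) \<in> parcs (dig_B (Suc s) s)" if "(u, v) \<in> parcs (dig_B (Suc s) s)" for u v
      using that s1 by (cases u; cases v) (auto simp: arcs_B)
  qed (simp_all add: adm_B assms inv closed)
  show "isomorphic (converse_digraph (dig_C (Suc s))) (dig_C (Suc s))"
  proof (rule isomorphic_converse_self[where f = ?xy and r = "Suc s"])
    show "(?xy v, ?xy u) \<in> parcs (dig_C (Suc s))" if "(u, v) \<in> parcs (dig_C (Suc s))" for u v
      using that s1 by (cases u; cases v) (auto simp: arcs_C[OF s1])
  qed (simp_all add: adm_C assms inv closed)
  show "isomorphic (converse_digraph (dig_D (Suc s))) (dig_D (Suc s))"
  proof (rule isomorphic_converse_self[where f = ?xy and r = "Suc s"])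
    show "(?xy v, ?xy u) \<in> parcs (dig_D (Suc s))" if "(u, v) \<in> parcs (dig_D (Suc s))" for u v
      using that s1 by (cases u; cases v) (auto simp: arcs_D[OF s1] split: if_splits)
  qed (simp_all add: adm_D assms inv closed)
qed

text \<open>Merges the endpoints \<open>t = 0\<close> and \<open>t = s\<close>, which the list names
  separately, with the range between them into one family.\<close>

lemma set_dig_list:
  assumes "1 \<le> s"
  shows "H \<in> set (dig_list (Suc s)) \<longleftrightarrow> H = dig_A (Suc s) \<or> H = dig_C (Suc s) \<or> H = dig_D (Suc s)
    \<or> (\<exists>t\<le>s. H = dig_B (Suc s) t) \<or> (\<exists>t. 1 \<le> t \<and> t < s \<and> H = converse_digraph (dig_B (Suc s) t))"
proof -
  have "{..s} = insert 0 (insert s {1..<s})" using assms by auto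
  moreover have "(\<exists>t\<le>s. H = dig_B (Suc s) t) \<longleftrightarrow> H \<in> dig_B (Suc s) ` {..s}" by auto
  ultimately have "(\<exists>t\<le>s. H = dig_B (Suc s) t) \<longleftrightarrow>
      H = dig_B (Suc s) 0 \<or> H = dig_B (Suc s) s \<or> H \<in> dig_B (Suc s) ` {1..<s}"
    by simp
  then show ?thesis by (auto simp: dig_list_def dig_B'_def)
qed

lemma adm_dig_list:
  assumes "4 \<le> s" "H \<in> set (dig_list (Suc s))"
  shows "adm (pverts H) (parcs H) (Suc s)"
  using assms adm_A adm_B adm_C adm_D adm.adm_converse[OF adm_B] set_dig_list[of s H]
  by auto

definition in_list :: "nat \<Rightarrow> 'v set \<Rightarrow> ('v \<times> 'v) set \<Rightarrow> bool" where
  "in_list s V E \<longleftrightarrow> (\<exists>H\<in>set (dig_list (Suc s)). isomorphic \<lparr>pverts = V, parcs = E\<rparr> H)"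

text \<open>Reversal fixes \<open>A\<close>, \<open>C\<close>, \<open>D\<close> and the two end
  members of the \<open>B\<close> family up to isomorphism and exchanges the other \<open>B\<close>
  with their converses. Hence arguments about out-neighbours also settle the case of
  in-neighbours.\<close>

lemma in_list_converse:
  assumes adm: "adm V E (Suc s)" and s: "4 \<le> s" and "in_list s V (E\<inverse>)"
  shows "in_list s V E"
proof -
  obtain H where H: "H \<in> set (dig_list (Suc s))" "isomorphic \<lparr>pverts = V, parcs = E\<inverse>\<rparr> H"
    using assms(3) by (auto simp: in_list_def)
  have wf: "pair_wf_digraph \<lparr>pverts = V, parcs = E\<rparr>" "pair_wf_digraph \<lparr>pverts = V, parcs = E\<inverse>\<rparr>"
    using adm_pair_wf_digraph[of "\<lparr>pverts = V, parcs = E\<rparr>" "Suc s"]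
      adm_pair_wf_digraph[of "\<lparr>pverts = V, parcs = E\<inverse>\<rparr>" "Suc s"] adm adm.adm_converse by auto
  obtain f where f: "inj_on f V" "pverts H = f ` V" "parcs H = map_prod f f ` (E\<inverse>)"
    using iffD1[OF isomorphic_iff[OF wf(2)] H(2)] unfolding pair_pre_digraph.simps by blast
  have "(parcs H)\<inverse> = map_prod f f ` E"
    unfolding f(3) by (auto simp: image_iff; force)
  then have G: "isomorphic \<lparr>pverts = V, parcs = E\<rparr> (converse_digraph H)"
    using f(1,2) by (intro iffD2[OF isomorphic_iff[OF wf(1)]] exI[of _ f]) simp
  have "\<exists>K\<in>set (dig_list (Suc s)). isomorphic (converse_digraph H) K"
  proof -
    have refl: "isomorphic K K" if "K \<in> set (dig_list (Suc s))" for K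
      using isomorphic_refl[OF adm_pair_wf_digraph[OF adm_dig_list[OF s that]]] .
    have B: "\<exists>K\<in>set (dig_list (Suc s)). isomorphic (converse_digraph (dig_B (Suc s) t)) K" if "t \<le> s" for t
    proof (cases "1 \<le> t \<and> t < s")
      case True
      then have "converse_digraph (dig_B (Suc s) t) \<in> set (dig_list (Suc s))"
        using s by (auto simp: set_dig_list)
      then show ?thesis using refl by blast
    next
      case False
      then have "t = 0 \<or> t = s" using that by auto
      moreover have "dig_B (Suc s) t \<in> set (dig_list (Suc s))" using that s by (auto simp: set_dig_list)
      ultimately show ?thesis using converse_self(2,3)[OF s] by auto
    qed
    have cc: "converse_digraph (converse_digraph K) = K" for K :: "vertex pair_pre_digraph"
      by (simp add: converse_digraph_def)
    have "H \<in> {dig_A (Suc s), dig_C (Suc s), dig_D (Suc s)} \<or> (\<exists>t\<le>s. H = dig_B (Suc s) t)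
        \<or> (\<exists>t\<le>s. H = converse_digraph (dig_B (Suc s) t))"
      using H(1) s by (auto simp: set_dig_list intro: less_imp_le)
    then show ?thesis
    proof (elim disjE exE conjE)
      assume "H \<in> {dig_A (Suc s), dig_C (Suc s), dig_D (Suc s)}"
      then show ?thesis using converse_self(1,4,5)[OF s] H(1) by auto
    next
      fix t assume "t \<le> s" "H = dig_B (Suc s) t"
      then show ?thesis using B by simp
    next
      fix t assume "t \<le> s" "H = converse_digraph (dig_B (Suc s) t)"
      moreover from this have "dig_B (Suc s) t \<in> set (dig_list (Suc s))"
        using s by (auto simp: set_dig_list)
      ultimately show ?thesis using refl by (auto simp: cc)
    qed
  qed
  then show ?thesis using isomorphic_trans[OF G] by (auto simp: in_list_def)
qed

section \<open>Classification of the orientations\<close>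

text \<open>A numbering with one prescribed position, because one index is exceptional: the last in
  \<open>A\<close> and \<open>C\<close>, the first in \<open>D\<close>.\<close>

lemma bij_betw_fix_point:
  assumes "finite A" "card A = n" "k \<in> {1..n}" "a \<in> A"
  obtains g where "bij_betw g {1..n} A" "g k = (a :: 'a)"
proof -
  have "card ({1..n} - {k}) = card (A - {a})" using assms by simp
  then obtain h where h: "bij_betw h ({1..n} - {k}) (A - {a})"
    using assms(1) finite_same_card_bij[of "{1..n} - {k}" "A - {a}"] by auto
  define g where "g i = (if i = k then a else h i)" for i
  have "bij_betw g ({1..n} - {k}) (A - {a})"
    using h by (rule bij_betw_cong[THEN iffD1, rotated]) (simp add: g_def)
  moreover have "g k = a" by (simp add: g_def)
  ultimately have "bij_betw g (({1..n} - {k}) \<union> {k}) ((A - {a}) \<union> {a})"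
    using notIn_Un_bij_betw[of k "{1..n} - {k}" g "A - {a}"] by simp
  moreover have "({1..n} - {k}) \<union> {k} = {1..n}" "(A - {a}) \<union> {a} = A" using assms by auto
  ultimately show thesis using that \<open>g k = a\<close> by simp
qed

text \<open>A numbering that lists \<open>T\<close> first, since in
  \<open>B\<^sub>r\<^sub>,\<^sub>t\<close> the \<open>y\<^sub>i\<close> pointing to \<open>y\<close>
  are the first \<open>t\<close>.\<close>

lemma bij_betw_initial_segment:
  assumes "finite A" "card A = n" "T \<subseteq> A"
  obtains g where "bij_betw g {1..n} A" "\<And>i. i \<in> {1..n} \<Longrightarrow> (g i :: 'a) \<in> T \<longleftrightarrow> i \<le> card T"
proof -
  have fin: "finite T" using assms finite_subset by blast
  have le: "card T \<le> n" using assms card_mono by blast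
  obtain g1 where g1: "bij_betw g1 {1..card T} T"
    using fin ex_bij_betw_nat_finite_1 by blast
  have "card {card T + 1..n} = card (A - T)"
    using assms fin le by (simp add: card_Diff_subset)
  then obtain g2 where g2: "bij_betw g2 {card T + 1..n} (A - T)"
    using assms(1) finite_same_card_bij[of "{card T + 1..n}" "A - T"] by auto
  define g where "g i = (if i \<le> card T then g1 i else g2 i)" for i
  have b1: "bij_betw g {1..card T} T"
    using g1 by (rule bij_betw_cong[THEN iffD1, rotated]) (simp add: g_def)
  have b2: "bij_betw g {card T + 1..n} (A - T)"
    using g2 by (rule bij_betw_cong[THEN iffD1, rotated]) (simp add: g_def)
  have "bij_betw g ({1..card T} \<union> {card T + 1..n}) (T \<union> (A - T))"
    using b1 b2 by (rule bij_betw_combine) auto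
  moreover have "{1..card T} \<union> {card T + 1..n} = {1..n}" "T \<union> (A - T) = A" using le assms(3) by auto
  ultimately have "bij_betw g {1..n} A" by simp
  moreover have "g i \<in> T \<longleftrightarrow> i \<le> card T" if "i \<in> {1..n}" for i
  proof (cases "i \<le> card T")
    case True
    then show ?thesis using b1 that by (auto dest: bij_betwE)
  next
    case False
    then have "g i \<in> A - T" using b2 that by (auto dest: bij_betwE)
    then show ?thesis using False by simp
  qed
  ultimately show thesis by (rule that)
qed

text \<open>The candidate map sends the standard triangle to \<open>a\<close>, \<open>b\<close>,
  \<open>c\<close>, \<open>x\<^sub>i\<close> to \<open>p i\<close> and \<open>y\<^sub>i\<close> to
  \<open>g i\<close>. It covers \<open>V\<close> and is injective because both vertex sets have the
  same size.\<close>

lemma isomorphic_std: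
  assumes "adm V E (Suc s)" "adm (std_verts (Suc s)) (parcs H) (Suc s)" "pverts H = std_verts (Suc s)"
    and V: "V = {a, b, c} \<union> p ` {1..s} \<union> g ` {1..s}"
    and arcs: "\<And>u v. (u, v) \<in> parcs H \<Longrightarrow> (case_vertex a b c p g u, case_vertex a b c p g v) \<in> E"
  shows "isomorphic \<lparr>pverts = V, parcs = E\<rparr> H"
proof (rule isomorphicI[where f = "case_vertex a b c p g"])
  interpret G: adm V E "Suc s" by fact
  interpret H: adm "std_verts (Suc s)" "parcs H" "Suc s" by fact
  show "pair_digraph H"
    using H.two_geodetic_axioms assms(3) by (intro two_geodetic_pair_digraph) simp
  show "finite (parcs \<lparr>pverts = V, parcs = E\<rparr>)" by (simp add: G.finite_arcs)
  show "card (parcs \<lparr>pverts = V, parcs = E\<rparr>) = card (parcs H)"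
    using G.arcs_card H.arcs_card by simp
  have img: "case_vertex a b c p g ` std_verts (Suc s) = V"
    unfolding V std_verts_def by (simp add: image_Un image_image)
  then show "case_vertex a b c p g ` pverts H = pverts \<lparr>pverts = V, parcs = E\<rparr>"
    using assms(3) by simp
  show "inj_on (case_vertex a b c p g) (pverts H)"
    using assms(3) G.order H.order img H.finite_verts by (metis eq_card_imp_inj_on)
qed (use arcs in simp)

text \<open>As in the criteria below, the triangle \<open>a\<close>, \<open>b\<close>,
  \<open>c\<close> is a parameter: it will be the triangle of the configuration, a rotation of it
  or, once for \<open>C\<close>, a different triangle.\<close>

lemma in_list_A:
  assumes "adm V E (Suc s)" "4 \<le> s" "V = {a, b, c} \<union> p ` {1..s} \<union> g ` {1..s}"
    and "(a, b) \<in> E" "(b, c) \<in> E" "(c, a) \<in> E"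
    and "\<And>i j. i \<in> {1..s} \<Longrightarrow> j \<in> {1..s} \<Longrightarrow> i \<noteq> j \<Longrightarrow> (g j, p i) \<in> E"
    and "\<And>i. 1 \<le> i \<Longrightarrow> i < s \<Longrightarrow> (p i, g i) \<in> E \<and> (a, p i) \<in> E \<and> (g i, b) \<in> E"
    and "(g s, p s) \<in> E" "(p s, a) \<in> E" "(b, g s) \<in> E"
  shows "in_list s V E"
proof -
  have arc_back: "(g j, p i) \<in> E" if "i \<in> {1..s}" "j \<in> {1..s}" "i \<noteq> j \<or> i = s" for i j
    using assms(7,9) that by (cases "i = j") auto
  have "isomorphic \<lparr>pverts = V, parcs = E\<rparr> (dig_A (Suc s))"
  proof (rule isomorphic_std[OF assms(1) adm_A[OF assms(2)] _ assms(3)])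
    show "(case_vertex a b c p g u, case_vertex a b c p g v) \<in> E" if "(u, v) \<in> parcs (dig_A (Suc s))" for u v
      using that assms(2,4-6,8-) arc_back by (cases u) (auto simp: arcs_A)
  qed simp
  then show ?thesis using assms(2) by (auto simp: in_list_def set_dig_list)
qed

lemma in_list_B:
  assumes "adm V E (Suc s)" "4 \<le> s" "t \<le> s" "V = {a, b, c} \<union> p ` {1..s} \<union> g ` {1..s}"
    and "(a, b) \<in> E" "(b, c) \<in> E" "(c, a) \<in> E"
    and "\<And>i j. i \<in> {1..s} \<Longrightarrow> j \<in> {1..s} \<Longrightarrow> i \<noteq> j \<Longrightarrow> (g j, p i) \<in> E"
    and "\<And>i. i \<in> {1..s} \<Longrightarrow> (p i, g i) \<in> E \<and> (a, p i) \<in> E"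
    and "\<And>i. i \<in> {1..s} \<Longrightarrow> i \<le> t \<Longrightarrow> (g i, b) \<in> E"
    and "\<And>i. i \<in> {1..s} \<Longrightarrow> t < i \<Longrightarrow> (g i, c) \<in> E"
  shows "in_list s V E"
proof -
  have "isomorphic \<lparr>pverts = V, parcs = E\<rparr> (dig_B (Suc s) t)"
  proof (rule isomorphic_std[OF assms(1) adm_B[OF assms(2,3)] _ assms(4)])
    show "(case_vertex a b c p g u, case_vertex a b c p g v) \<in> E" if "(u, v) \<in> parcs (dig_B (Suc s) t)" for u v
      using that assms(3,5-) by (cases u) (auto simp: arcs_B)
  qed simp
  moreover have "dig_B (Suc s) t \<in> set (dig_list (Suc s))"
    using assms(2,3) by (subst set_dig_list) auto
  ultimately show ?thesis unfolding in_list_def by blast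
qed

lemma in_list_C:
  assumes "adm V E (Suc s)" "4 \<le> s" "V = {a, b, c} \<union> p ` {1..s} \<union> g ` {1..s}"
    and "(a, b) \<in> E" "(b, c) \<in> E" "(c, a) \<in> E"
    and "\<And>i j. i \<in> {1..s} \<Longrightarrow> j \<in> {1..s} \<Longrightarrow> i \<noteq> j \<Longrightarrow> (g j, p i) \<in> E"
    and "\<And>i. 1 \<le> i \<Longrightarrow> i < s \<Longrightarrow> (p i, g i) \<in> E \<and> (b, p i) \<in> E \<and> (g i, a) \<in> E"
    and "(g s, p s) \<in> E" "(p s, c) \<in> E" "(c, g s) \<in> E"
  shows "in_list s V E"
proof -
  have arc_back: "(g j, p i) \<in> E" if "i \<in> {1..s}" "j \<in> {1..s}" "i \<noteq> j \<or> i = s" for i j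
    using assms(7,9) that by (cases "i = j") auto
  have "isomorphic \<lparr>pverts = V, parcs = E\<rparr> (dig_C (Suc s))"
  proof (rule isomorphic_std[OF assms(1) adm_C[OF assms(2)] _ assms(3)])
    show "(case_vertex a b c p g u, case_vertex a b c p g v) \<in> E" if "(u, v) \<in> parcs (dig_C (Suc s))" for u v
      using that assms(2,4-6,8-) arc_back by (cases u) (auto simp: arcs_C)
  qed simp
  then show ?thesis using assms(2) by (auto simp: in_list_def set_dig_list)
qed

lemma in_list_D:
  assumes "adm V E (Suc s)" "4 \<le> s" "V = {a, b, c} \<union> p ` {1..s} \<union> g ` {1..s}"
    and "(a, b) \<in> E" "(b, c) \<in> E" "(c, a) \<in> E"
    and "\<And>i j. i \<in> {1..s} \<Longrightarrow> j \<in> {1..s} \<Longrightarrow> i \<noteq> j \<Longrightarrow> (g j, p i) \<in> E"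
    and "\<And>i. i \<in> {1..s} \<Longrightarrow> (p i, g i) \<in> E"
    and "\<And>i. 1 < i \<Longrightarrow> i \<le> s \<Longrightarrow> (b, p i) \<in> E \<and> (g i, a) \<in> E"
    and "(c, p 1) \<in> E" "(g 1, c) \<in> E"
  shows "in_list s V E"
proof -
  have "isomorphic \<lparr>pverts = V, parcs = E\<rparr> (dig_D (Suc s))"
  proof (rule isomorphic_std[OF assms(1) adm_D[OF assms(2)] _ assms(3)])
    show "(case_vertex a b c p g u, case_vertex a b c p g v) \<in> E" if "(u, v) \<in> parcs (dig_D (Suc s))" for u v
      using that assms by (cases u) (auto simp: arcs_D not_less_eq_eq)
  qed simp
  then show ?thesis using assms(2) by (auto simp: in_list_def set_dig_list)
qed

section \<open>Symmetries of a configuration and forced arcs between its sides\<close>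

context config
begin

lemma config_rotate: "config V E s y z x P Q"
  using config_axioms unfolding config_def config_axioms_def by (auto simp: insert_commute)

lemma config_swap: "config V E s x y z Q P"
proof
  show "\<exists>!a. a \<in> {x, y, z} \<and> ((a, w) \<in> E \<or> (w, a) \<in> E)" if "w \<in> Q \<union> P" for w
    using attached[of w] that by (simp add: Un_commute)
  show "V = {x, y, z} \<union> Q \<union> P" using verts by auto
  show "(p, q) \<in> E \<or> (q, p) \<in> E" if "p \<in> Q" "q \<in> P" for p q using complete that by blast
qed (use tri disj card_P card_Q s_ge ind_P ind_Q in auto)

lemma config_converse: "config V (E\<inverse>) s z y x P Q"
proof -
  interpret c: adm V "E\<inverse>" "Suc s" by (rule adm_converse)
  show ?thesis
  proof
    show "\<exists>!a. a \<in> {z, y, x} \<and> ((a, w) \<in> E\<inverse> \<or> (w, a) \<in> E\<inverse>)" if "w \<in> P \<union> Q" for w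
      using attached[OF that] by (simp add: insert_commute disj_commute)
    show "V = {z, y, x} \<union> P \<union> Q" using verts by auto
    show "(p, q) \<in> E\<inverse> \<or> (q, p) \<in> E\<inverse>" if "p \<in> P" "q \<in> Q" for p q using complete that by blast
  qed (use tri disj card_P card_Q s_ge ind_P ind_Q in auto)
qed

lemma finite_PQ: "finite P" "finite Q"
  using finite_verts verts by auto

lemma attached_adj: "w \<in> P \<union> Q \<Longrightarrow> adj x w \<or> adj y w \<or> adj z w"
  using attached[of w] by (auto simp: adj_def)

lemma attached_unique:
  assumes "w \<in> P \<union> Q" "a \<in> {x, y, z}" "b \<in> {x, y, z}" "adj a w" "adj b w"
  shows "a = b"
  using attached[OF assms(1)] assms(2-5) unfolding adj_def by blast

lemma xyz_distinct: "x \<noteq> y" "y \<noteq> z" "x \<noteq> z"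
  using tri no_loop by auto

lemma adj_PQ: "p \<in> P \<Longrightarrow> q \<in> Q \<Longrightarrow> adj p q"
  using complete by (auto simp: adj_def)

text \<open>Otherwise the edge joining \<open>a\<close> and \<open>q\<close> would lie in triangles
  with both \<open>p1\<close> and \<open>p2\<close>.\<close>

lemma no_Q_nb:
  assumes "p1 \<in> P" "p2 \<in> P" "p1 \<noteq> p2" "adj a p1" "adj a p2" "q \<in> Q"
  shows "\<not> adj a q"
  using edge_in_one_triangle[of a q p1 p2] assms adj_PQ adj_commute by metis

text \<open>Each \<open>q\<close> points to \<open>o1\<close> or \<open>o2\<close>, since otherwise
  \<open>x\<close> would reach it through both. An arc from \<open>z\<close> to \<open>q\<close>
  would then compete with the walk from \<open>z\<close> through \<open>x\<close> to that vertex,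
  and an arc from \<open>p\<close> to \<open>q\<close> with the walk from \<open>p\<close> through
  \<open>x\<close>. Finally, two in-neighbours of \<open>x\<close> in \<open>P\<close> would give
  two walks to \<open>x\<close> from any \<open>q\<close>.\<close>

lemma two_out_nbs:
  assumes o: "o1 \<in> P" "o2 \<in> P" "o1 \<noteq> o2" "(x, o1) \<in> E" "(x, o2) \<in> E"
  shows "q \<in> Q \<Longrightarrow> \<not> adj x q"
    and "q \<in> Q \<Longrightarrow> (z, q) \<notin> E"
    and "p \<in> P \<Longrightarrow> (p, x) \<in> E \<Longrightarrow> q \<in> Q \<Longrightarrow> (q, p) \<in> E"
    and "p \<in> P \<Longrightarrow> p' \<in> P \<Longrightarrow> (p, x) \<in> E \<Longrightarrow> (p', x) \<in> E \<Longrightarrow> p = p'"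
proof -
  have meet: "(q, o1) \<in> E \<or> (q, o2) \<in> E" if "q \<in> Q" for q
    using complete[OF o(1) that] complete[OF o(2) that] unique_mid o(3-5) by blast
  have xQ: "x \<noteq> q" if "q \<in> Q" for q using disj that by auto
  show "\<not> adj x q" if "q \<in> Q"
    using no_Q_nb[OF o(1-3) _ _ that] o(4,5) by (auto simp: adj_def)
  show "(z, q) \<notin> E" if "q \<in> Q"
    using unique_mid[of z x _ q] tri(3) o(4,5) meet[OF that] xQ[OF that] by blast
  have in_nb: "(q, p) \<in> E" if "p \<in> P" "(p, x) \<in> E" "q \<in> Q" for p q
    using unique_mid[of p x _ q] o(4,5) meet[OF that(3)] xQ[OF that(3)] complete that by blast
  then show "p \<in> P \<Longrightarrow> (p, x) \<in> E \<Longrightarrow> q \<in> Q \<Longrightarrow> (q, p) \<in> E" .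
  have "Q \<noteq> {}" using card_Q s_ge by auto
  then show "p = p'" if "p \<in> P" "p' \<in> P" "(p, x) \<in> E" "(p', x) \<in> E"
    using in_nb that unique_mid by blast
qed

text \<open>Out-neighbours of \<open>x\<close> in \<open>P\<close> have disjoint out-neighbourhoods, and any two vertices of \<open>P\<close> have
  at most one 2-walk between them, so the out-neighbourhoods are singletons.\<close>

lemma out_matching:
  assumes o: "o1 \<in> P" "o2 \<in> P" "o1 \<noteq> o2" "(x, o1) \<in> E" "(x, o2) \<in> E"
  obtains m where "\<And>p. p \<in> P \<Longrightarrow> (x, p) \<in> E \<Longrightarrow> m p \<in> Q"
    and "\<And>p q. p \<in> P \<Longrightarrow> (x, p) \<in> E \<Longrightarrow> q \<in> Q \<Longrightarrow> (p, q) \<in> E \<longleftrightarrow> q = m p"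
    and "inj_on m {p \<in> P. (x, p) \<in> E}"
proof -
  have ex: "\<exists>q\<in>Q. (p, q) \<in> E" if p: "p \<in> P" "(x, p) \<in> E" for p
  proof -
    obtain v where v: "(p, v) \<in> E" using no_sink[of p] p verts by auto
    have "v \<in> V" using v arcs_subset by auto
    moreover have "v \<noteq> x" using no_2cycle p v by blast
    moreover have "v \<notin> {y, z}"
      using attached_unique[of p x v] p v xyz_distinct by (auto simp: adj_def)
    moreover have "v \<notin> P" using ind_P p v by blast
    ultimately show ?thesis using v verts by auto
  qed
  have unique: "q = q'" if p: "p \<in> P" "(x, p) \<in> E" and q: "q \<in> Q" "q' \<in> Q" "(p, q) \<in> E" "(p, q') \<in> E" for p q q'
  proof -
    obtain p' where p': "p' \<in> P" "(x, p') \<in> E" "p' \<noteq> p" using o by metis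
    have "(p', q) \<notin> E" "(p', q') \<notin> E" using unique_mid[of x p _ p'] p p' q by blast+
    then have "(q, p') \<in> E" "(q', p') \<in> E" using complete p' q by blast+
    then show ?thesis using unique_mid q by blast
  qed
  define m where "m p = (THE q. q \<in> Q \<and> (p, q) \<in> E)" for p
  have m: "m p \<in> Q \<and> (p, m p) \<in> E" if "p \<in> P" "(x, p) \<in> E" for p
  proof -
    have "\<exists>!q. q \<in> Q \<and> (p, q) \<in> E" using ex[OF that] unique[OF that] by blast
    from theI'[OF this] show ?thesis unfolding m_def .
  qed
  show thesis
  proof (rule that)
    show "m p \<in> Q" if "p \<in> P" "(x, p) \<in> E" for p using m that by blast
    show "(p, q) \<in> E \<longleftrightarrow> q = m p" if "p \<in> P" "(x, p) \<in> E" "q \<in> Q" for p q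
      using m unique that by blast
    show "inj_on m {p \<in> P. (x, p) \<in> E}"
    proof (rule inj_onI)
      fix p p' assume p: "p \<in> {p \<in> P. (x, p) \<in> E}" "p' \<in> {p \<in> P. (x, p) \<in> E}" "m p = m p'"
      then have "(p, m p) \<in> E" "(p', m p) \<in> E" using m[of p] m[of p'] by auto
      then show "p = p'" using unique_mid p by blast
    qed
  qed
qed

text \<open>Determines all arcs between \<open>P\<close> and \<open>Q\<close> except the one joining
  \<open>p0\<close> and \<open>qb\<close>. Its direction is left to the separate cases; in
  \<open>hub_y_out\<close> it decides between \<open>C\<close> and \<open>D\<close>.\<close>

definition matched :: "('v \<Rightarrow> 'v) \<Rightarrow> 'v \<Rightarrow> 'v \<Rightarrow> bool" where
  "matched m p0 qb \<longleftrightarrow> p0 \<in> P \<and> qb \<in> Q \<and> bij_betw m (P - {p0}) (Q - {qb}) \<and>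
    (\<forall>p\<in>P - {p0}. \<forall>q\<in>Q. (p, q) \<in> E \<longleftrightarrow> q = m p) \<and> (\<forall>q\<in>Q - {qb}. (q, p0) \<in> E)"

lemma matchedD:
  assumes "matched m p0 qb"
  shows "qb \<in> Q" "bij_betw m (P - {p0}) (Q - {qb})"
    "p \<in> P - {p0} \<Longrightarrow> q \<in> Q \<Longrightarrow> (p, q) \<in> E \<longleftrightarrow> q = m p" "q \<in> Q - {qb} \<Longrightarrow> (q, p0) \<in> E" "p0 \<in> P"
  using assms by (auto simp: matched_def)

text \<open>Position \<open>k\<close> receives the exceptional pair, whose direction stays open as
  in \<open>matched\<close>; \<open>k\<close> is \<open>s\<close> for \<open>A\<close> and
  \<open>C\<close>, and 1 for \<open>D\<close>.\<close>

definition enumerated :: "nat \<Rightarrow> (nat \<Rightarrow> 'v) \<Rightarrow> (nat \<Rightarrow> 'v) \<Rightarrow> 'v \<Rightarrow> 'v \<Rightarrow> bool" where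
  "enumerated k p g p0 qb \<longleftrightarrow> p ` {1..s} = P \<and> g ` {1..s} = Q \<and> p k = p0 \<and> g k = qb \<and>
    (\<forall>i\<in>{1..s} - {k}. p i \<in> P - {p0} \<and> g i \<in> Q - {qb} \<and> (p i, g i) \<in> E) \<and>
    (\<forall>i\<in>{1..s}. \<forall>j\<in>{1..s}. i \<noteq> j \<longrightarrow> (g j, p i) \<in> E)"

lemma enumeratedD:
  assumes "enumerated k p g p0 qb"
  shows "p ` {1..s} = P" "g ` {1..s} = Q" "p k = p0" "g k = qb"
    "i \<in> {1..s} \<Longrightarrow> i \<noteq> k \<Longrightarrow> p i \<in> P - {p0} \<and> g i \<in> Q - {qb} \<and> (p i, g i) \<in> E"
    "i \<in> {1..s} \<Longrightarrow> j \<in> {1..s} \<Longrightarrow> i \<noteq> j \<Longrightarrow> (g j, p i) \<in> E"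
  using assms by (auto simp: enumerated_def)

text \<open>\<open>out_matching\<close> applies to the \<open>s - 1\<close> out-neighbours of
  \<open>x\<close> in \<open>P\<close>, and its image misses exactly one vertex \<open>qb\<close>.
  The arcs at \<open>p0\<close> and at \<open>y\<close> are then forced because the matching already
  provides walks of length 2.\<close>

lemma matching_except_one:
  assumes p0: "p0 \<in> P" "(x, p0) \<notin> E" and out: "\<And>p. p \<in> P \<Longrightarrow> p \<noteq> p0 \<Longrightarrow> (x, p) \<in> E"
  obtains m qb where "matched m p0 qb" "\<forall>q\<in>Q - {qb}. (y, q) \<notin> E"
proof -
  have c: "card (P - {p0}) = s - 1" using card_P p0 by simp
  then have "\<exists>o1\<in>P - {p0}. \<exists>o2\<in>P - {p0}. o1 \<noteq> o2"
    using s_ge by (intro two_elements) simp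
  then obtain o1 o2 where o12: "o1 \<in> P - {p0}" "o2 \<in> P - {p0}" "o1 \<noteq> o2" by blast
  then have o: "o1 \<in> P" "o2 \<in> P" "o1 \<noteq> o2" "(x, o1) \<in> E" "(x, o2) \<in> E" using out by auto
  obtain m where m: "\<And>p. p \<in> P \<Longrightarrow> (x, p) \<in> E \<Longrightarrow> m p \<in> Q"
    "\<And>p q. p \<in> P \<Longrightarrow> (x, p) \<in> E \<Longrightarrow> q \<in> Q \<Longrightarrow> (p, q) \<in> E \<longleftrightarrow> q = m p"
    "inj_on m {p \<in> P. (x, p) \<in> E}"
    using out_matching[OF o] by blast
  have O: "{p \<in> P. (x, p) \<in> E} = P - {p0}" using p0 out by auto
  let ?M = "m ` (P - {p0})"
  have sub: "?M \<subseteq> Q" using m(1) out by auto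
  have "card ?M = s - 1" using m(3) c unfolding O by (simp add: card_image)
  then have "card (Q - ?M) = 1"
    using card_Diff_subset[OF finite_subset[OF sub finite_PQ(2)] sub] card_Q s_ge by simp
  then obtain qb where qb: "Q - ?M = {qb}" by (auto simp: card_1_singleton_iff)
  then have M: "?M = Q - {qb}" "qb \<in> Q" using sub by auto
  have match: "(p, q) \<in> E \<longleftrightarrow> q = m p" if "p \<in> P - {p0}" "q \<in> Q" for p q
    using m(2) out that by auto
  have bij: "bij_betw m (P - {p0}) (Q - {qb})"
    using m(3) M(1) unfolding O by (simp add: bij_betw_def)
  show thesis
  proof (rule that)
    have "(q, p0) \<in> E" if q: "q \<in> Q - {qb}" for q
    proof (rule ccontr)
      assume "(q, p0) \<notin> E"
      then have p0q: "(p0, q) \<in> E" using complete p0 q by blast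
      obtain p where p: "p \<in> P - {p0}" "q = m p" using q M(1) by blast
      \<comment> \<open>\<open>4 \<le> s\<close> leaves two vertices \<open>p1\<close>,
        \<open>p2\<close> besides \<open>p0\<close> and \<open>p\<close>. Their partners point to
        \<open>p\<close>, so they cannot also point to \<open>p0\<close>, which would give a second
        walk to \<open>q\<close>; but then \<open>p0\<close> reaches \<open>p\<close> through both
        partners.\<close>
      have "card (P - {p0} - {p}) = s - 2" using c p by simp
      then have "\<exists>p1\<in>P - {p0} - {p}. \<exists>p2\<in>P - {p0} - {p}. p1 \<noteq> p2"
        using s_ge by (intro two_elements) simp
      then obtain p1 p2 where p12: "p1 \<in> P - {p0} - {p}" "p2 \<in> P - {p0} - {p}" "p1 \<noteq> p2" by blast
      have pq: "(p, q) \<in> E" using match p q by auto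
      have mne: "m a \<noteq> m b" if "a \<in> P - {p0}" "b \<in> P - {p0}" "a \<noteq> b" for a b
        using bij that by (auto simp: bij_betw_def dest: inj_onD)
      have to: "m p' \<in> Q \<and> (m p', p) \<in> E \<and> (p0, m p') \<in> E" if p': "p' \<in> P - {p0} - {p}" for p'
      proof -
        have Q: "m p' \<in> Q" using p' sub by auto
        have "(p, m p') \<notin> E" using match[of p "m p'"] p p' Q mne[of p p'] by auto
        then have m_p: "(m p', p) \<in> E" using complete p Q by blast
        then have "(m p', p0) \<notin> E" using unique_mid[of "m p'" p q p0] pq p0q p by blast
        then show ?thesis using complete[OF p0(1) Q] Q m_p by blast
      qed
      have "m p1 = m p2" using to[OF p12(1)] to[OF p12(2)] unique_mid by blast
      then show False using mne p12 by blast
    qed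
    then show "matched m p0 qb"
      using bij match p0(1) M(2) by (auto simp: matched_def)
    have "(y, q) \<notin> E" if q: "q \<in> Q - {qb}" for q
    proof
      assume "(y, q) \<in> E"
      moreover obtain p where p: "p \<in> P - {p0}" "q = m p" using q M(1) by blast
      moreover have "(x, p) \<in> E" "(p, q) \<in> E" using p q match out by auto
      ultimately have "y = p" using unique_mid tri(1) by blast
      then show False using p disj by auto
    qed
    then show "\<forall>q\<in>Q - {qb}. (y, q) \<notin> E" by blast
  qed
qed

lemma index_mem: "1 \<in> {1..s}" "s \<in> {1..s}"
  using s_ge by auto

text \<open>\<open>P\<close> is numbered with \<open>p0\<close> at position \<open>k\<close>;
  \<open>m\<close> carries the numbering over to \<open>Q\<close>, and \<open>qb\<close> fills
  position \<open>k\<close>.\<close>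

lemma matching_enumeration:
  assumes "matched m p0 qb" and k: "k \<in> {1..s}"
  obtains p g where "enumerated k p g p0 qb"
proof -
  note m = matchedD[OF assms(1)]
  note qbQ = m(1) and bij = m(2) and match = m(3) and rest = m(4) and p0 = m(5)
  obtain p where p: "bij_betw p {1..s} P" "p k = p0"
    using bij_betw_fix_point[OF finite_PQ(1) card_P k p0] by blast
  define g where "g i = (if i = k then qb else m (p i))" for i
  have inj: "i = j" if "p i = p j" "i \<in> {1..s}" "j \<in> {1..s}" for i j
    using p(1) that by (auto simp: bij_betw_def dest: inj_onD)
  have pP: "p i \<in> P" if "i \<in> {1..s}" for i
    using p(1) that by (auto dest: bij_betwE)
  have pO: "p i \<in> P - {p0}" if "i \<in> {1..s}" "i \<noteq> k" for i
    using pP[OF that(1)] inj[of i k] p(2) that k by auto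
  have gQ: "g i \<in> Q - {qb}" if "i \<in> {1..s}" "i \<noteq> k" for i
    using pO[OF that] bij that(2) by (auto simp: g_def bij_betw_def)
  have pg: "g j = m (p i) \<longleftrightarrow> i = j" if "i \<in> {1..s}" "j \<in> {1..s}" "i \<noteq> k" for i j
  proof (cases "j = k")
    case True
    then show ?thesis using gQ[OF that(1,3)] that(3) by (auto simp: g_def)
  next
    case False
    then have "g j = m (p j)" by (simp add: g_def)
    moreover have "m (p j) = m (p i) \<longleftrightarrow> p j = p i"
      using inj_on_eq_iff[OF bij_betw_imp_inj_on[OF bij] pO[OF that(2) False] pO[OF that(1,3)]] .
    ultimately show ?thesis using inj[OF _ that(1,2)] by metis
  qed
  have "enumerated k p g p0 qb"
    unfolding enumerated_def
  proof (intro conjI ballI impI)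
    show "p ` {1..s} = P" using p(1) by (simp add: bij_betw_def)
    show "p k = p0" by fact
    show "g k = qb" by (simp add: g_def)
    have "p ` ({1..s} - {k}) = P - {p0}"
    proof -
      have "p ` ({1..s} - {k}) = p ` {1..s} - p ` {k}"
        by (rule inj_on_image_set_diff[of p "{1..s}"]) (use p(1) k in \<open>auto simp: bij_betw_def\<close>)
      then show ?thesis using p by (simp add: bij_betw_def)
    qed
    then have "Q - {qb} = m ` p ` ({1..s} - {k})" using bij by (simp add: bij_betw_def)
    also have "\<dots> = g ` ({1..s} - {k})" by (auto simp: g_def image_image)
    finally have "insert qb (Q - {qb}) = insert (g k) (g ` ({1..s} - {k}))" by (simp add: g_def)
    then have "Q = g ` insert k ({1..s} - {k})" unfolding insert_Diff[OF qbQ] image_insert .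
    then show "g ` {1..s} = Q" unfolding insert_Diff[OF k] by (rule sym)
    show "p i \<in> P - {p0}" "g i \<in> Q - {qb}" "(p i, g i) \<in> E" if "i \<in> {1..s} - {k}" for i
      using pO[of i] gQ[of i] match[of "p i" "g i"] pg[of i i] that by auto
    show "(g j, p i) \<in> E" if ij: "i \<in> {1..s}" "j \<in> {1..s}" "i \<noteq> j" for i j
    proof (cases "i = k")
      case True
      then show ?thesis using rest[OF gQ[of j]] ij p(2) by auto
    next
      case False
      have "g j \<in> Q" using gQ[of j] ij qbQ by (cases "j = k") (auto simp: g_def)
      moreover have "(p i, g j) \<notin> E" using match[OF pO[OF ij(1) False] \<open>g j \<in> Q\<close>] pg[OF ij(1,2) False] ij(3) by simp
      ultimately show ?thesis using complete pP ij(1) by blast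
    qed
  qed
  then show thesis by (rule that)
qed

text \<open>Serves to attach the unmatched vertex \<open>qb\<close>: something must point to it, and
  only \<open>y\<close> is left.\<close>

lemma in_source:
  assumes "q \<in> Q" "\<not> adj x q" "(z, q) \<notin> E" "\<And>p. p \<in> P \<Longrightarrow> (p, q) \<notin> E"
  shows "(y, q) \<in> E"
proof -
  obtain u where u: "(u, q) \<in> E" using no_source[of q] assms(1) verts by auto
  then have "u \<in> V" using arcs_subset by auto
  then show ?thesis using u assms ind_Q verts by (auto simp: adj_def)
qed

text \<open>By \<open>two_out_nbs\<close>, at most one vertex of \<open>P\<close> points to
  \<open>x\<close>. If none does, all of \<open>P\<close> is matched with \<open>Q\<close> and the
  digraph is \<open>B\<close>, with \<open>t\<close> the number of vertices of \<open>Q\<close>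
  pointing to \<open>y\<close>. If \<open>p0\<close> does, every vertex of \<open>Q\<close> points
  to \<open>p0\<close> and the digraph is \<open>A\<close>.\<close>

lemma cover_P_out:
  assumes adj: "\<And>p. p \<in> P \<Longrightarrow> adj x p"
    and o: "o1 \<in> P" "o2 \<in> P" "o1 \<noteq> o2" "(x, o1) \<in> E" "(x, o2) \<in> E"
  shows "in_list s V E"
proof -
  obtain m where m: "\<And>p. p \<in> P \<Longrightarrow> (x, p) \<in> E \<Longrightarrow> m p \<in> Q"
    "\<And>p q. p \<in> P \<Longrightarrow> (x, p) \<in> E \<Longrightarrow> q \<in> Q \<Longrightarrow> (p, q) \<in> E \<longleftrightarrow> q = m p"
    "inj_on m {p \<in> P. (x, p) \<in> E}"
    using out_matching[OF o] by blast
  note noQ = two_out_nbs(1)[OF o] and noz = two_out_nbs(2)[OF o]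
    and inp = two_out_nbs(3)[OF o] and in1 = two_out_nbs(4)[OF o]
  show ?thesis
  proof (cases "\<exists>p\<in>P. (p, x) \<in> E")
    case False
    then have out: "(x, p) \<in> E" if "p \<in> P" for p using adj that by (auto simp: adj_def)
    then have O: "{p \<in> P. (x, p) \<in> E} = P" by auto
    have "m ` P \<subseteq> Q" using m(1) out by auto
    moreover have "card (m ` P) = card Q" using m(3) card_P card_Q unfolding O by (simp add: card_image)
    ultimately have mP: "m ` P = Q" using finite_PQ by (intro card_subset_eq)
    have noy: "(y, q) \<notin> E" if q: "q \<in> Q" for q
    proof
      assume "(y, q) \<in> E"
      moreover obtain p where p: "p \<in> P" "q = m p" using q mP by blast
      moreover have "(p, q) \<in> E" using m(2) p q out by blast
      ultimately have "y = p" using unique_mid tri(1) out by blast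
      then show False using p disj by auto
    qed
    have yz: "(q, y) \<in> E \<or> (q, z) \<in> E" if "q \<in> Q" for q
      using attached_adj[of q] noQ noy noz that by (auto simp: adj_def)
    let ?T = "{p \<in> P. (m p, y) \<in> E}"
    obtain p where p: "bij_betw p {1..s} P" "\<And>i. i \<in> {1..s} \<Longrightarrow> p i \<in> ?T \<longleftrightarrow> i \<le> card ?T"
      using bij_betw_initial_segment[OF finite_PQ(1) card_P, of ?T] by blast
    have pP: "p i \<in> P" if "i \<in> {1..s}" for i using p(1) that by (auto dest: bij_betwE)
    have pinj: "i = j" if "p i = p j" "i \<in> {1..s}" "j \<in> {1..s}" for i j
      using p(1) that by (auto simp: bij_betw_def dest: inj_onD)
    have mQ: "m (p i) \<in> Q" if "i \<in> {1..s}" for i using m(1) out pP that by blast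
    show ?thesis
    proof (rule in_list_B[where t = "card ?T" and a = x and b = y and c = z and p = p and g = "\<lambda>i. m (p i)"])
      show "adm V E (Suc s)" by unfold_locales
      show "card ?T \<le> s" using card_mono[OF finite_PQ(1), of ?T] card_P by auto
      show "V = {x, y, z} \<union> p ` {1..s} \<union> (\<lambda>i. m (p i)) ` {1..s}"
        unfolding image_image[of m p, symmetric] using p(1) mP verts by (simp add: bij_betw_def)
      show "(m (p j), p i) \<in> E" if "i \<in> {1..s}" "j \<in> {1..s}" "i \<noteq> j" for i j
      proof -
        have "m (p j) \<noteq> m (p i)"
          using m(3) pP[OF that(1)] pP[OF that(2)] pinj that unfolding O by (auto dest: inj_onD)
        then have "(p i, m (p j)) \<notin> E" using m(2) pP out mQ that by blast
        then show ?thesis using complete pP mQ that by blast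
      qed
      show "(p i, m (p i)) \<in> E \<and> (x, p i) \<in> E" if "i \<in> {1..s}" for i
        using m(2) pP out mQ that by blast
      show "(m (p i), y) \<in> E" if "i \<in> {1..s}" "i \<le> card ?T" for i
        using p(2) that by blast
      show "(m (p i), z) \<in> E" if "i \<in> {1..s}" "card ?T < i" for i
      proof -
        have "(m (p i), y) \<notin> E" using p(2)[OF that(1)] that(2) pP[OF that(1)] by auto
        then show ?thesis using yz[OF mQ[OF that(1)]] by blast
      qed
    qed (use tri s_ge in auto)
  next
    case True
    then obtain p0 where p0: "p0 \<in> P" "(p0, x) \<in> E" by blast
    have out: "(x, p) \<in> E" if "p \<in> P" "p \<noteq> p0" for p
      using adj[OF that(1)] in1[OF that(1) p0(1)] that p0(2) by (auto simp: adj_def)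
    have x_p0: "(x, p0) \<notin> E" using no_2cycle p0 by blast
    obtain m' qb where mt: "matched m' p0 qb" and ny: "\<forall>q\<in>Q - {qb}. (y, q) \<notin> E"
    by (rule matching_except_one[OF p0(1) x_p0 out])
  note m' = matchedD(1-4)[OF mt] ny[rule_format]
    \<comment> \<open>\<open>q\<close> already reaches \<open>x\<close> through \<open>p0\<close>,
      so it cannot point to \<open>z\<close>, which also leads to \<open>x\<close>.\<close>
    have to_y: "(q, y) \<in> E" if "q \<in> Q - {qb}" for q
    proof -
      have "(q, z) \<notin> E" using unique_mid[of q z x p0] tri(3) p0 inp[of p0 q] that disj by auto
      then show ?thesis using attached_adj[of q] noQ noz m'(5) that by (auto simp: adj_def)
    qed
    have qb_out: "(qb, p) \<in> E" if "p \<in> P" for p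
    proof (cases "p = p0")
      case True
      then show ?thesis using inp p0 m'(1) by blast
    next
      case False
      then have "m' p \<in> Q - {qb}" using m'(2) that by (auto dest: bij_betwE)
      then have "(p, qb) \<notin> E" using m'(1,3) that False by auto
      then show ?thesis using complete m'(1) that by blast
    qed
    then have y_qb: "(y, qb) \<in> E"
      using in_source[OF m'(1)] noQ noz m'(1) no_2cycle by blast
    obtain p g where "enumerated s p g p0 qb"
      by (rule matching_enumeration[OF mt index_mem(2)])
    note pg = enumeratedD[OF this]
    show ?thesis
    proof (rule in_list_A[where a = x and b = y and c = z and p = p and g = g])
      show "adm V E (Suc s)" by unfold_locales
      show "V = {x, y, z} \<union> p ` {1..s} \<union> g ` {1..s}" using verts pg(1,2) by simp
      show "(p i, g i) \<in> E \<and> (x, p i) \<in> E \<and> (g i, y) \<in> E" if "1 \<le> i" "i < s" for i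
        using pg(5)[of i] that out to_y by auto
      show "(g j, p i) \<in> E" if "i \<in> {1..s}" "j \<in> {1..s}" "i \<noteq> j" for i j using pg(6) that .
      show "(g s, p s) \<in> E" "(p s, x) \<in> E" "(y, g s) \<in> E" unfolding pg(3,4)
        using p0 qb_out y_qb by auto
    qed (use tri s_ge in auto)
  qed
qed

text \<open>Here \<open>y\<close> is a hub with one neighbour on each side. Whether
  \<open>p0\<close> points to \<open>qb\<close> decides between \<open>D\<close> and
  \<open>C\<close>. In both the triangle is read as \<open>z\<close>, \<open>x\<close>,
  \<open>y\<close>, so that \<open>z\<close> and \<open>x\<close> take the places of the standard
  \<open>x\<close> and \<open>y\<close>.\<close>

lemma hub_y_out:
  assumes p0: "p0 \<in> P" "adj y p0" and q0: "q0 \<in> Q" "adj y q0"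
    and adjP: "\<And>p. p \<in> P \<Longrightarrow> p \<noteq> p0 \<Longrightarrow> adj x p" and adjQ: "\<And>q. q \<in> Q \<Longrightarrow> q \<noteq> q0 \<Longrightarrow> adj z q"
    and o: "o1 \<in> P" "o2 \<in> P" "o1 \<noteq> o2" "(x, o1) \<in> E" "(x, o2) \<in> E"
  shows "in_list s V E"
proof -
  note noQ = two_out_nbs(1)[OF o] and noz = two_out_nbs(2)[OF o] and inp = two_out_nbs(3)[OF o]
  have toz: "(q, z) \<in> E" if "q \<in> Q" "q \<noteq> q0" for q
    using adjQ noz that by (auto simp: adj_def)
  have "\<exists>q\<in>Q. \<exists>q'\<in>Q. q \<noteq> q'" using card_Q s_ge by (intro two_elements) simp
  then obtain q1 where q1: "q1 \<in> Q" "q1 \<noteq> q0" by metis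
  \<comment> \<open>\<open>q1\<close> already reaches \<open>x\<close> through \<open>z\<close>; a
    vertex \<open>p\<close> pointing to \<open>x\<close> would by \<open>inp\<close> receive an arc
    from \<open>q1\<close> and give a second walk.\<close>
  have "(p, x) \<notin> E" if "p \<in> P" for p
    using unique_mid[of q1 z x p] toz[OF q1] tri(3) inp[OF that _ q1(1)] disj that by auto
  then have out: "(x, p) \<in> E" if "p \<in> P" "p \<noteq> p0" for p
    using adjP that by (auto simp: adj_def)
  have x_p0: "(x, p0) \<notin> E"
    using attached_unique[of p0 x y] p0 xyz_distinct by (auto simp: adj_def)
  obtain m qb where mt: "matched m p0 qb" and ny: "\<forall>q\<in>Q - {qb}. (y, q) \<notin> E"
    by (rule matching_except_one[OF p0(1) x_p0 out])
  note m = matchedD(1-4)[OF mt] ny[rule_format]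
  have qb_out: "(p, qb) \<notin> E" if "p \<in> P - {p0}" for p
  proof -
    have "m p \<in> Q - {qb}" using m(2) that by (auto dest: bij_betwE)
    then show ?thesis using m(1,3) that by auto
  qed
  show ?thesis
  proof (cases "(p0, qb) \<in> E")
    case False
    then have "(y, qb) \<in> E"
      using in_source[OF m(1)] noQ noz m(1) qb_out by blast
    then have qb: "qb = q0"
      using attached_unique[of qb y z] adjQ m(1) xyz_distinct by (auto simp: adj_def)
    have qb_p0: "(qb, p0) \<in> E" using complete False p0 m(1) by blast
    then have "(y, p0) \<notin> E" using no_shortcut \<open>(y, qb) \<in> E\<close> by blast
    then have p0_y: "(p0, y) \<in> E" using p0 by (auto simp: adj_def)
    obtain p g where "enumerated s p g p0 qb"
      by (rule matching_enumeration[OF mt index_mem(2)])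
    note pg = enumeratedD[OF this]
    show ?thesis
    proof (rule in_list_C[where a = z and b = x and c = y and p = p and g = g])
      show "adm V E (Suc s)" by unfold_locales
      show "V = {z, x, y} \<union> p ` {1..s} \<union> g ` {1..s}" using verts pg(1,2) by auto
      show "(p i, g i) \<in> E \<and> (x, p i) \<in> E \<and> (g i, z) \<in> E" if "1 \<le> i" "i < s" for i
        using pg(5)[of i] that out toz qb by auto
      show "(g j, p i) \<in> E" if "i \<in> {1..s}" "j \<in> {1..s}" "i \<noteq> j" for i j using pg(6) that .
      show "(g s, p s) \<in> E" "(p s, y) \<in> E" "(y, g s) \<in> E" unfolding pg(3,4)
        using p0_y qb_p0 \<open>(y, qb) \<in> E\<close> by auto
    qed (use tri s_ge in auto)
  next
    case True
    \<comment> \<open>Otherwise \<open>q0\<close> would point to \<open>p0\<close>, and the cyclic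
      triangle on \<open>q0\<close>, \<open>p0\<close>, \<open>y\<close> would contain the arc from
      \<open>y\<close> to \<open>q0\<close> that \<open>m(5)\<close> excludes.\<close>
    have qb: "q0 = qb"
    proof (rule ccontr)
      assume "q0 \<noteq> qb"
      then have "(q0, p0) \<in> E" "(y, q0) \<notin> E" using m(4,5) q0 by auto
      then show False
        using triangle_directed[of q0 p0 y] p0(2) q0(2) adj_commute by blast
    qed
    then have hub: "(q0, y) \<in> E" "(y, p0) \<in> E"
      using triangle_directed[of p0 q0 y] True p0(2) q0(2) adj_commute by blast+
    obtain p g where "enumerated 1 p g p0 qb"
      by (rule matching_enumeration[OF mt index_mem(1)])
    note pg = enumeratedD[OF this]
    show ?thesis
    proof (rule in_list_D[where a = z and b = x and c = y and p = p and g = g])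
      show "adm V E (Suc s)" by unfold_locales
      show "V = {z, x, y} \<union> p ` {1..s} \<union> g ` {1..s}" using verts pg(1,2) by auto
      show "(p i, g i) \<in> E" if "i \<in> {1..s}" for i
        using pg(3-5) that True by (cases "i = 1") auto
      show "(x, p i) \<in> E \<and> (g i, z) \<in> E" if "1 < i" "i \<le> s" for i
        using pg(5)[of i] that out toz qb by auto
      show "(g j, p i) \<in> E" if "i \<in> {1..s}" "j \<in> {1..s}" "i \<noteq> j" for i j using pg(6) that .
      show "(y, p 1) \<in> E" "(g 1, y) \<in> E" unfolding pg(3,4) using hub qb by auto
    qed (use tri s_ge in auto)
  qed
qed

text \<open>Here the second directed triangle \<open>z \<rightarrow> p0 \<rightarrow> q0 \<rightarrow> z\<close> becomes the base triangle of \<open>C\<^sub>r\<close>,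
  while \<open>y\<close> and \<open>x\<close> take the places of \<open>x\<^sub>r\<^sub>-\<^sub>1\<close> and \<open>y\<^sub>r\<^sub>-\<^sub>1\<close>.\<close>

lemma hub_z_out:
  assumes p0: "p0 \<in> P" "adj z p0" and q0: "q0 \<in> Q" "adj z q0"
    and adjP: "\<And>p. p \<in> P \<Longrightarrow> p \<noteq> p0 \<Longrightarrow> adj x p" and adjQ: "\<And>q. q \<in> Q \<Longrightarrow> q \<noteq> q0 \<Longrightarrow> adj y q"
    and o: "o1 \<in> P" "o2 \<in> P" "o1 \<noteq> o2" "(x, o1) \<in> E" "(x, o2) \<in> E"
  shows "in_list s V E"
proof -
  note noQ = two_out_nbs(1)[OF o] and noz = two_out_nbs(2)[OF o] and inp = two_out_nbs(3)[OF o]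
  have q0z: "(q0, z) \<in> E" using q0 noz by (auto simp: adj_def)
  have "(p, x) \<notin> E" if "p \<in> P" for p
    using unique_mid[of q0 z x p] q0z tri(3) inp[OF that _ q0(1)] disj that by auto
  then have out: "(x, p) \<in> E" if "p \<in> P" "p \<noteq> p0" for p
    using adjP that by (auto simp: adj_def)
  have x_p0: "(x, p0) \<notin> E"
    using attached_unique[of p0 x z] p0 xyz_distinct by (auto simp: adj_def)
  obtain m qb where mt: "matched m p0 qb" and ny: "\<forall>q\<in>Q - {qb}. (y, q) \<notin> E"
    by (rule matching_except_one[OF p0(1) x_p0 out])
  note m = matchedD(1-4)[OF mt] ny[rule_format]
  \<comment> \<open>The arc from \<open>q0\<close> to \<open>z\<close> orients the triangle on
    \<open>q0\<close>, \<open>z\<close>, \<open>p0\<close>; its arc from \<open>p0\<close> to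
    \<open>q0\<close> contradicts \<open>m(4)\<close> unless \<open>q0\<close> is the unmatched
    vertex.\<close>
  have hub: "(z, p0) \<in> E" "(p0, q0) \<in> E"
    using triangle_directed[of q0 z p0] q0z p0 q0 adj_PQ adj_commute by blast+
  then have qb: "qb = q0" using m(4) q0(1) no_2cycle by blast
  have to_y: "(q, y) \<in> E" if "q \<in> Q" "q \<noteq> q0" for q
    using adjQ m(5) qb that by (auto simp: adj_def)
  have q0_out: "(q0, p) \<in> E" if "p \<in> P" "p \<noteq> p0" for p
  proof -
    have "m p \<in> Q - {qb}" using m(2) that by (auto dest: bij_betwE)
    then have "(p, q0) \<notin> E" using m(3)[of p q0] that q0(1) qb by auto
    then show ?thesis using complete that q0(1) by blast
  qed
  obtain p g where "enumerated s p g p0 qb"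
      by (rule matching_enumeration[OF mt index_mem(2)])
    note pg = enumeratedD[OF this]
  have ins: "{1..s} = insert s {1..<s}" using s_ge by auto
  show ?thesis
  proof (rule in_list_C[where a = p0 and b = q0 and c = z and p = "p(s := y)" and g = "g(s := x)"])
    show "adm V E (Suc s)" by unfold_locales
    have "p ` {1..<s} \<union> {p0} = P" "g ` {1..<s} \<union> {q0} = Q"
      using pg(1-4) qb unfolding ins by auto
    then show "V = {p0, q0, z} \<union> (p(s := y)) ` {1..s} \<union> (g(s := x)) ` {1..s}"
      unfolding verts ins by auto
    show "((p(s := y)) i, (g(s := x)) i) \<in> E \<and> (q0, (p(s := y)) i) \<in> E \<and> ((g(s := x)) i, p0) \<in> E"
      if "1 \<le> i" "i < s" for i
      using pg(5)[of i] that q0_out m(4) by auto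
    show "((g(s := x)) j, (p(s := y)) i) \<in> E" if "i \<in> {1..s}" "j \<in> {1..s}" "i \<noteq> j" for i j
      using pg(5)[of i] pg(5)[of j] pg(6)[OF that] that out to_y qb by auto
  qed (use tri s_ge hub q0z in auto)
qed

section \<open>Removing the assumption on out-neighbours by reversal\<close>

lemma two_out_or_two_in:
  assumes "A \<subseteq> P" "3 \<le> card A" "\<And>p. p \<in> A \<Longrightarrow> adj x p"
  obtains o1 o2 where "o1 \<in> P" "o2 \<in> P" "o1 \<noteq> o2" "(x, o1) \<in> E" "(x, o2) \<in> E"
    | o1 o2 where "o1 \<in> P" "o2 \<in> P" "o1 \<noteq> o2" "(x, o1) \<in> E\<inverse>" "(x, o2) \<in> E\<inverse>"
proof -
  have "A = {p\<in>A. (x, p) \<in> E} \<union> {p\<in>A. (p, x) \<in> E}" using assms(3) by (auto simp: adj_def)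
  then have "card A \<le> card {p\<in>A. (x, p) \<in> E} + card {p\<in>A. (p, x) \<in> E}"
    using card_Un_le by metis
  then consider "2 \<le> card {p\<in>A. (x, p) \<in> E}" | "2 \<le> card {p\<in>A. (p, x) \<in> E}"
    using assms(2) by linarith
  then show thesis
  proof cases
    case 1
    then show ?thesis using two_elements that(1) assms(1) by blast
  next
    case 2
    then show ?thesis using two_elements that(2) assms(1) by blast
  qed
qed

text \<open>Two rotations bring \<open>x\<close> back to the first place, so that lemmas about
  \<open>x\<close> apply to the reversed digraph; there \<open>y\<close> and \<open>z\<close> have
  exchanged their places.\<close>

lemma config_converse': "config V (E\<inverse>) s x z y P Q"
  using config.config_rotate[OF config.config_rotate[OF config_converse]] .

lemma cover_P:
  assumes "\<And>p. p \<in> P \<Longrightarrow> adj x p"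
  shows "in_list s V E"
proof -
  have "3 \<le> card P" using card_P s_ge by simp
  from order_refl this assms show ?thesis
  proof (rule two_out_or_two_in)
    fix o1 o2
    assume "o1 \<in> P" "o2 \<in> P" "o1 \<noteq> o2" "(x, o1) \<in> E" "(x, o2) \<in> E"
    then show ?thesis using cover_P_out assms by blast
  next
    fix o1 o2
    assume inn: "o1 \<in> P" "o2 \<in> P" "o1 \<noteq> o2" "(x, o1) \<in> E\<inverse>" "(x, o2) \<in> E\<inverse>"
    interpret c: config V "E\<inverse>" s x z y P Q by (rule config_converse')
    have "in_list s V (E\<inverse>)"
      using c.cover_P_out[OF _ inn] assms by (simp add: adj_converse)
    then show ?thesis using in_list_converse[OF _ s_ge] adm_axioms by blast
  qed
qed

text \<open>Reversal exchanges \<open>y\<close> and \<open>z\<close>: a hub at \<open>y\<close> with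
  two in-neighbours of \<open>x\<close> becomes a hub at \<open>z\<close> with two out-neighbours,
  and conversely. Hence both orders of \<open>y\<close> and \<open>z\<close> are treated at
  once.\<close>

lemma hub:
  assumes p0: "p0 \<in> P" and q0: "q0 \<in> Q" and a: "{a, b} = {y, z}" and "adj a p0" "adj a q0"
    and adjP: "\<And>p. p \<in> P \<Longrightarrow> p \<noteq> p0 \<Longrightarrow> adj x p" and adjQ: "\<And>q. q \<in> Q \<Longrightarrow> q \<noteq> q0 \<Longrightarrow> adj b q"
  shows "in_list s V E"
proof -
  have ab: "a = y \<and> b = z \<or> a = z \<and> b = y" using a by (auto simp: doubleton_eq_iff)
  have "P - {p0} \<subseteq> P" "3 \<le> card (P - {p0})" "\<And>p. p \<in> P - {p0} \<Longrightarrow> adj x p"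
    using card_P s_ge p0 adjP by auto
  then show ?thesis
  proof (rule two_out_or_two_in)
    fix o1 o2
    assume "o1 \<in> P" "o2 \<in> P" "o1 \<noteq> o2" "(x, o1) \<in> E" "(x, o2) \<in> E"
    then show ?thesis
      using ab hub_y_out[OF p0 _ q0] hub_z_out[OF p0 _ q0] assms(4-7) by metis
  next
    fix o1 o2
    assume inn: "o1 \<in> P" "o2 \<in> P" "o1 \<noteq> o2" "(x, o1) \<in> E\<inverse>" "(x, o2) \<in> E\<inverse>"
    interpret c: config V "E\<inverse>" s x z y P Q by (rule config_converse')
    have "in_list s V (E\<inverse>)"
      using ab c.hub_y_out[OF p0 _ q0, of o1 o2] c.hub_z_out[OF p0 _ q0, of o1 o2] inn assms(4-7)
      unfolding adj_converse by metis
    then show ?thesis using in_list_converse[OF _ s_ge] adm_axioms by blast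
  qed
qed

text \<open>Pigeonhole: at least four vertices of \<open>P\<close> are shared by three triangle
  vertices.\<close>

lemma some_two_nb:
  obtains a where "a \<in> {x, y, z}" "2 \<le> card (nb P a)"
proof -
  have "P = nb P x \<union> nb P y \<union> nb P z" using attached_adj by (auto simp: nb_def)
  then have "card P = card (nb P x \<union> nb P y \<union> nb P z)" by simp
  then have "card P \<le> card (nb P x) + card (nb P y) + card (nb P z)"
    using card_Un_le[of "nb P x \<union> nb P y" "nb P z"] card_Un_le[of "nb P x" "nb P y"] by linarith
  then show thesis using that[of x] that[of y] that[of z] card_P s_ge by fastforce
qed

lemma two_nb_no_Q:
  assumes "2 \<le> card (nb P a)"
  shows "nb Q a = {}"
proof -
  obtain p1 p2 where "p1 \<in> nb P a" "p2 \<in> nb P a" "p1 \<noteq> p2" using two_elements[OF assms] by blast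
  then show ?thesis using no_Q_nb[of p1 p2 a] by (auto simp: nb_def)
qed

end

section \<open>Distribution of the two sides over the triangle\<close>

context config
begin

text \<open>A triangle vertex with two neighbours on one side has none on the other. So
  \<open>x\<close> sees only \<open>P\<close>, some \<open>b\<close> sees only \<open>Q\<close>, and
  the third vertex \<open>a\<close> either misses a side, which is then covered by \<open>x\<close>
  or \<open>b\<close> alone, or has exactly one neighbour on each side and is a hub.\<close>

lemma in_list_of_x:
  assumes x: "2 \<le> card (nb P x)"
  shows "in_list s V E"
proof -
  interpret swp: config V E s x y z Q P by (rule config_swap)
  interpret swp_y: config V E s y z x Q P by (rule swp.config_rotate)
  interpret swp_z: config V E s z x y Q P by (rule swp_y.config_rotate)
  have xQ: "nb Q x = {}" by (rule two_nb_no_Q[OF x])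
  obtain b where b: "b \<in> {x, y, z}" "2 \<le> card (nb Q b)" by (rule swp.some_two_nb)
  then have "b \<noteq> x" using xQ by auto
  have bP: "nb P b = {}" by (rule swp.two_nb_no_Q[OF b(2)])
  obtain a where a: "{a, b} = {y, z}" using b(1) \<open>b \<noteq> x\<close> by blast
  then have axyz: "{x, a, b} = {x, y, z}" "a \<in> {x, y, z}" by auto
  have covP: "adj x p \<or> adj a p" if "p \<in> P" for p
    using attached_adj[of p] that bP axyz by (auto simp: nb_def)
  have covQ: "adj a q \<or> adj b q" if "q \<in> Q" for q
    using attached_adj[of q] that xQ axyz by (auto simp: nb_def)
  have all_P: ?thesis if "nb P a = {}"
    using cover_P covP that by (auto simp: nb_def)
  have all_Q: ?thesis if "nb Q a = {}"
  proof -
    have "adj b q" if "q \<in> Q" for q using covQ[OF that] \<open>nb Q a = {}\<close> that by (auto simp: nb_def)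
    \<comment> \<open>The configuration with the sides exchanged is rotated so that \<open>b\<close>
      comes first.\<close>
    then show ?thesis using swp_y.cover_P swp_z.cover_P b(1) \<open>b \<noteq> x\<close> by blast
  qed
  show ?thesis
  proof (cases "2 \<le> card (nb P a) \<or> 2 \<le> card (nb Q a) \<or> nb P a = {} \<or> nb Q a = {}")
    case True
    then show ?thesis using all_P all_Q two_nb_no_Q swp.two_nb_no_Q by blast
  next
    case False
    have fin: "finite (nb P a)" "finite (nb Q a)" using finite_PQ by (auto simp: nb_def)
    have "card (nb P a) \<noteq> 0" "card (nb Q a) \<noteq> 0" using False fin by simp_all
    then have "card (nb P a) = 1" "card (nb Q a) = 1" using False by linarith+
    then obtain p0 q0 where "nb P a = {p0}" "nb Q a = {q0}" by (auto simp: card_1_singleton_iff)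
    then have p0: "p0 \<in> P" "adj a p0" "\<And>p. p \<in> P \<Longrightarrow> adj a p \<Longrightarrow> p = p0"
      and q0: "q0 \<in> Q" "adj a q0" "\<And>q. q \<in> Q \<Longrightarrow> adj a q \<Longrightarrow> q = q0"
      by (auto simp: nb_def set_eq_iff)
    show ?thesis
      using hub[OF p0(1) q0(1) a p0(2) q0(2)] covP covQ p0(3) q0(3) by blast
  qed
qed

lemma config_in_list: "in_list s V E"
proof -
  interpret ry: config V E s y z x P Q by (rule config_rotate)
  interpret rz: config V E s z x y P Q by (rule ry.config_rotate)
  show ?thesis
    using some_two_nb in_list_of_x ry.in_list_of_x rz.in_list_of_x by blast
qed

end

theorem admissible_in_list:
  assumes "4 \<le> s" "admissible (Suc s) G"
  shows "\<exists>H\<in>set (dig_list (Suc s)). isomorphic G H"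
proof -
  interpret adm "pverts G" "parcs G" "Suc s" using assms(2) by (simp add: admissible_iff)
  obtain x y z P Q where "config (pverts G) (parcs G) s x y z P Q"
    using config_exists assms(1) by auto
  then have "in_list s (pverts G) (parcs G)" by (rule config.config_in_list)
  moreover have "\<lparr>pverts = pverts G, parcs = parcs G\<rparr> = G" by simp
  ultimately show ?thesis by (simp only: in_list_def)
qed

section \<open>Pairwise non-isomorphism\<close>

definition outdeg :: "('v \<times> 'v) set \<Rightarrow> 'v \<Rightarrow> nat" where
  "outdeg E v = card (E `` {v})"

definition indeg :: "('v \<times> 'v) set \<Rightarrow> 'v \<Rightarrow> nat" where
  "indeg E v = card (E\<inverse> `` {v})"

lemma deg_converse: "outdeg (E\<inverse>) = indeg E" "indeg (E\<inverse>) = outdeg E"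
  by (simp_all add: fun_eq_iff outdeg_def indeg_def)

text \<open>With \<open>d = r\<close> a probe for \<open>t\<close>: in
  \<open>B\<^sub>r\<^sub>,\<^sub>t\<close> only \<open>x\<close> has out-degree \<open>r\<close>,
  and its only in-neighbour \<open>z\<close> has in-degree \<open>r - t\<close>.\<close>

definition pred_indegs :: "nat \<Rightarrow> ('v \<times> 'v) set \<Rightarrow> nat set" where
  "pred_indegs d E = {indeg E v | u v. (v, u) \<in> E \<and> outdeg E u = d}"

text \<open>In \<open>C\<^sub>r\<close> and \<open>D\<^sub>r\<close> only \<open>z\<close> has both
  degrees 2. Besides \<open>x\<close> it points to \<open>y\<^sub>r\<^sub>-\<^sub>1\<close>, of
  out-degree \<open>r - 1\<close>, in the former and to \<open>x\<^sub>1\<close>, of out-degree 1,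
  in the latter. In \<open>A\<^sub>r\<close> no vertex has both degrees 2.\<close>

definition hub_outdegs :: "('v \<times> 'v) set \<Rightarrow> nat set" where
  "hub_outdegs E = {outdeg E v | u v. (u, v) \<in> E \<and> outdeg E u = 2 \<and> indeg E u = 2}"

text \<open>The first component separates the digraphs \<open>B\<^sub>r\<^sub>,\<^sub>t\<close>, the second their converses, and the third
  the remaining \<open>A\<^sub>r\<close>, \<open>C\<^sub>r\<close>, \<open>D\<^sub>r\<close>; a component is blanked where an earlier one already decides.\<close>

definition key :: "nat \<Rightarrow> ('v \<times> 'v) set \<Rightarrow> nat set \<times> nat set \<times> nat set" where
  "key d E = (let I = pred_indegs d E; J = pred_indegs d (E\<inverse>) in
     (I, if I = {} then J else {}, if I = {} \<and> J = {} then hub_outdegs E else {}))"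

lemma outdeg_image:
  assumes "inj_on f V" "E \<subseteq> V \<times> V" "v \<in> V"
  shows "outdeg (map_prod f f ` E) (f v) = outdeg E v"
proof -
  have "(map_prod f f ` E) `` {f v} = f ` (E `` {v})"
  proof (intro set_eqI iffI)
    fix w assume "w \<in> (map_prod f f ` E) `` {f v}"
    then obtain a b where ab: "(a, b) \<in> E" "f a = f v" "w = f b" by auto
    then have "a = v" using inj_onD[OF assms(1)] assms(2,3) by blast
    then show "w \<in> f ` (E `` {v})" using ab by blast
  next
    fix w assume "w \<in> f ` (E `` {v})"
    then show "w \<in> (map_prod f f ` E) `` {f v}" by force
  qed
  moreover have "inj_on f (E `` {v})"
    using assms(1,2) by (rule_tac inj_on_subset) auto
  ultimately show ?thesis by (simp add: outdeg_def card_image)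
qed

lemma converse_image: "(map_prod f f ` E)\<inverse> = map_prod f f ` (E\<inverse>)"
  by (auto simp: image_iff; force)

lemma indeg_image:
  assumes "inj_on f V" "E \<subseteq> V \<times> V" "v \<in> V"
  shows "indeg (map_prod f f ` E) (f v) = indeg E v"
proof -
  have "E\<inverse> \<subseteq> V \<times> V" using assms(2) by auto
  then have "outdeg (map_prod f f ` (E\<inverse>)) (f v) = outdeg (E\<inverse>) v"
    using assms by (intro outdeg_image)
  then show ?thesis
    by (simp only: deg_converse converse_image[symmetric])
qed

lemma key_image:
  assumes inj: "inj_on f V" and sub: "E \<subseteq> V \<times> V"
  shows "key d (map_prod f f ` E) = key d E"
proof -
  have pred: "pred_indegs d (map_prod f f ` F) = pred_indegs d F" if F: "F \<subseteq> V \<times> V" for F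
  proof -
    have "pred_indegs d (map_prod f f ` F) =
        {indeg (map_prod f f ` F) (f v) | u v. (v, u) \<in> F \<and> outdeg (map_prod f f ` F) (f u) = d}"
      unfolding pred_indegs_def by blast
    also have "\<dots> = pred_indegs d F"
      unfolding pred_indegs_def using outdeg_image[OF inj F] indeg_image[OF inj F] F
      by (intro Collect_cong) (metis SigmaD1 SigmaD2 subsetD)
    finally show ?thesis .
  qed
  have "hub_outdegs (map_prod f f ` E) = {outdeg (map_prod f f ` E) (f v) | u v. (u, v) \<in> E \<and>
      outdeg (map_prod f f ` E) (f u) = 2 \<and> indeg (map_prod f f ` E) (f u) = 2}"
    unfolding hub_outdegs_def by blast
  also have "\<dots> = hub_outdegs E"
    unfolding hub_outdegs_def using outdeg_image[OF inj sub] indeg_image[OF inj sub] sub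
    by (intro Collect_cong) (metis SigmaD1 SigmaD2 subsetD)
  finally have hub: "hub_outdegs (map_prod f f ` E) = hub_outdegs E" .
  have "E\<inverse> \<subseteq> V \<times> V" using sub by auto
  then show ?thesis
    by (simp only: key_def converse_image pred[OF sub] pred hub)
qed

lemma isomorphic_key:
  assumes "adm (pverts G) (parcs G) r" "isomorphic G H"
  shows "key d (parcs G) = key d (parcs H)"
proof -
  interpret adm "pverts G" "parcs G" r by fact
  show ?thesis
    using isomorphic_iff[OF adm_pair_wf_digraph[OF assms(1)]] assms(2) key_image[OF _ arcs_subset] by metis
qed

lemma card_index_image: "card (VX ` I) = card I" "card (VY ` I) = card I"
  by (simp_all add: card_image inj_on_def)

lemma degrees_A:
  assumes "4 \<le> s" "v \<in> std_verts (Suc s)"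
  shows "outdeg (parcs (dig_A (Suc s))) v = case_vertex s 2 1 (\<lambda>_. 1) (\<lambda>_. s) v"
    and "indeg (parcs (dig_A (Suc s))) v = case_vertex 2 s 1 (\<lambda>_. s) (\<lambda>_. 1) v"
proof -
  let ?E = "parcs (dig_A (Suc s))"
  have s1: "1 \<le> s" using assms(1) by simp
  have out: "w \<in> ?E `` {v} \<longleftrightarrow> w \<in> case_vertex (insert Vy (VX ` {1..<s})) {Vz, VY s} {Vx}
      (\<lambda>i. {if i < s then VY i else Vx})
      (\<lambda>i. if i < s then insert Vy (VX ` ({1..s} - {i})) else VX ` {1..s}) v" for w
    using assms(2) by (cases v) (auto simp: arcs_A[OF s1] std_verts_Suc)
  show "outdeg ?E v = case_vertex s 2 1 (\<lambda>_. 1) (\<lambda>_. s) v"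
    unfolding outdeg_def set_eqI[OF out] using assms
    by (cases v) (auto simp: card_index_image card_insert_if std_verts_Suc image_iff)
  have into: "w \<in> ?E\<inverse> `` {v} \<longleftrightarrow> w \<in> case_vertex {Vz, VX s} (insert Vx (VY ` {1..<s})) {Vy}
      (\<lambda>i. if i < s then insert Vx (VY ` ({1..s} - {i})) else VY ` {1..s})
      (\<lambda>i. {if i < s then VX i else Vy}) v" for w
    using assms(2) by (cases v; cases w) (auto simp: arcs_A[OF s1] std_verts_Suc)
  show "indeg ?E v = case_vertex 2 s 1 (\<lambda>_. s) (\<lambda>_. 1) v"
    unfolding indeg_def set_eqI[OF into] using assms
    by (cases v) (auto simp: card_index_image card_insert_if std_verts_Suc image_iff)
qed

lemma degrees_B:
  assumes "4 \<le> s" "t \<le> s" "v \<in> std_verts (Suc s)"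
  shows "outdeg (parcs (dig_B (Suc s) t)) v = case_vertex (Suc s) 1 1 (\<lambda>_. 1) (\<lambda>_. s) v"
    and "indeg (parcs (dig_B (Suc s) t)) v = case_vertex 1 (Suc t) (Suc (s - t)) (\<lambda>_. s) (\<lambda>_. 1) v"
proof -
  let ?E = "parcs (dig_B (Suc s) t)"
  have out: "w \<in> ?E `` {v} \<longleftrightarrow> w \<in> case_vertex (insert Vy (VX ` {1..s})) {Vz} {Vx} (\<lambda>i. {VY i})
      (\<lambda>i. insert (if i \<le> t then Vy else Vz) (VX ` ({1..s} - {i}))) v" for w
    using assms(3) by (cases v) (auto simp: arcs_B[OF assms(2)] std_verts_Suc)
  show "outdeg ?E v = case_vertex (Suc s) 1 1 (\<lambda>_. 1) (\<lambda>_. s) v"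
    unfolding outdeg_def set_eqI[OF out] using assms
    by (cases v) (auto simp: card_index_image card_insert_if std_verts_Suc image_iff)
  have into: "w \<in> ?E\<inverse> `` {v} \<longleftrightarrow> w \<in> case_vertex {Vz} (insert Vx (VY ` {1..t})) (insert Vy (VY ` {t+1..s}))
      (\<lambda>i. insert Vx (VY ` ({1..s} - {i}))) (\<lambda>i. {VX i}) v" for w
    using assms(2,3) by (cases v; cases w) (auto simp: arcs_B[OF assms(2)] std_verts_Suc)
  show "indeg ?E v = case_vertex 1 (Suc t) (Suc (s - t)) (\<lambda>_. s) (\<lambda>_. 1) v"
    unfolding indeg_def set_eqI[OF into] using assms
    by (cases v) (auto simp: card_index_image card_insert_if std_verts_Suc image_iff)
qed

lemma degrees_C:
  assumes "4 \<le> s" "v \<in> std_verts (Suc s)"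
  shows "outdeg (parcs (dig_C (Suc s))) v = case_vertex 1 s 2 (\<lambda>_. 1) (\<lambda>_. s) v"
    and "indeg (parcs (dig_C (Suc s))) v = case_vertex s 1 2 (\<lambda>_. s) (\<lambda>_. 1) v"
proof -
  let ?E = "parcs (dig_C (Suc s))"
  have s1: "1 \<le> s" using assms(1) by simp
  have out: "w \<in> ?E `` {v} \<longleftrightarrow> w \<in> case_vertex {Vy} (insert Vz (VX ` {1..<s})) {Vx, VY s}
      (\<lambda>i. {if i < s then VY i else Vz})
      (\<lambda>i. if i < s then insert Vx (VX ` ({1..s} - {i})) else VX ` {1..s}) v" for w
    using assms(2) by (cases v) (auto simp: arcs_C[OF s1] std_verts_Suc)
  show "outdeg ?E v = case_vertex 1 s 2 (\<lambda>_. 1) (\<lambda>_. s) v"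
    unfolding outdeg_def set_eqI[OF out] using assms
    by (cases v) (auto simp: card_index_image card_insert_if std_verts_Suc image_iff)
  have into: "w \<in> ?E\<inverse> `` {v} \<longleftrightarrow> w \<in> case_vertex (insert Vz (VY ` {1..<s})) {Vx} {Vy, VX s}
      (\<lambda>i. if i < s then insert Vy (VY ` ({1..s} - {i})) else VY ` {1..s})
      (\<lambda>i. {if i < s then VX i else Vz}) v" for w
    using assms(2) by (cases v; cases w) (auto simp: arcs_C[OF s1] std_verts_Suc)
  show "indeg ?E v = case_vertex s 1 2 (\<lambda>_. s) (\<lambda>_. 1) v"
    unfolding indeg_def set_eqI[OF into] using assms
    by (cases v) (auto simp: card_index_image card_insert_if std_verts_Suc image_iff)
qed

text \<open>The degrees agree with those of \<open>dig_C\<close> vertex by vertex, so only a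
  quantity read along arcs can separate the two digraphs.\<close>

lemma degrees_D:
  assumes "4 \<le> s" "v \<in> std_verts (Suc s)"
  shows "outdeg (parcs (dig_D (Suc s))) v = case_vertex 1 s 2 (\<lambda>_. 1) (\<lambda>_. s) v"
    and "indeg (parcs (dig_D (Suc s))) v = case_vertex s 1 2 (\<lambda>_. s) (\<lambda>_. 1) v"
proof -
  let ?E = "parcs (dig_D (Suc s))"
  have s1: "1 \<le> s" using assms(1) by simp
  have out: "w \<in> ?E `` {v} \<longleftrightarrow> w \<in> case_vertex {Vy} (insert Vz (VX ` {2..s})) {Vx, VX 1} (\<lambda>i. {VY i})
      (\<lambda>i. insert (if i = 1 then Vz else Vx) (VX ` ({1..s} - {i}))) v" for w
    using assms(2) by (cases v) (auto simp: arcs_D[OF s1] std_verts_Suc)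
  show "outdeg ?E v = case_vertex 1 s 2 (\<lambda>_. 1) (\<lambda>_. s) v"
    unfolding outdeg_def set_eqI[OF out] using assms
    by (cases v) (auto simp: card_index_image card_insert_if std_verts_Suc image_iff)
  have into: "w \<in> ?E\<inverse> `` {v} \<longleftrightarrow> w \<in> case_vertex (insert Vz (VY ` {2..s})) {Vx} {Vy, VY 1}
      (\<lambda>i. insert (if i = 1 then Vz else Vy) (VY ` ({1..s} - {i}))) (\<lambda>i. {VX i}) v" for w
    using assms(2) s1 by (cases v; cases w) (auto simp: arcs_D[OF s1] std_verts_Suc split: if_splits)
  show "indeg ?E v = case_vertex s 1 2 (\<lambda>_. s) (\<lambda>_. 1) v"
    unfolding indeg_def set_eqI[OF into] using assms
    by (cases v) (auto simp: card_index_image card_insert_if std_verts_Suc image_iff)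
qed

text \<open>Meant for \<open>d = r\<close>: no vertex of \<open>A\<^sub>r\<close>,
  \<open>C\<^sub>r\<close> or \<open>D\<^sub>r\<close> has an in-degree or out-degree that
  large.\<close>

lemma pred_indegs_empty:
  assumes "adm V E r" "\<And>v. v \<in> V \<Longrightarrow> outdeg E v \<noteq> d" "\<And>v. v \<in> V \<Longrightarrow> indeg E v \<noteq> d"
  shows "pred_indegs d E = {}" "pred_indegs d (E\<inverse>) = {}"
proof -
  interpret adm V E r by fact
  show "pred_indegs d E = {}" "pred_indegs d (E\<inverse>) = {}"
    using assms(2,3) arcs_subset by (auto simp: pred_indegs_def deg_converse)
qed

lemma keys:
  assumes s: "4 \<le> s"
  shows "key (Suc s) (parcs (dig_A (Suc s))) = ({}, {}, {})"
    and "key (Suc s) (parcs (dig_C (Suc s))) = ({}, {}, {1, s})"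
    and "key (Suc s) (parcs (dig_D (Suc s))) = ({}, {}, {1})"
    and "t \<le> s \<Longrightarrow> key (Suc s) (parcs (dig_B (Suc s) t)) = ({Suc (s - t)}, {}, {})"
    and "1 \<le> t \<Longrightarrow> t < s \<Longrightarrow> key (Suc s) (parcs (converse_digraph (dig_B (Suc s) t))) = ({}, {Suc (s - t)}, {})"
proof -
  have s1: "1 \<le> s" using s by simp
  note degs = degrees_A[OF s] degrees_C[OF s] degrees_D[OF s]
  have A: "pred_indegs (Suc s) (parcs (dig_A (Suc s))) = {}" "pred_indegs (Suc s) ((parcs (dig_A (Suc s)))\<inverse>) = {}"
    by (rule pred_indegs_empty[OF adm_A[OF s]]; use s in \<open>simp add: degs split: vertex.split\<close>)+
  have C: "pred_indegs (Suc s) (parcs (dig_C (Suc s))) = {}" "pred_indegs (Suc s) ((parcs (dig_C (Suc s)))\<inverse>) = {}"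
    by (rule pred_indegs_empty[OF adm_C[OF s]]; use s in \<open>simp add: degs split: vertex.split\<close>)+
  have D: "pred_indegs (Suc s) (parcs (dig_D (Suc s))) = {}" "pred_indegs (Suc s) ((parcs (dig_D (Suc s)))\<inverse>) = {}"
    by (rule pred_indegs_empty[OF adm_D[OF s]]; use s in \<open>simp add: degs split: vertex.split\<close>)+
  have sub: "u \<in> std_verts (Suc s) \<and> v \<in> std_verts (Suc s)"
    if "(u, v) \<in> parcs H" "H \<in> set (dig_list (Suc s))" "pverts H = std_verts (Suc s)" for u v H
    using adm.axioms(1)[OF adm_dig_list[OF s that(2)]] that(1,3) two_geodetic.arcs_subset by fastforce
  have in_l: "dig_A (Suc s) \<in> set (dig_list (Suc s))" "dig_C (Suc s) \<in> set (dig_list (Suc s))"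
    "dig_D (Suc s) \<in> set (dig_list (Suc s))" "t \<le> s \<Longrightarrow> dig_B (Suc s) t \<in> set (dig_list (Suc s))" for t
    using set_dig_list[OF s1] by blast+
  have xyz: "Vx \<in> std_verts (Suc s)" "Vy \<in> std_verts (Suc s)" "Vz \<in> std_verts (Suc s)"
    "VX 1 \<in> std_verts (Suc s)" "VY s \<in> std_verts (Suc s)"
    using s by (simp_all add: std_verts_Suc)
  have "hub_outdegs (parcs (dig_A (Suc s))) = {}"
  proof -
    have "\<not> (outdeg (parcs (dig_A (Suc s))) u = 2 \<and> indeg (parcs (dig_A (Suc s))) u = 2)"
      if "(u, v) \<in> parcs (dig_A (Suc s))" for u v
      using sub[OF that in_l(1)] s by (simp add: degs split: vertex.split)
    then show ?thesis by (auto simp: hub_outdegs_def)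
  qed
  then show "key (Suc s) (parcs (dig_A (Suc s))) = ({}, {}, {})" using A by (simp add: key_def)
  have hub: "outdeg (parcs H) u = 2 \<and> indeg (parcs H) u = 2 \<longleftrightarrow> u = Vz"
    if "(u, v) \<in> parcs H" "H = dig_C (Suc s) \<or> H = dig_D (Suc s)" for u v H
    using that(2) sub[OF that(1)] in_l s by (elim disjE) (auto simp: degs split: vertex.splits)
  have "hub_outdegs (parcs (dig_C (Suc s))) = {outdeg (parcs (dig_C (Suc s))) v | v. (Vz, v) \<in> parcs (dig_C (Suc s))}"
    using hub unfolding hub_outdegs_def by blast
  also have "\<dots> = {outdeg (parcs (dig_C (Suc s))) Vx, outdeg (parcs (dig_C (Suc s))) (VY s)}"
    by (auto simp: arcs_C[OF s1])
  also have "\<dots> = {1, s}" using xyz by (simp add: degs)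
  finally show "key (Suc s) (parcs (dig_C (Suc s))) = ({}, {}, {1, s})" using C by (simp add: key_def)
  have "hub_outdegs (parcs (dig_D (Suc s))) = {outdeg (parcs (dig_D (Suc s))) v | v. (Vz, v) \<in> parcs (dig_D (Suc s))}"
    using hub unfolding hub_outdegs_def by blast
  also have "\<dots> = {outdeg (parcs (dig_D (Suc s))) Vx, outdeg (parcs (dig_D (Suc s))) (VX 1)}"
    by (auto simp: arcs_D[OF s1])
  also have "\<dots> = {1}" using xyz by (simp add: degs)
  finally show "key (Suc s) (parcs (dig_D (Suc s))) = ({}, {}, {1})" using D by (simp add: key_def)
  have B: "pred_indegs (Suc s) (parcs (dig_B (Suc s) t)) = {Suc (s - t)}" if t: "t \<le> s" for t
  proof -
    have u: "outdeg (parcs (dig_B (Suc s) t)) u = Suc s \<longleftrightarrow> u = Vx" if "(v, u) \<in> parcs (dig_B (Suc s) t)" for u v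
      using sub[OF that in_l(4)[OF t]] s by (auto simp: degrees_B[OF s t] split: vertex.splits)
    have v: "(v, Vx) \<in> parcs (dig_B (Suc s) t) \<longleftrightarrow> v = Vz" for v
      by (cases v) (auto simp: arcs_B[OF t])
    have iff: "(v, u) \<in> parcs (dig_B (Suc s) t) \<and> outdeg (parcs (dig_B (Suc s) t)) u = Suc s
        \<longleftrightarrow> v = Vz \<and> u = Vx" for u v
      using u v by blast
    have "pred_indegs (Suc s) (parcs (dig_B (Suc s) t)) = {indeg (parcs (dig_B (Suc s) t)) Vz}"
      unfolding pred_indegs_def iff by simp
    then show ?thesis using xyz degrees_B(2)[OF s t] by simp
  qed
  then show "key (Suc s) (parcs (dig_B (Suc s) t)) = ({Suc (s - t)}, {}, {})" if "t \<le> s"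
    using that by (simp add: key_def)
  show "key (Suc s) (parcs (converse_digraph (dig_B (Suc s) t))) = ({}, {Suc (s - t)}, {})"
    if t: "1 \<le> t" "t < s"
  proof -
    \<comment> \<open>The in-degrees of \<open>B\<^sub>r\<^sub>,\<^sub>t\<close> are 1,
      \<open>t + 1\<close>, \<open>s - t + 1\<close> and \<open>s\<close>; they all stay below
      \<open>r\<close> because \<open>0 < t < s\<close>.\<close>
    have "indeg (parcs (dig_B (Suc s) t)) u \<noteq> Suc s" if "(u, v) \<in> parcs (dig_B (Suc s) t)" for u v
      using sub[OF that in_l(4)] s t by (auto simp: degrees_B[OF s less_imp_le[OF t(2)]] split: vertex.splits)
    then have "pred_indegs (Suc s) ((parcs (dig_B (Suc s) t))\<inverse>) = {}"
      by (auto simp: pred_indegs_def deg_converse)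
    then show ?thesis using B[of t] t by (simp add: key_def)
  qed
qed

lemma distinct_keys:
  assumes s: "4 \<le> s"
  shows "distinct (map (\<lambda>H. key (Suc s) (parcs H)) (dig_list (Suc s)))"
proof -
  have "map (\<lambda>H. key (Suc s) (parcs H)) (dig_list (Suc s)) =
      [({}, {}, {}), ({Suc s}, {}, {}), ({1}, {}, {}), ({}, {}, {1, s}), ({}, {}, {1})]
      @ map (\<lambda>t. ({Suc (s - t)}, {}, {})) [1..<s] @ map (\<lambda>t. ({}, {Suc (s - t)}, {})) [1..<s]"
    using keys(1-3)[OF s] keys(4)[OF s, of 0] keys(4)[OF s, of s] keys(4,5)[OF s]
    by (simp add: dig_list_def dig_B'_def)
  also have "distinct \<dots>"
    using s by (auto simp: distinct_map inj_on_def)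
  finally show ?thesis .
qed

lemma dig_list_not_isomorphic:
  assumes "4 \<le> s" "i < length (dig_list (Suc s))" "j < length (dig_list (Suc s))"
    and "isomorphic (dig_list (Suc s) ! i) (dig_list (Suc s) ! j)"
  shows "i = j"
proof -
  have "key (Suc s) (parcs (dig_list (Suc s) ! i)) = key (Suc s) (parcs (dig_list (Suc s) ! j))"
    using isomorphic_key[OF adm_dig_list[OF assms(1)] assms(4)] assms(2) by simp
  then show ?thesis
    using nth_eq_iff_index_eq[OF distinct_keys[OF assms(1)], of i j] assms(2,3) by simp
qed

text \<open>Five single entries and two families of \<open>r - 2\<close> each.\<close>

lemma length_dig_list: "4 \<le> s \<Longrightarrow> length (dig_list (Suc s)) = 2 * Suc s + 1"
  by (simp add: dig_list_def)

section \<open>Counting isomorphism classes\<close>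

definition nat_code :: "vertex \<Rightarrow> nat" where
  "nat_code = case_vertex 0 1 2 (\<lambda>i. 2 * i + 3) (\<lambda>i. 2 * i + 4)"

lemma inj_nat_code: "inj nat_code"
proof (rule injI)
  fix u v assume "nat_code u = nat_code v"
  then show "u = v" unfolding nat_code_def by (cases u; cases v; simp; presburger)
qed

definition nat_copy :: "vertex pair_pre_digraph \<Rightarrow> nat pair_pre_digraph" where
  "nat_copy H = \<lparr>pverts = nat_code ` pverts H, parcs = map_prod nat_code nat_code ` parcs H\<rparr>"

lemma nat_copy:
  assumes "admissible r H"
  shows "admissible r (nat_copy H)" "isomorphic H (nat_copy H)"
proof -
  have inj: "inj_on nat_code (pverts H)" using inj_nat_code inj_on_subset by blast
  have adm: "adm (pverts H) (parcs H) r" using assms by (simp add: admissible_iff)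
  show "admissible r (nat_copy H)"
    using adm_image[OF adm inj] by (simp add: admissible_iff nat_copy_def)
  show "isomorphic H (nat_copy H)"
    unfolding isomorphic_iff[OF adm_pair_wf_digraph[OF adm]] using inj
    by (intro exI[of _ nat_code]) (simp add: nat_copy_def)
qed

text \<open>Sending an index of the list to the class of a copy of its entry on the natural numbers
  is onto by the classification and injective by the distinct keys, so there are as many classes as
  entries.\<close>

lemma card_iso_classes:
  assumes s: "4 \<le> s"
  shows "card (admissible_iso_classes (Suc s)) = 2 * Suc s + 1"
proof -
  let ?L = "dig_list (Suc s)"
  let ?A = "{G :: nat pair_pre_digraph. admissible (Suc s) G}"
  let ?R = "{(G :: nat pair_pre_digraph, H :: nat pair_pre_digraph). admissible (Suc s) G \<and> admissible (Suc s) H \<and> isomorphic G H}"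
  have wf: "pair_wf_digraph G" if "admissible (Suc s) G" for G :: "'v pair_pre_digraph"
    using that adm_pair_wf_digraph by (auto simp: admissible_iff)
  have equiv: "equiv ?A ?R"
    by (rule equivI)
      (auto simp: refl_on_def sym_def trans_def intro: isomorphic_refl isomorphic_sym isomorphic_trans wf)
  have L: "admissible (Suc s) (?L ! i)" if "i < length ?L" for i
    using adm_dig_list[OF s] that by (simp add: admissible_iff)
  let ?c = "\<lambda>i. ?R `` {nat_copy (?L ! i)}"
  have "admissible_iso_classes (Suc s) = ?c ` {..<length ?L}"
  proof (intro set_eqI iffI)
    fix X :: "nat pair_pre_digraph set" assume "X \<in> admissible_iso_classes (Suc s)"
    then obtain G where G: "admissible (Suc s) G" "X = ?R `` {G}"
      by (auto simp: admissible_iso_classes_def elim: quotientE)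
    obtain H where "H \<in> set ?L" "isomorphic G H" using admissible_in_list[OF s G(1)] by blast
    then obtain i where i: "i < length ?L" "isomorphic G (?L ! i)" by (auto simp: in_set_conv_nth)
    then have "(G, nat_copy (?L ! i)) \<in> ?R"
      using nat_copy[OF L[OF i(1)]] G(1) isomorphic_trans by auto
    then have "X = ?c i" unfolding G(2) by (rule equiv_class_eq[OF equiv])
    then show "X \<in> ?c ` {..<length ?L}" using i(1) by blast
  next
    fix X :: "nat pair_pre_digraph set" assume "X \<in> ?c ` {..<length ?L}"
    then obtain i where i: "i < length ?L" "X = ?c i" by blast
    have "nat_copy (?L ! i) \<in> ?A" using nat_copy(1)[OF L[OF i(1)]] by simp
    then show "X \<in> admissible_iso_classes (Suc s)"
      unfolding admissible_iso_classes_def i(2) by (rule quotientI)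
  qed
  moreover have "inj_on ?c {..<length ?L}"
  proof (rule inj_onI)
    fix i j assume ij: "i \<in> {..<length ?L}" "j \<in> {..<length ?L}" "?c i = ?c j"
    have Ni: "admissible (Suc s) (nat_copy (?L ! i))" "isomorphic (?L ! i) (nat_copy (?L ! i))"
      and Nj: "admissible (Suc s) (nat_copy (?L ! j))" "isomorphic (?L ! j) (nat_copy (?L ! j))"
      using nat_copy[OF L] ij(1,2) by blast+
    have "(nat_copy (?L ! i), nat_copy (?L ! j)) \<in> ?R"
    proof (rule eq_equiv_class[OF _ equiv])
      show "?R `` {nat_copy (?L ! i)} = ?R `` {nat_copy (?L ! j)}" using ij(3) .
      show "nat_copy (?L ! j) \<in> ?A" using Nj by simp
    qed
    then have "isomorphic (nat_copy (?L ! i)) (nat_copy (?L ! j))" by simp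
    then have "isomorphic (?L ! i) (nat_copy (?L ! j))"
      by (rule isomorphic_trans[OF Ni(2)])
    moreover have "isomorphic (nat_copy (?L ! j)) (?L ! j)"
      using ij(2) by (intro isomorphic_sym[OF wf[OF L] Nj(2)]) simp
    ultimately have "isomorphic (?L ! i) (?L ! j)" by (rule isomorphic_trans)
    then show "i = j" using dig_list_not_isomorphic[OF s] ij by auto
  qed
  ultimately show ?thesis using length_dig_list[OF s] by (simp add: card_image)
qed

theorem theorem20:
  fixes r :: nat
  assumes "r \<ge> 5"
  shows "(\<forall>G :: 'a pair_pre_digraph. admissible r G \<longrightarrow> (\<exists>H \<in> set (dig_list r). isomorphic G H))
    \<and> (\<forall>H \<in> set (dig_list r). admissible r H)
    \<and> (\<forall>i j. i < j \<and> j < length (dig_list r) \<longrightarrow> \<not> isomorphic (dig_list r ! i) (dig_list r ! j))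
    \<and> card (admissible_iso_classes r) = 2 * r + 1"
proof -
  obtain s where r: "r = Suc s" and s: "4 \<le> s" using assms by (cases r) auto
  show ?thesis
    unfolding r
  proof (intro conjI allI ballI impI)
    show "\<exists>H\<in>set (dig_list (Suc s)). isomorphic G H" if "admissible (Suc s) G" for G :: "'a pair_pre_digraph"
      using admissible_in_list[OF s that] .
    show "admissible (Suc s) H" if "H \<in> set (dig_list (Suc s))" for H
      using adm_dig_list[OF s that] by (simp add: admissible_iff)
    show "\<not> isomorphic (dig_list (Suc s) ! i) (dig_list (Suc s) ! j)"
      if "i < j \<and> j < length (dig_list (Suc s))" for i j
      using dig_list_not_isomorphic[OF s, of i j] that by auto
    show "card (admissible_iso_classes (Suc s)) = 2 * Suc s + 1"
      using card_iso_classes[OF s] .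
  qed
qed

end
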